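(* Let $\phi$ be a quantum channel on $\mathcal M(d;\mathbb C)$ such that the algebraic multiplicity of $0$ as an eigenvalue of $\phi$ satisfies $a_\phi(0)<2(d-1)$ (in particular this holds if $\det\phi\neq 0$). Then the following are equivalent: (1) $\phi$ is entanglement-saving; (2) $\phi$ has a semipositive fixed point, or $|\sigma_P(\phi)|\ge 2$; (3) there exists $1\le n\le d$ such that $\phi^n$ has a semipositive fixed point.
   Context: A quantum channel is a completely positive, trace-preserving linear map on $\mathcal M(d;\mathbb C)$; its spectrum, determinant and algebraic multiplicities refer to $\phi$ as a linear operator on the $d^2$-dimensional space $\mathcal M(d;\mathbb C)$. $\phi$ is entanglement-breaking if $(\phi\otimes I)(\rho)$ is separable for every bipartite state $\rho$. $\phi$ is entanglement-saving (ES) if $\phi^n$ (the $n$-fold composition) is not entanglement-breaking for every integer $n\ge 1$. A semipositive fixed point is a nonzero $A\ge 0$ with $\det A=0$ and $\phi(A)=A$. $|\sigma_P(\phi)|$ is the number of eigenvalues of $\phi$ of modulus $1$, counted with multiplicity. *)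

theory Defs
  imports "Jordan_Normal_Form.Jordan_Normal_Form" "Jordan_Normal_Form.Schur_Decomposition"
begin

definition psd :: "nat \<Rightarrow> complex mat \<Rightarrow> bool" where
  "psd n A \<longleftrightarrow> A \<in> carrier_mat n n \<and> mat_adjoint A = A \<and>
     (\<forall>v \<in> carrier_vec n. Im (conjugate v \<bullet> (A *\<^sub>v v)) = 0 \<and> Re (conjugate v \<bullet> (A *\<^sub>v v)) \<ge> 0)"

definition mtrace :: "complex mat \<Rightarrow> complex" where
  "mtrace A = (\<Sum>i<dim_row A. A $$ (i,i))"

definition density :: "nat \<Rightarrow> complex mat \<Rightarrow> bool" where
  "density n A \<longleftrightarrow> psd n A \<and> mtrace A = 1"

(* Kronecker product A \<otimes> B, index (i,a) \<mapsto> i * dim B + a *)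
definition kron :: "complex mat \<Rightarrow> complex mat \<Rightarrow> complex mat" where
  "kron A B = mat (dim_row A * dim_row B) (dim_col A * dim_col B)
     (\<lambda>(p,q). A $$ (p div dim_row B, q div dim_col B) * B $$ (p mod dim_row B, q mod dim_col B))"

definition separable_state :: "nat \<Rightarrow> nat \<Rightarrow> complex mat \<Rightarrow> bool" where
  "separable_state d k \<rho> \<longleftrightarrow> (\<exists>(m::nat) A B. (\<forall>i<m. psd d (A i) \<and> psd k (B i)) \<and>
      \<rho> = mat (d*k) (d*k) (\<lambda>(p,q). \<Sum>i<m. kron (A i) (B i) $$ (p,q)))"

definition block :: "nat \<Rightarrow> nat \<Rightarrow> complex mat \<Rightarrow> nat \<Rightarrow> nat \<Rightarrow> complex mat" where
  "block d k \<rho> a b = mat d d (\<lambda>(i,j). \<rho> $$ (i*k+a, j*k+b))"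

definition tensor_id :: "(complex mat \<Rightarrow> complex mat) \<Rightarrow> nat \<Rightarrow> nat \<Rightarrow> complex mat \<Rightarrow> complex mat" where
  "tensor_id \<phi> d k \<rho> = mat (d*k) (d*k)
     (\<lambda>(p,q). \<phi> (block d k \<rho> (p mod k) (q mod k)) $$ (p div k, q div k))"

definition linear_map_mat :: "nat \<Rightarrow> (complex mat \<Rightarrow> complex mat) \<Rightarrow> bool" where
  "linear_map_mat d \<phi> \<longleftrightarrow> (\<forall>A \<in> carrier_mat d d. \<phi> A \<in> carrier_mat d d) \<and>
     (\<forall>A \<in> carrier_mat d d. \<forall>B \<in> carrier_mat d d. \<phi> (A + B) = \<phi> A + \<phi> B) \<and>
     (\<forall>c. \<forall>A \<in> carrier_mat d d. \<phi> (c \<cdot>\<^sub>m A) = c \<cdot>\<^sub>m \<phi> A)"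

definition completely_positive :: "nat \<Rightarrow> (complex mat \<Rightarrow> complex mat) \<Rightarrow> bool" where
  "completely_positive d \<phi> \<longleftrightarrow> (\<forall>k\<ge>1. \<forall>\<rho>. psd (d*k) \<rho> \<longrightarrow> psd (d*k) (tensor_id \<phi> d k \<rho>))"

definition trace_preserving :: "nat \<Rightarrow> (complex mat \<Rightarrow> complex mat) \<Rightarrow> bool" where
  "trace_preserving d \<phi> \<longleftrightarrow> (\<forall>A \<in> carrier_mat d d. mtrace (\<phi> A) = mtrace A)"

definition quantum_channel :: "nat \<Rightarrow> (complex mat \<Rightarrow> complex mat) \<Rightarrow> bool" where
  "quantum_channel d \<phi> \<longleftrightarrow> linear_map_mat d \<phi> \<and> completely_positive d \<phi> \<and> trace_preserving d \<phi>"

definition entanglement_breaking :: "nat \<Rightarrow> (complex mat \<Rightarrow> complex mat) \<Rightarrow> bool" where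
  "entanglement_breaking d \<phi> \<longleftrightarrow>
     (\<forall>k\<ge>1. \<forall>\<rho>. density (d*k) \<rho> \<longrightarrow> separable_state d k (tensor_id \<phi> d k \<rho>))"

definition entanglement_saving :: "nat \<Rightarrow> (complex mat \<Rightarrow> complex mat) \<Rightarrow> bool" where
  "entanglement_saving d \<phi> \<longleftrightarrow> (\<forall>n\<ge>1. \<not> entanglement_breaking d (\<phi> ^^ n))"

definition mat_unit :: "nat \<Rightarrow> nat \<Rightarrow> nat \<Rightarrow> complex mat" where
  "mat_unit d i j = mat d d (\<lambda>(r,s). if r = i \<and> s = j then 1 else 0)"

(* matrix of \<phi> as linear operator on the d^2-dimensional space M(d), w.r.t. basis E_{ij}, (i,j) \<mapsto> i*d+j *)
definition rep_mat :: "nat \<Rightarrow> (complex mat \<Rightarrow> complex mat) \<Rightarrow> complex mat" where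
  "rep_mat d \<phi> = mat (d*d) (d*d)
     (\<lambda>(p,q). \<phi> (mat_unit d (q div d) (q mod d)) $$ (p div d, p mod d))"

definition alg_mult :: "nat \<Rightarrow> (complex mat \<Rightarrow> complex mat) \<Rightarrow> complex \<Rightarrow> nat" where
  "alg_mult d \<phi> z = Polynomial.order z (char_poly (rep_mat d \<phi>))"

definition det_map :: "nat \<Rightarrow> (complex mat \<Rightarrow> complex mat) \<Rightarrow> complex" where
  "det_map d \<phi> = det (rep_mat d \<phi>)"

definition peripheral_count :: "nat \<Rightarrow> (complex mat \<Rightarrow> complex mat) \<Rightarrow> nat" where
  "peripheral_count d \<phi> = (\<Sum>z \<in> {z. poly (char_poly (rep_mat d \<phi>)) z = 0 \<and> cmod z = 1}. alg_mult d \<phi> z)"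

definition semipositive_fixed_point :: "nat \<Rightarrow> (complex mat \<Rightarrow> complex mat) \<Rightarrow> complex mat \<Rightarrow> bool" where
  "semipositive_fixed_point d \<phi> A \<longleftrightarrow> psd d A \<and> A \<noteq> 0\<^sub>m d d \<and> det A = 0 \<and> \<phi> A = A"

definition has_semipositive_fixed_point :: "nat \<Rightarrow> (complex mat \<Rightarrow> complex mat) \<Rightarrow> bool" where
  "has_semipositive_fixed_point d \<phi> \<longleftrightarrow> (\<exists>A. semipositive_fixed_point d \<phi> A)"

end

(* Diagonalizing a hermitian fixed point X = X+ - X- of a positive trace-preserving map and comparing traces
   shows that X+ and X- are fixed as well; so a nonzero traceless fixed point always yields a semipositive one.
   If phi has no semipositive fixed point, it has a faithful fixed state rho.  A left eigenmatrix u for an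
   eigenvalue z of modulus one then satisfies u K = z K u for all Kraus operators K.  Hence
   multiplication by z preserves the spectrum of u, so z^n = 1 for some n <= d, and u rho is a fixed point of
   phi^n, traceless if z <> 1.  If moreover 1 is the only peripheral eigenvalue and is simple, phi^n converges to
   X |-> tr(X) rho, whose neighbours are measure-and-prepare maps, so some phi^n is entanglement-breaking.
   Conversely, a measure-and-prepare map fixing a semipositive A of rank r maps the off-diagonal blocks
   relative to the support of A into the corner of A, which forces the eigenvalue 0 to have multiplicity at
   least 2 r (d - r) >= 2 (d - 1). *)
theory Submission
  imports Defs "Jordan_Normal_Form.Spectral_Radius"
begin

subsection \<open>Positive semidefinite matrices\<close>

text \<open>Passing from z-invariance of the spectrum of u to z^n = 1 needs a nonzero point x of
  that spectrum. It exists because u is invertible: otherwise u \<rho> u^* would be a semipositive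
  fixed point of \<phi>. Then z^0 x, ..., z^d x are d + 1 members of a set with at most d elements.
  Faithfulness of \<rho> enters three times: it turns tr Z \<rho> Z^* = 0 into Z = 0, it makes u
  \<rho> nonzero, and it puts \<rho> in the interior of the positive cone, which is why maps close
  to X |-> tr(X) \<rho> are still of measure-and-prepare form. The last implication has to confront
  an entanglement-breaking power \<phi>^m with a fixed point of another power \<phi>^n. Both
  properties pass to \<phi>^(n m), and the multiplicity of the eigenvalue 0 is the same for all
  positive powers, so the hypothesis on \<phi> applies there. The bound 2 (d - 1) is the least value
  of 2 r (d - r) for 1 <= r <= d - 1.\<close>

lemma mat_adjoint_eq: "mat_adjoint A = mat (dim_col A) (dim_row A) (\<lambda>(i,j). cnj (A $$ (j,i)))"
  by (rule eq_matI) (auto simp: mat_adjoint_def mat_of_rows_def)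

lemma mat_adjoint_dim [simp]: "dim_row (mat_adjoint A) = dim_col (A :: complex mat)"
  "dim_col (mat_adjoint A) = dim_row A"
  by (simp_all add: mat_adjoint_eq)

lemma mat_adjoint_carrier [simp, intro]:
  "A \<in> carrier_mat n m \<Longrightarrow> mat_adjoint (A :: complex mat) \<in> carrier_mat m n"
  by auto

lemma mat_adjoint_index [simp]:
  "i < dim_col A \<Longrightarrow> j < dim_row A \<Longrightarrow> mat_adjoint A $$ (i,j) = cnj (A $$ (j,i))"
  by (simp add: mat_adjoint_eq)

lemma mat_adjoint_adjoint [simp]: "mat_adjoint (mat_adjoint A) = (A :: complex mat)"
  by (rule eq_matI) auto

lemma mult_mat_index:
  assumes "A \<in> carrier_mat n k" "B \<in> carrier_mat k m" "i < n" "j < m"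
  shows "(A * B) $$ (i,j) = (\<Sum>l<k. A $$ (i,l) * B $$ (l,j))"
  using assms by (auto simp: scalar_prod_def lessThan_atLeast0)

lemma mat_adjoint_mult:
  assumes "A \<in> carrier_mat n k" "B \<in> carrier_mat k (m::nat)"
  shows "mat_adjoint (A * B) = mat_adjoint B * mat_adjoint (A :: complex mat)"
  using assms by (intro eq_matI)
    (auto simp: scalar_prod_def intro!: sum.cong)

lemma mat_adjoint_add:
  assumes "A \<in> carrier_mat n m" "B \<in> carrier_mat n m"
  shows "mat_adjoint (A + B) = mat_adjoint A + mat_adjoint (B :: complex mat)"
  using assms by (intro eq_matI) auto

lemma mat_adjoint_smult: "mat_adjoint (c \<cdot>\<^sub>m A) = cnj c \<cdot>\<^sub>m mat_adjoint A"
  by (intro eq_matI) auto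

lemma mat_adjoint_one [simp]: "mat_adjoint (1\<^sub>m n) = (1\<^sub>m n :: complex mat)"
  by (intro eq_matI) auto

lemma inner_adjoint:
  assumes B: "B \<in> carrier_mat m n" and v: "v \<in> carrier_vec m" and w: "w \<in> carrier_vec n"
  shows "conjugate v \<bullet> (B *\<^sub>v w) = conjugate (mat_adjoint B *\<^sub>v v) \<bullet> (w :: complex vec)"
proof -
  have "conjugate v \<bullet> (B *\<^sub>v w) = (\<Sum>i<m. \<Sum>j<n. cnj (v $ i) * B $$ (i,j) * w $ j)"
    using assms by (auto simp: scalar_prod_def lessThan_atLeast0 sum_distrib_left mult.assoc
        intro!: sum.cong)
  also have "\<dots> = (\<Sum>j<n. \<Sum>i<m. cnj (v $ i) * B $$ (i,j) * w $ j)"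
    by (rule sum.swap)
  also have "\<dots> = conjugate (mat_adjoint B *\<^sub>v v) \<bullet> w"
    using assms by (auto simp: scalar_prod_def lessThan_atLeast0 sum_distrib_right sum_distrib_left mult_ac
        intro!: sum.cong)
  finally show ?thesis .
qed

text \<open>The argument is a function and not a vector, so that test vectors can be written as
  lambda terms without dimension conditions.\<close>

definition qform :: "nat \<Rightarrow> complex mat \<Rightarrow> (nat \<Rightarrow> complex) \<Rightarrow> complex" where
  "qform n A x = (\<Sum>i<n. \<Sum>j<n. cnj (x i) * A $$ (i,j) * x j)"

lemma inner_eq_qform:
  assumes "A \<in> carrier_mat n n" "v \<in> carrier_vec n"
  shows "conjugate v \<bullet> (A *\<^sub>v v) = qform n A (($) v)"
  using assms by (auto simp: scalar_prod_def qform_def lessThan_atLeast0 sum_distrib_left mult.assoc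
        intro!: sum.cong)

lemma qform_eq_inner:
  assumes "A \<in> carrier_mat n n"
  shows "qform n A x = conjugate (vec n x) \<bullet> (A *\<^sub>v vec n x)"
  unfolding inner_eq_qform[OF assms vec_carrier] by (simp add: qform_def)

lemma hermitian_index:
  assumes "mat_adjoint A = A" "A \<in> carrier_mat n n" "i < n" "j < n"
  shows "A $$ (j,i) = cnj (A $$ (i,j))"
  using mat_adjoint_index[of j A i] assms by auto

lemma hermitianI:
  assumes "A \<in> carrier_mat n n" "\<And>i j. i < n \<Longrightarrow> j < n \<Longrightarrow> A $$ (j,i) = cnj (A $$ (i,j))"
  shows "mat_adjoint A = A"
proof (rule eq_matI)
  fix i j assume ij: "i < dim_row A" "j < dim_col A"
  then have "mat_adjoint A $$ (i,j) = cnj (A $$ (j,i))" using assms(1) by simp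
  also have "\<dots> = A $$ (i,j)" using assms(2)[of j i] ij assms(1) by simp
  finally show "mat_adjoint A $$ (i,j) = A $$ (i,j)" .
qed (use assms(1) in auto)

lemma hermitian_qform_real:
  assumes "mat_adjoint A = A" "A \<in> carrier_mat n n"
  shows "Im (qform n A x) = 0"
proof -
  have "cnj (qform n A x) = (\<Sum>i<n. \<Sum>j<n. x i * cnj (A $$ (i,j)) * cnj (x j))"
    by (simp add: qform_def)
  also have "\<dots> = (\<Sum>i<n. \<Sum>j<n. cnj (x j) * A $$ (j,i) * x i)"
    by (intro sum.cong) (auto simp: hermitian_index[OF assms, symmetric] mult_ac)
  also have "\<dots> = qform n A x"
    unfolding qform_def by (rule sum.swap)
  finally show ?thesis by (simp add: complex_eq_iff)
qed

lemma psd_iff: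
  "psd n A \<longleftrightarrow> A \<in> carrier_mat n n \<and> mat_adjoint A = A \<and> (\<forall>x. 0 \<le> Re (qform n A x))"
  unfolding psd_def
  by (metis hermitian_qform_real inner_eq_qform qform_eq_inner vec_carrier)

lemma psdD:
  assumes "psd n A"
  shows "A \<in> carrier_mat n n" "mat_adjoint A = A" "0 \<le> Re (qform n A x)" "Im (qform n A x) = 0"
  using assms hermitian_qform_real unfolding psd_iff by auto

lemma psd_herm: "psd n A \<Longrightarrow> i < n \<Longrightarrow> j < n \<Longrightarrow> A $$ (j,i) = cnj (A $$ (i,j))"
  using hermitian_index psdD by blast

lemma hermitian_sandwich:
  assumes "A \<in> carrier_mat n n" "(B :: complex mat) \<in> carrier_mat m n" "mat_adjoint A = A"
  shows "mat_adjoint (B * A * mat_adjoint B) = B * A * mat_adjoint B"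
proof -
  have "mat_adjoint (B * A * mat_adjoint B) = B * (A * mat_adjoint B)"
    using assms by (simp add: mat_adjoint_mult[where n=m and k=n and m=m] mat_adjoint_mult[where n=m and k=n and m=n])
  also have "\<dots> = B * A * mat_adjoint B" using assms by (simp add: assoc_mult_mat[of B m n A n _ m])
  finally show ?thesis .
qed

text \<open>The form of \<open>B * A * mat_adjoint B\<close> at \<open>x\<close> is the form of
  \<open>A\<close> at \<open>mat_adjoint B\<close> applied to \<open>x\<close>.\<close>

lemma psd_conj:
  assumes "psd n A" "B \<in> carrier_mat m n"
  shows "psd m (B * A * mat_adjoint B)"
proof -
  note A = psdD(1,2)[OF assms(1)] and B = assms(2)
  have c: "B * A * mat_adjoint B \<in> carrier_mat m m" using A B by auto
  have h: "mat_adjoint (B * A * mat_adjoint B) = B * A * mat_adjoint B"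
    by (rule hermitian_sandwich[OF A(1) B A(2)])
  have "0 \<le> Re (qform m (B * A * mat_adjoint B) x)" for x
  proof -
    let ?v = "vec m x" and ?w = "mat_adjoint B *\<^sub>v vec m x"
    have w: "?w \<in> carrier_vec n" using B by (intro mult_mat_vec_carrier[of _ n m]) auto
    have "(B * A * mat_adjoint B) *\<^sub>v ?v = (B * A) *\<^sub>v ?w"
      using A B by (intro assoc_mult_mat_vec[of _ m n _ m]) auto
    also have "\<dots> = B *\<^sub>v (A *\<^sub>v ?w)"
      using A B w by (intro assoc_mult_mat_vec[of _ m n _ n]) auto
    finally have "qform m (B * A * mat_adjoint B) x = conjugate ?v \<bullet> (B *\<^sub>v (A *\<^sub>v ?w))"
      using qform_eq_inner[OF c] by simp
    also have "\<dots> = conjugate ?w \<bullet> (A *\<^sub>v ?w)"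
      using A B w by (intro inner_adjoint[of B m n]) auto
    also have "\<dots> = qform n A (($) ?w)" using inner_eq_qform A w by blast
    finally show ?thesis using assms(1) unfolding psd_iff by auto
  qed
  with c h show ?thesis unfolding psd_iff by auto
qed

lemma qform_two:
  assumes "i < n" "j < n" "i \<noteq> j"
  shows "qform n A (\<lambda>k. if k = i then a else if k = j then b else 0)
    = cnj a * A $$ (i,i) * a + cnj a * A $$ (i,j) * b + cnj b * A $$ (j,i) * a + cnj b * A $$ (j,j) * b"
proof -
  let ?x = "\<lambda>k. if k = i then a else if k = j then b else 0"
  have s: "(\<Sum>k<n. g k) = (\<Sum>k\<in>{i,j}. g k)" if "\<And>k. k \<notin> {i,j} \<Longrightarrow> g k = 0" for g :: "nat \<Rightarrow> complex"
    using assms that by (intro sum.mono_neutral_right) auto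
  have "qform n A ?x = (\<Sum>k\<in>{i,j}. \<Sum>l\<in>{i,j}. cnj (?x k) * A $$ (k,l) * ?x l)"
    unfolding qform_def by (subst s, simp add: s, intro sum.cong refl s, auto)
  also have "\<dots> = cnj a * A $$ (i,i) * a + cnj a * A $$ (i,j) * b + cnj b * A $$ (j,i) * a + cnj b * A $$ (j,j) * b"
    using assms by (auto simp: add.assoc)
  finally show ?thesis .
qed

lemma qform_one:
  assumes "i < n"
  shows "qform n A (\<lambda>k. if k = i then 1 else 0) = A $$ (i,i)"
proof -
  let ?x = "\<lambda>k. if k = i then 1 else 0 :: complex"
  have s: "(\<Sum>k<n. g k) = (\<Sum>k\<in>{i}. g k)" if "\<And>k. k \<notin> {i} \<Longrightarrow> g k = 0" for g :: "nat \<Rightarrow> complex"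
    using assms that by (intro sum.mono_neutral_right) auto
  have "qform n A ?x = (\<Sum>k\<in>{i}. \<Sum>l\<in>{i}. cnj (?x k) * A $$ (k,l) * ?x l)"
    unfolding qform_def by (subst s, simp add: s, intro sum.cong refl s, auto)
  then show ?thesis by simp
qed

lemma psd_diag_entry:
  assumes "psd n A" "i < n"
  shows "0 \<le> Re (A $$ (i,i))" "Im (A $$ (i,i)) = 0" "A $$ (i,i) = of_real (Re (A $$ (i,i)))"
  using psdD[OF assms(1)] qform_one[OF assms(2), of A]  by (metis, metis, metis complex_eq_iff Re_complex_of_real Im_complex_of_real)

text \<open>On a e_i + e_j the form has no term quadratic in a once the i-th diagonal entry is zero.
  What remains is affine in a, and a nonzero off-diagonal entry would make it negative
  somewhere.\<close>

lemma psd_zero_diag_row: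
  assumes "psd n A" "i < n" "j < n" "A $$ (i,i) = 0"
  shows "A $$ (i,j) = 0" "A $$ (j,i) = 0"
proof -
  have "A $$ (i,j) = 0"
  proof (rule ccontr)
    assume z: "A $$ (i,j) \<noteq> 0"
    then have ij: "i \<noteq> j" using assms by auto
    \<comment> \<open>With this \<open>t\<close> the two mixed terms are both - (A_jj + 1), so the
      form takes the value - A_jj - 2 < 0.\<close>
    define t where "t = (Re (A $$ (j,j)) + 1) / (cmod (A $$ (i,j)))\<^sup>2"
    define a where "a = - of_real t * A $$ (i,j)"
    have "qform n A (\<lambda>k. if k = i then a else if k = j then 1 else 0)
      = cnj a * A $$ (i,j) + cnj (A $$ (i,j)) * a + A $$ (j,j)"
      using qform_two[OF assms(2,3) ij, of A a 1] assms psd_herm[OF assms(1-3)] by simp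
    also have "cnj a * A $$ (i,j) = - of_real (t * (cmod (A $$ (i,j)))\<^sup>2)"
      unfolding a_def using complex_norm_square[of "A $$ (i,j)"] by (simp add: mult.commute)
    also have "cnj (A $$ (i,j)) * a = - of_real (t * (cmod (A $$ (i,j)))\<^sup>2)"
      unfolding a_def using complex_norm_square[of "A $$ (i,j)"] by (simp add: mult.commute)
    also have "t * (cmod (A $$ (i,j)))\<^sup>2 = Re (A $$ (j,j)) + 1"
      using z by (simp add: t_def)
    finally have "Re (qform n A (\<lambda>k. if k = i then a else if k = j then 1 else 0)) = - Re (A $$ (j,j)) - 2"
      by simp
    with psdD(3)[OF assms(1), of "\<lambda>k. if k = i then a else if k = j then 1 else 0"]
      psd_diag_entry(1)[OF assms(1,3)] show False by linarith
  qed
  with psd_herm[OF assms(1-3)] show "A $$ (i,j) = 0" "A $$ (j,i) = 0" by auto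
qed

section \<open>Unitary matrices and the spectral theorem\<close>

definition unitary_mat :: "nat \<Rightarrow> complex mat \<Rightarrow> bool" where
  "unitary_mat n U \<longleftrightarrow> U \<in> carrier_mat n n \<and> mat_adjoint U * U = 1\<^sub>m n \<and> U * mat_adjoint U = 1\<^sub>m n"

lemma unitary_matD:
  assumes "unitary_mat n U"
  shows "U \<in> carrier_mat n n" "mat_adjoint U \<in> carrier_mat n n"
    "mat_adjoint U * U = 1\<^sub>m n" "U * mat_adjoint U = 1\<^sub>m n"
  using assms unfolding unitary_mat_def by auto

lemma unitary_mat_adjoint: "unitary_mat n U \<Longrightarrow> unitary_mat n (mat_adjoint U)"
  unfolding unitary_mat_def by auto

lemma unitary_mat_mult:
  assumes "unitary_mat n U" "unitary_mat n V"
  shows "unitary_mat n (U * V)"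
proof -
  note u = unitary_matD[OF assms(1)] and v = unitary_matD[OF assms(2)]
  have 1: "mat_adjoint (U * V) = mat_adjoint V * mat_adjoint U"
    using u v by (intro mat_adjoint_mult) auto
  have "mat_adjoint V * mat_adjoint U * (U * V) = mat_adjoint V * (mat_adjoint U * U * V)"
    using u(1,2) v(1,2) by (simp add: assoc_mult_mat[of _ n n _ n _ n])
  also have "\<dots> = 1\<^sub>m n" using u v by simp
  finally have 2: "mat_adjoint V * mat_adjoint U * (U * V) = 1\<^sub>m n" .
  have "U * V * (mat_adjoint V * mat_adjoint U) = U * (V * mat_adjoint V * mat_adjoint U)"
    using u(1,2) v(1,2) by (simp add: assoc_mult_mat[of _ n n _ n _ n] del: mat_adjoint_carrier)
  also have "\<dots> = 1\<^sub>m n" using u v by simp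
  finally have 3: "U * V * (mat_adjoint V * mat_adjoint U) = 1\<^sub>m n" .
  show ?thesis unfolding unitary_mat_def 1 using 2 3 u v by auto
qed

text \<open>The Householder reflection exchanging \<open>v\<close> with the first basis vector.\<close>
lemma unitary_first_column:
  fixes v :: "nat \<Rightarrow> complex" and r :: real
  assumes n: "0 < n" and v1: "(\<Sum>k<n. cnj (v k) * v k) = 1" and v0: "v 0 = of_real r" "r < 1"
  obtains W where "W \<in> carrier_mat n n" "mat_adjoint W = W" "W * W = 1\<^sub>m n"
    "\<And>i. i < n \<Longrightarrow> W $$ (i,0) = v i"
proof -
  define w where "w = (\<lambda>i. v i - (if i = 0 then 1 else 0))"
  \<comment> \<open>The reflection is 1 - (2 / |w|^2) w w^* with w = v - e_0. As \<open>v 0\<close>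
    is real, |w|^2 = 2 (1 - r), which gives this \<open>c\<close>; \<open>r < 1\<close> keeps w
    nonzero.\<close>
  define c where "c = complex_of_real (1 / (1 - r))"
  define W where "W = mat n n (\<lambda>(i,j). (if i = j then 1 else 0) - c * w i * cnj (w j))"
  have W: "W \<in> carrier_mat n n" by (simp add: W_def)
  have h: "mat_adjoint W = W"
    by (rule hermitianI[OF W]) (auto simp: W_def c_def)
  have "c * (1 - of_real r) = of_real (1 / (1 - r) * (1 - r))"
    unfolding c_def of_real_mult by simp
  then have cr: "c * (1 - of_real r) = 1" using v0(2) by simp
  have "(\<Sum>k<n. cnj (w k) * w k) = (\<Sum>k<n. cnj (v k) * v k - (if k = 0 then cnj (v 0) + v 0 - 1 else 0))"
    by (intro sum.cong) (auto simp: w_def algebra_simps)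
  also have "\<dots> = 2 * (1 - of_real r)"
    using n by (simp add: sum_subtractf v1 v0)
  finally have ww: "(\<Sum>k<n. cnj (w k) * w k) = 2 * (1 - of_real r)" .
  have "W * W = 1\<^sub>m n"
  proof (rule eq_matI)
    fix i j assume ij: "i < dim_row (1\<^sub>m n)" "j < dim_col (1\<^sub>m n)"
    then have ij: "i < n" "j < n" by auto
    have "(W * W) $$ (i,j) = (\<Sum>k<n. W $$ (i,k) * W $$ (k,j))"
      using mult_mat_index[OF W W ij] .
    also have "\<dots> = (\<Sum>k<n. (if k = i then (if k = j then 1 else 0) - c * w k * cnj (w j) else 0)
        - (if k = j then c * w i * cnj (w k) else 0) + (c * c * w i * cnj (w j)) * (cnj (w k) * w k))"
      using ij by (intro sum.cong) (auto simp: W_def algebra_simps)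
    also have "\<dots> = (if i = j then 1 else 0) - c * w i * cnj (w j) - c * w i * cnj (w j)
        + (c * c * w i * cnj (w j)) * (2 * (1 - of_real r))"
      unfolding sum.distrib sum_subtractf sum_distrib_left[symmetric] ww using ij by simp
    also have "(c * c * w i * cnj (w j)) * (2 * (1 - of_real r)) = 2 * (c * w i * cnj (w j)) * (c * (1 - of_real r))"
      by (simp add: algebra_simps)
    also have "(if i = j then 1 else 0) - c * w i * cnj (w j) - c * w i * cnj (w j) + 2 * (c * w i * cnj (w j)) * (c * (1 - of_real r)) = (1\<^sub>m n) $$ (i,j)"
      unfolding cr using ij by simp
    finally show "(W * W) $$ (i,j) = (1\<^sub>m n) $$ (i,j)" .
  qed (use W in auto)
  moreover have "W $$ (i,0) = v i" if "i < n" for i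
  proof -
    have "W $$ (i,0) = (if i = 0 then 1 else 0) + w i * (c * (1 - of_real r))"
      using that n by (auto simp: W_def w_def v0 algebra_simps)
    then show ?thesis unfolding cr by (simp add: w_def)
  qed
  ultimately show ?thesis using that W h by blast
qed

definition real_diag :: "nat \<Rightarrow> (nat \<Rightarrow> real) \<Rightarrow> complex mat" where
  "real_diag n f = mat n n (\<lambda>(i,j). if i = j then of_real (f i) else 0)"

lemma real_diag_carrier [simp, intro]: "real_diag n f \<in> carrier_mat n n"
  and real_diag_dim [simp]: "dim_row (real_diag n f) = n" "dim_col (real_diag n f) = n"
  and real_diag_index [simp]: "i < n \<Longrightarrow> j < n \<Longrightarrow> real_diag n f $$ (i,j) = (if i = j then of_real (f i) else 0)"
  by (auto simp: real_diag_def)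

text \<open>Supplies an eigenvector in exactly the shape that \<open>unitary_first_column\<close>
  accepts: unit length and a real first entry below one.\<close>

lemma unit_vector_of_eigenvalue:
  fixes A :: "complex mat"
  assumes A: "A \<in> carrier_mat n n" and n: "0 < n"
  shows "\<exists>e v r. (\<Sum>k<n. cnj (v k) * v k) = 1 \<and> v 0 = complex_of_real r \<and> r < 1 \<and>
    (\<forall>i<n. (\<Sum>j<n. A $$ (i,j) * v j) = e * v i)"
proof -
  from spectrum_non_empty[OF A n] obtain e where "eigenvalue A e"
    unfolding spectrum_def by auto
  then obtain x where x: "x \<in> carrier_vec n" "x \<noteq> 0\<^sub>v n" "A *\<^sub>v x = e \<cdot>\<^sub>v x"
    using A unfolding eigenvalue_def eigenvector_def by auto
  define s where "s = (\<Sum>k<n. (cmod (x $ k))\<^sup>2)"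
  have s0: "s > 0"
  proof -
    from x obtain k where k: "k < n" "x $ k \<noteq> 0" by (metis carrier_vecD eq_vecI index_zero_vec)
    then show ?thesis unfolding s_def
      by (intro sum_pos2[of _ k]) auto
  qed
  \<comment> \<open>This phase turns the first entry into minus its modulus. It is then at most 0,
    so the eigenvector never coincides with e_0 and the reflection is always defined.\<close>
  define p where "p = (if x $ 0 = 0 then 1 else - cnj (x $ 0) / cmod (x $ 0))"
  have p: "cnj p * p = 1"
    using complex_norm_square[of p] by (auto simp: p_def norm_divide mult.commute)
  define v where "v = (\<lambda>k. p / sqrt s * x $ k)"
  have "(\<Sum>k<n. cnj (v k) * v k) = (\<Sum>k<n. (cnj p * p) * of_real ((cmod (x $ k))\<^sup>2) / (complex_of_real (sqrt s) * complex_of_real (sqrt s)))"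
    by (intro sum.cong refl, subst complex_norm_square) (auto simp: v_def field_simps)
  also have "\<dots> = of_real (s / (sqrt s * sqrt s))"
    unfolding p of_real_divide of_real_mult sum_divide_distrib[symmetric] by (simp add: s_def)
  also have "\<dots> = 1" using s0 by simp
  finally have 1: "(\<Sum>k<n. cnj (v k) * v k) = 1" .
  have 2: "v 0 = complex_of_real (- cmod (x $ 0) / sqrt s)"
  proof (cases "x $ 0 = 0")
    case False
    then have "v 0 = - (x $ 0 * cnj (x $ 0)) / (cmod (x $ 0) * complex_of_real (sqrt s))"
      by (simp add: v_def p_def mult.commute)
    also have "x $ 0 * cnj (x $ 0) = complex_of_real (cmod (x $ 0)) * cmod (x $ 0)"
      using complex_norm_square[of "x $ 0"] by (simp add: power2_eq_square)
    finally show ?thesis using False by simp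
  qed (simp add: v_def p_def)
  have 3: "- cmod (x $ 0) / sqrt s < 1"
    using s0 by (auto simp: field_simps) (smt (verit) norm_ge_zero real_sqrt_gt_zero)
  have 4: "(\<Sum>j<n. A $$ (i,j) * v j) = e * v i" if "i < n" for i
  proof -
    have "(\<Sum>j<n. A $$ (i,j) * v j) = p / sqrt s * (A *\<^sub>v x) $ i"
      using A x(1) that by (auto simp: v_def scalar_prod_def lessThan_atLeast0 sum_distrib_left intro!: sum.cong)
    also have "\<dots> = e * v i" unfolding x(3) using x(1) that by (simp add: v_def)
    finally show ?thesis .
  qed
  show ?thesis using 1 2 3 4 by blast
qed

lemma qform_one_mat: "qform n (1\<^sub>m n) x = of_real (\<Sum>i<n. (cmod (x i))\<^sup>2)"
proof -
  have "qform n (1\<^sub>m n) x = (\<Sum>i<n. \<Sum>j<n. if j = i then cnj (x i) * x i else 0)"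
    unfolding qform_def by (intro sum.cong) auto
  also have "\<dots> = (\<Sum>i<n. of_real ((cmod (x i))\<^sup>2))"
    by (intro sum.cong refl, subst complex_norm_square) (auto simp: mult.commute)
  finally show ?thesis by simp
qed

lemma four_block_adjoint:
  assumes "U \<in> carrier_mat m m"
  shows "mat_adjoint (four_block_mat (1\<^sub>m 1) (0\<^sub>m 1 m) (0\<^sub>m m 1) U)
    = four_block_mat (1\<^sub>m 1) (0\<^sub>m 1 m) (0\<^sub>m m 1) (mat_adjoint (U :: complex mat))"
  using assms by (intro eq_matI) (auto simp: four_block_mat_def Let_def)

lemma unitary_four_block:
  assumes "unitary_mat m U"
  shows "unitary_mat (Suc m) (four_block_mat (1\<^sub>m 1) (0\<^sub>m 1 m) (0\<^sub>m m 1) U)" (is "unitary_mat _ ?V")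
proof -
  note u = unitary_matD[OF assms]
  have one: "four_block_mat (1\<^sub>m 1) (0\<^sub>m 1 m) (0\<^sub>m m 1) (1\<^sub>m m) = (1\<^sub>m (Suc m) :: complex mat)"
    by (rule eq_matI) (auto simp: four_block_mat_def Let_def)
  have "four_block_mat (1\<^sub>m 1) (0\<^sub>m 1 m) (0\<^sub>m m 1) A * four_block_mat (1\<^sub>m 1) (0\<^sub>m 1 m) (0\<^sub>m m 1) B
    = four_block_mat (1\<^sub>m 1) (0\<^sub>m 1 m) (0\<^sub>m m 1) (A * B)"
    if "A \<in> carrier_mat m m" "B \<in> carrier_mat m m" for A B :: "complex mat"
    using that by (subst mult_four_block_mat[of _ 1 1 _ m _ m _ _ 1 _ m]) auto
  then show ?thesis
    unfolding unitary_mat_def four_block_adjoint[OF u(1)] using u one by auto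
qed

lemma sandwich_sandwich:
  assumes "A \<in> carrier_mat n n" "B \<in> carrier_mat n n" "(C :: complex mat) \<in> carrier_mat n n"
  shows "C * (B * A * mat_adjoint B) * mat_adjoint C = (C * B) * A * mat_adjoint (C * B)"
proof -
  have B: "mat_adjoint B \<in> carrier_mat n n" and C: "mat_adjoint C \<in> carrier_mat n n" using assms by auto
  show ?thesis unfolding mat_adjoint_mult[OF assms(3,2)]
    using assms B C by (simp add: assoc_mult_mat[of _ n n _ n _ n] del: mat_adjoint_carrier)
qed

text \<open>Induction on the size. Conjugating by a reflection whose first column is an eigenvector
  clears the first column below the diagonal; hermiticity clears the first row as well, and the
  remaining block is hermitian of size \<open>m\<close>.\<close>

theorem hermitian_spectral:
  assumes "A \<in> carrier_mat n n" "mat_adjoint A = A"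
  shows "\<exists>U f. unitary_mat n U \<and> A = U * real_diag n f * mat_adjoint U"
  using assms
proof (induction n arbitrary: A)
  case 0
  then show ?case by (intro exI[of _ "1\<^sub>m 0"] exI[of _ "\<lambda>_. 0"]) (auto simp: unitary_mat_def)
next
  case (Suc m)
  let ?n = "Suc m"
  note A = Suc.prems(1)
  from unit_vector_of_eigenvalue[OF A zero_less_Suc] obtain e v r where
    v: "(\<Sum>k<?n. cnj (v k) * v k) = 1" "v 0 = complex_of_real r" "r < 1"
    and ev: "\<And>i. i < ?n \<Longrightarrow> (\<Sum>j<?n. A $$ (i,j) * v j) = e * v i"
    by blast
  obtain W where W: "W \<in> carrier_mat ?n ?n" "mat_adjoint W = W" "W * W = 1\<^sub>m ?n"
    and W0: "\<And>i. i < ?n \<Longrightarrow> W $$ (i,0) = v i"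
    using unitary_first_column[OF _ v] by auto
  have WU: "unitary_mat ?n W" unfolding unitary_mat_def using W by auto
  define A' where "A' = W * A * W"
  have A': "A' \<in> carrier_mat ?n ?n" using W A unfolding A'_def by auto
  have hA': "mat_adjoint A' = A'"
    using hermitian_sandwich[OF A W(1) Suc.prems(2)] unfolding A'_def W(2) .
  have AW0: "(A * W) $$ (i,0) = e * W $$ (i,0)" if "i < ?n" for i
    using mult_mat_index[OF A W(1) that, of 0] ev[OF that] W0 that by (simp del: sum.lessThan_Suc)
  have col0: "A' $$ (i,0) = (if i = 0 then e else 0)" if "i < ?n" for i
  proof -
    have "A' = W * (A * W)" unfolding A'_def using A W by (simp add: assoc_mult_mat[of _ ?n ?n _ ?n _ ?n])
    then have "A' $$ (i,0) = (\<Sum>k<?n. W $$ (i,k) * (A * W) $$ (k,0))"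
      using mult_mat_index[of W ?n ?n "A * W" ?n i 0] A W that by auto
    also have "\<dots> = e * (\<Sum>k<?n. W $$ (i,k) * W $$ (k,0))"
      using AW0 by (auto simp: sum_distrib_left mult_ac simp del: sum.lessThan_Suc intro!: sum.cong)
    also have "(\<Sum>k<?n. W $$ (i,k) * W $$ (k,0)) = (W * W) $$ (i,0)"
      using mult_mat_index[OF W(1,1) that, of 0] by (auto simp del: sum.lessThan_Suc)
    finally show ?thesis unfolding W(3) using that by auto
  qed
  have row0: "A' $$ (0,j) = (if j = 0 then e else 0)" if "j < ?n" for j
    using hermitian_index[OF hA' A' that, of 0] hermitian_index[OF hA' A', of 0 0] col0[OF that] col0[of 0] by auto
  have er: "e = of_real (Re e)"
    using hermitian_index[OF hA' A', of 0 0] col0[of 0] by (simp add: complex_eq_iff)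
  define B where "B = mat m m (\<lambda>(i,j). A' $$ (Suc i, Suc j))"
  have B: "B \<in> carrier_mat m m" unfolding B_def by auto
  have "mat_adjoint B = B"
  proof (rule hermitianI[OF B])
    fix i j assume "i < m" "j < m"
    then show "B $$ (j,i) = cnj (B $$ (i,j))"
      using hermitian_index[OF hA' A', of "Suc i" "Suc j"] unfolding B_def by simp
  qed
  with Suc.IH[OF B] obtain U f where U: "unitary_mat m U" and BU: "B = U * real_diag m f * mat_adjoint U"
    by auto
  note u = unitary_matD[OF U]
  let ?V = "four_block_mat (1\<^sub>m 1) (0\<^sub>m 1 m) (0\<^sub>m m 1) U"
  let ?D = "four_block_mat (mat 1 1 (\<lambda>_. e)) (0\<^sub>m 1 m) (0\<^sub>m m 1) (real_diag m f)"
  define g where "g = (\<lambda>i. if i = 0 then Re e else f (i - 1))"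
  have D: "?D = real_diag ?n g"
    using er by (intro eq_matI) (auto simp: four_block_mat_def Let_def g_def)
  have V: "unitary_mat ?n ?V" by (rule unitary_four_block[OF U])
  have "?V * ?D = four_block_mat (mat 1 1 (\<lambda>_. e)) (0\<^sub>m 1 m) (0\<^sub>m m 1) (U * real_diag m f)"
    using u(1) by (subst mult_four_block_mat[of _ 1 1 _ m _ m _ _ 1 _ m]) auto
  then have "?V * ?D * mat_adjoint ?V = four_block_mat (mat 1 1 (\<lambda>_. e)) (0\<^sub>m 1 m) (0\<^sub>m m 1) (U * real_diag m f * mat_adjoint U)"
    unfolding four_block_adjoint[OF u(1)]
    using u(1) by simp (subst mult_four_block_mat[of _ 1 1 _ m _ m _ _ 1 _ m], auto)
  also have "\<dots> = A'"
    unfolding BU[symmetric] using A' col0 row0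
    by (intro eq_matI) (auto simp: four_block_mat_def Let_def B_def)
  finally have A'V: "A' = ?V * real_diag ?n g * mat_adjoint ?V" unfolding D by simp
  have "A = W * A' * mat_adjoint W"
  proof -
    have "W * A' * W = (W * W) * A * (W * W)"
      unfolding A'_def using A W(1) by (simp add: assoc_mult_mat[of _ ?n ?n _ ?n _ ?n])
    then show ?thesis unfolding W using A by simp
  qed
  also have "\<dots> = (W * ?V) * real_diag ?n g * mat_adjoint (W * ?V)"
    unfolding A'V using unitary_matD(1)[OF V] W(1) by (intro sandwich_sandwich[of _ ?n]) auto
  finally show ?case using unitary_mat_mult[OF WU V] by blast
qed

lemma spectral_index:
  assumes "unitary_mat n U" "i < n" "j < n"
  shows "(U * real_diag n f * mat_adjoint U) $$ (i,j) = (\<Sum>k<n. of_real (f k) * (U $$ (i,k) * cnj (U $$ (j,k))))"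
proof -
  note u = unitary_matD[OF assms(1)]
  have 1: "(U * real_diag n f) $$ (i,k) = of_real (f k) * U $$ (i,k)" if "k < n" for k
  proof -
    have "(U * real_diag n f) $$ (i,k) = (\<Sum>l<n. U $$ (i,l) * real_diag n f $$ (l,k))"
      by (rule mult_mat_index[OF u(1) real_diag_carrier assms(2) that])
    also have "\<dots> = (\<Sum>l<n. if l = k then of_real (f k) * U $$ (i,k) else 0)"
      by (intro sum.cong refl) (use that in auto)
    finally show ?thesis using that by simp
  qed
  have "(U * real_diag n f * mat_adjoint U) $$ (i,j) = (\<Sum>k<n. (U * real_diag n f) $$ (i,k) * mat_adjoint U $$ (k,j))"
    using mult_mat_index[of "U * real_diag n f" n n "mat_adjoint U" n i j] u assms by auto
  then show ?thesis using 1 u assms by (auto intro!: sum.cong)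
qed

lemma psd_real_diag:
  assumes "\<And>i. i < n \<Longrightarrow> 0 \<le> f i"
  shows "psd n (real_diag n f)"
proof -
  have "qform n (real_diag n f) x = of_real (\<Sum>i<n. f i * (cmod (x i))\<^sup>2)" for x
  proof -
    have "qform n (real_diag n f) x = (\<Sum>i<n. \<Sum>j<n. if j = i then f i * (cnj (x i) * x i) else 0)"
      unfolding qform_def by (intro sum.cong) auto
    also have "\<dots> = (\<Sum>i<n. of_real (f i) * of_real ((cmod (x i))\<^sup>2))"
      by (intro sum.cong refl, subst complex_norm_square) (auto simp: mult.commute)
    finally show ?thesis by simp
  qed
  then show ?thesis unfolding psd_iff
    using assms by (auto intro!: hermitianI[of _ n] sum_nonneg)
qed

lemma psd_spectral_nonneg:
  assumes "psd n (U * real_diag n f * mat_adjoint U)" "unitary_mat n U" "i < n"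
  shows "0 \<le> f i"
proof -
  note u = unitary_matD[OF assms(2)]
  have "psd n (mat_adjoint U * (U * real_diag n f * mat_adjoint U) * mat_adjoint (mat_adjoint U))"
    by (rule psd_conj[OF assms(1) u(2)])
  also have "mat_adjoint U * (U * real_diag n f * mat_adjoint U) * mat_adjoint (mat_adjoint U)
    = (mat_adjoint U * U) * real_diag n f * mat_adjoint (mat_adjoint U * U)"
    using u by (intro sandwich_sandwich) auto
  also have "\<dots> = real_diag n f" unfolding u(3) by (simp add: right_mult_one_mat[of _ n n] left_mult_one_mat[of _ n n])
  finally have "psd n (real_diag n f)" .
  from psd_diag_entry(1)[OF this assms(3)] assms(3) show ?thesis by simp
qed

lemma psd_spectral:
  assumes "psd n A"
  obtains U f where "unitary_mat n U" "A = U * real_diag n f * mat_adjoint U" "\<And>i. i < n \<Longrightarrow> 0 \<le> f i"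
proof -
  from hermitian_spectral[OF psdD(1,2)[OF assms]] obtain U f where
    U: "unitary_mat n U" "A = U * real_diag n f * mat_adjoint U" by auto
  then show ?thesis using that psd_spectral_nonneg[of n U f] assms by auto
qed

text \<open>The vector \<open>e l\<close> is the \<open>l\<close>-th column of the diagonalizing
  unitary, scaled by the root of its eigenvalue. For the Choi matrix these vectors become Kraus
  operators.\<close>

lemma psd_gram:
  assumes "psd n A"
  obtains e :: "nat \<Rightarrow> nat \<Rightarrow> complex" where
    "\<And>i j. i < n \<Longrightarrow> j < n \<Longrightarrow> A $$ (i,j) = (\<Sum>l<n. e l i * cnj (e l j))"
proof -
  obtain U f where U: "unitary_mat n U" "A = U * real_diag n f * mat_adjoint U" "\<And>i. i < n \<Longrightarrow> 0 \<le> f i"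
    using psd_spectral[OF assms] by blast
  have "A $$ (i,j) = (\<Sum>l<n. (sqrt (f l) * U $$ (i,l)) * cnj (sqrt (f l) * U $$ (j,l)))" if "i < n" "j < n" for i j
    unfolding U(2) spectral_index[OF U(1) that]
  proof (intro sum.cong refl)
    fix l assume "l \<in> {..<n}"
    then have "complex_of_real (f l) = of_real (sqrt (f l) * sqrt (f l))" using U(3) by auto
    then show "complex_of_real (f l) * (U $$ (i,l) * cnj (U $$ (j,l))) = (sqrt (f l) * U $$ (i,l)) * cnj (sqrt (f l) * U $$ (j,l))"
      unfolding of_real_mult by simp
  qed
  then show ?thesis using that[of "\<lambda>l i. sqrt (f l) * U $$ (i,l)"] by blast
qed

lemma det_spectral:
  assumes "unitary_mat n U"
  shows "det (U * real_diag n f * mat_adjoint U) = of_real (\<Prod>i<n. f i)"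
proof -
  note u = unitary_matD[OF assms]
  have d: "det (real_diag n f) = of_real (\<Prod>i<n. f i)"
  proof -
    have "det (real_diag n f) = prod_list (diag_mat (real_diag n f))"
      by (rule det_upper_triangular[of _ n]) auto
    also have "\<dots> = (\<Prod>i<n. of_real (f i))"
      by (simp add: prod_list_diag_prod lessThan_atLeast0)
    finally show ?thesis by simp
  qed
  have "det (U * real_diag n f * mat_adjoint U) = det U * det (real_diag n f) * det (mat_adjoint U)"
    using u det_mult[of "U * real_diag n f" n "mat_adjoint U"] det_mult[of U n "real_diag n f"] by auto
  also have "det U * det (real_diag n f) * det (mat_adjoint U) = det (real_diag n f) * det (U * mat_adjoint U)"
    using u det_mult[of U n "mat_adjoint U"] by auto
  finally show ?thesis unfolding u(4) d by simp
qed

text \<open>A nonzero determinant makes all eigenvalues positive. Subtracting the multiple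
  \<open>c\<close> of the identity, with \<open>c\<close> at most the least eigenvalue, leaves a
  positive semidefinite matrix.\<close>

lemma posdef_coercive:
  assumes "psd n A" "det A \<noteq> 0"
  obtains c where "c > 0" "\<And>x. c * (\<Sum>i<n. (cmod (x i))\<^sup>2) \<le> Re (qform n A x)"
proof -
  obtain U f where U: "unitary_mat n U" "A = U * real_diag n f * mat_adjoint U" "\<And>i. i < n \<Longrightarrow> 0 \<le> f i"
    using psd_spectral[OF assms(1)] by blast
  note u = unitary_matD[OF U(1)]
  have f0: "0 < f i" if "i < n" for i
    using assms(2) U(3)[OF that] that unfolding U(2) det_spectral[OF U(1)] by (auto simp: less_le)
  \<comment> \<open>The inserted 1 keeps the set nonempty when \<open>n = 0\<close>.\<close>
  define c where "c = Min (insert 1 (f ` {..<n}))"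
  have c: "c > 0" using f0 unfolding c_def by (subst Min_gr_iff) auto
  have cf: "c \<le> f i" if "i < n" for i using that unfolding c_def by (intro Min_le) auto
  have "psd n (U * real_diag n (\<lambda>i. f i - c) * mat_adjoint U)"
    using cf by (intro psd_conj[OF _ u(1)] psd_real_diag) auto
  also have "U * real_diag n (\<lambda>i. f i - c) * mat_adjoint U = A - of_real c \<cdot>\<^sub>m 1\<^sub>m n"
  proof (rule eq_matI)
    fix i j assume "i < dim_row (A - of_real c \<cdot>\<^sub>m 1\<^sub>m n)" "j < dim_col (A - of_real c \<cdot>\<^sub>m 1\<^sub>m n)"
    then have ij: "i < n" "j < n" by auto
    have o: "(\<Sum>k<n. U $$ (i,k) * cnj (U $$ (j,k))) = (1\<^sub>m n) $$ (i,j)"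
      using mult_mat_index[OF u(1,2) ij] u(1) ij unfolding u(4) by simp
    have "(U * real_diag n (\<lambda>i. f i - c) * mat_adjoint U) $$ (i,j)
      = (\<Sum>k<n. of_real (f k) * (U $$ (i,k) * cnj (U $$ (j,k)))) - of_real c * (\<Sum>k<n. U $$ (i,k) * cnj (U $$ (j,k)))"
      unfolding spectral_index[OF U(1) ij] by (simp add: left_diff_distrib sum_subtractf sum_distrib_left)
    also have "\<dots> = A $$ (i,j) - of_real c * (1\<^sub>m n) $$ (i,j)"
      unfolding o U(2) spectral_index[OF U(1) ij] ..
    also have "\<dots> = (A - of_real c \<cdot>\<^sub>m 1\<^sub>m n) $$ (i,j)" using ij by simp
    finally show "(U * real_diag n (\<lambda>i. f i - c) * mat_adjoint U) $$ (i,j) = (A - of_real c \<cdot>\<^sub>m 1\<^sub>m n) $$ (i,j)" .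
  qed (use u in auto)
  finally have p: "psd n (A - of_real c \<cdot>\<^sub>m 1\<^sub>m n)" .
  have "c * (\<Sum>i<n. (cmod (x i))\<^sup>2) \<le> Re (qform n A x)" for x
  proof -
    have A: "A \<in> carrier_mat n n" using psdD(1)[OF assms(1)] .
    have "qform n (A - of_real c \<cdot>\<^sub>m 1\<^sub>m n) x = qform n A x - of_real c * qform n (1\<^sub>m n) x"
      using A unfolding qform_def sum_distrib_left sum_subtractf[symmetric]
      by (intro sum.cong) (auto simp: algebra_simps)
    then show ?thesis using psdD(3)[OF p, of x] unfolding qform_one_mat by simp
  qed
  with c that show ?thesis by blast
qed

section \<open>Index pairs (a,b) encoded as \<open>a * k + b\<close>\<close>

lemma sum_div_mod:
  fixes f :: "nat \<Rightarrow> nat \<Rightarrow> 'a :: comm_monoid_add"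
  shows "(\<Sum>q<m*k. f (q div k) (q mod k)) = (\<Sum>a<m. \<Sum>b<k. f a b)"
proof (cases "k = 0")
  case False
  have "(\<Sum>q<m*k. f (q div k) (q mod k)) = (\<Sum>a<m. sum (\<lambda>q. f (q div k) (q mod k)) {a*k..<a*k+k})"
    by (rule sum.nat_group[symmetric])
  also have "\<dots> = (\<Sum>a<m. \<Sum>b<k. f a b)"
  proof (rule sum.cong[OF refl])
    fix a
    have "sum (\<lambda>q. f (q div k) (q mod k)) {a*k..<a*k+k} = sum (\<lambda>q. f (q div k) (q mod k)) {0+a*k..<k+a*k}"
      by (simp add: add.commute)
    also have "\<dots> = (\<Sum>b = 0..<k. f ((b + a*k) div k) ((b + a*k) mod k))"
      by (rule sum.shift_bounds_nat_ivl)
    also have "\<dots> = (\<Sum>b<k. f a b)"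
      using False by (intro sum.cong) auto
    finally show "sum (\<lambda>q. f (q div k) (q mod k)) {a*k..<a*k+k} = (\<Sum>b<k. f a b)" .
  qed
  finally show ?thesis .
qed auto

lemma index_lt: "i < d \<Longrightarrow> a < k \<Longrightarrow> i * k + a < d * (k::nat)"
  by (metis div_less_iff_less_mult div_mult_self3 less_nat_zero_code nat_neq_iff add.right_neutral div_less gr0I add.commute)

lemma div_mod_lt: "p < d * (k::nat) \<Longrightarrow> p div k < d" "p < d * (k::nat) \<Longrightarrow> p mod k < k"
  by (auto simp: less_mult_imp_div_less) (metis mod_less_divisor mult_0_right not_gr0 not_less0)

lemma div_mod_eqI: "p div d = q div d \<Longrightarrow> p mod d = q mod d \<Longrightarrow> p = (q :: nat)"
  by (metis div_mult_mod_eq)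

subsection \<open>Linear maps on matrices\<close>

lemma mat_unit_carrier [simp, intro]: "mat_unit d a b \<in> carrier_mat d d"
  by (simp add: mat_unit_def)

lemma mat_unit_index [simp]: "i < d \<Longrightarrow> j < d \<Longrightarrow> mat_unit d a b $$ (i,j) = (if i = a \<and> j = b then 1 else 0)"
  by (simp add: mat_unit_def)

lemma mat_unit_dim [simp]: "dim_row (mat_unit d a b) = d" "dim_col (mat_unit d a b) = d"
  by (simp_all add: mat_unit_def)

lemma linear_map_matD:
  assumes "linear_map_mat d \<phi>"
  shows "A \<in> carrier_mat d d \<Longrightarrow> \<phi> A \<in> carrier_mat d d"
    "A \<in> carrier_mat d d \<Longrightarrow> B \<in> carrier_mat d d \<Longrightarrow> \<phi> (A + B) = \<phi> A + \<phi> B"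
    "A \<in> carrier_mat d d \<Longrightarrow> \<phi> (c \<cdot>\<^sub>m A) = c \<cdot>\<^sub>m \<phi> A"
  using assms unfolding linear_map_mat_def by auto

lemma linear_map_zero:
  assumes "linear_map_mat d \<phi>"
  shows "\<phi> (0\<^sub>m d d) = 0\<^sub>m d d"
proof -
  have "\<phi> (0 \<cdot>\<^sub>m 0\<^sub>m d d) = 0 \<cdot>\<^sub>m \<phi> (0\<^sub>m d d)" by (rule linear_map_matD(3)[OF assms]) auto
  also have "0 \<cdot>\<^sub>m 0\<^sub>m d d = (0\<^sub>m d d :: complex mat)" by (rule eq_matI) auto
  also have "0 \<cdot>\<^sub>m \<phi> (0\<^sub>m d d) = 0\<^sub>m d d" using linear_map_matD(1)[OF assms zero_carrier_mat] by (intro eq_matI) auto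
  finally show ?thesis .
qed

lemma linear_map_expand:
  assumes l: "linear_map_mat d \<phi>" and X: "X \<in> carrier_mat d d" and ij: "i < d" "j < d"
  shows "\<phi> X $$ (i,j) = (\<Sum>a<d. \<Sum>b<d. X $$ (a,b) * \<phi> (mat_unit d a b) $$ (i,j))"
proof -
  note lin = linear_map_matD[OF l]
  \<comment> \<open>\<open>M S\<close> is \<open>X\<close> with the entries outside \<open>S\<close>
    erased. Linearity is given for binary sums, so the expansion is built by adding one position at
    a time.\<close>
  define M where "M S = mat d d (\<lambda>p. if p \<in> S then X $$ p else 0)" for S
  have M: "M S \<in> carrier_mat d d" for S by (auto simp: M_def)
  have "\<phi> (M S) $$ (i,j) = (\<Sum>p\<in>S. X $$ p * \<phi> (mat_unit d (fst p) (snd p)) $$ (i,j))"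
    if "finite S" "S \<subseteq> {..<d} \<times> {..<d}" for S
    using that
  proof (induction S rule: finite_induct)
    case empty
    have "M {} = 0\<^sub>m d d" by (intro eq_matI) (auto simp: M_def)
    then show ?case using linear_map_zero[OF l] ij by simp
  next
    case (insert p S)
    have "M (insert p S) = M S + X $$ p \<cdot>\<^sub>m mat_unit d (fst p) (snd p)"
      using insert.hyps insert.prems by (intro eq_matI) (auto simp: M_def)
    then have "\<phi> (M (insert p S)) = \<phi> (M S) + X $$ p \<cdot>\<^sub>m \<phi> (mat_unit d (fst p) (snd p))"
      using lin M by auto
    then show ?case using insert ij lin(1)[of "mat_unit d (fst p) (snd p)"] by auto
  qed
  from this[of "{..<d} \<times> {..<d}"] have "\<phi> (M ({..<d} \<times> {..<d})) $$ (i,j) =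
    (\<Sum>p\<in>{..<d} \<times> {..<d}. X $$ p * \<phi> (mat_unit d (fst p) (snd p)) $$ (i,j))" by auto
  moreover have "M ({..<d} \<times> {..<d}) = X" using X by (intro eq_matI) (auto simp: M_def)
  ultimately show ?thesis by (simp add: sum.cartesian_product split_def)
qed

lemma linear_map_sum:
  assumes l: "linear_map_mat d \<phi>" and R: "\<And>s. s \<in> S \<Longrightarrow> R s \<in> carrier_mat d d" and ij: "i < d" "j < d"
  shows "\<phi> (mat d d (\<lambda>(i,j). \<Sum>s\<in>S. c s * R s $$ (i,j))) $$ (i,j) = (\<Sum>s\<in>S. c s * \<phi> (R s) $$ (i,j))"
proof -
  have "\<phi> (mat d d (\<lambda>(i,j). \<Sum>s\<in>S. c s * R s $$ (i,j))) $$ (i,j)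
    = (\<Sum>a<d. \<Sum>b<d. \<Sum>s\<in>S. c s * (R s $$ (a,b) * \<phi> (mat_unit d a b) $$ (i,j)))"
    by (subst linear_map_expand[OF l _ ij]) (auto simp: sum_distrib_right sum_distrib_left mult_ac intro!: sum.cong)
  also have "\<dots> = (\<Sum>a<d. \<Sum>s\<in>S. \<Sum>b<d. c s * (R s $$ (a,b) * \<phi> (mat_unit d a b) $$ (i,j)))"
    by (intro sum.cong refl sum.swap)
  also have "\<dots> = (\<Sum>s\<in>S. \<Sum>a<d. \<Sum>b<d. c s * (R s $$ (a,b) * \<phi> (mat_unit d a b) $$ (i,j)))"
    by (rule sum.swap)
  also have "\<dots> = (\<Sum>s\<in>S. c s * \<phi> (R s) $$ (i,j))"
    by (intro sum.cong refl, subst linear_map_expand[OF l R ij]) (auto simp: sum_distrib_left)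
  finally show ?thesis .
qed

lemma linear_map_comp: "linear_map_mat d \<phi> \<Longrightarrow> linear_map_mat d \<psi> \<Longrightarrow> linear_map_mat d (\<phi> \<circ> \<psi>)"
  unfolding linear_map_mat_def by auto

lemma linear_map_funpow: "linear_map_mat d \<phi> \<Longrightarrow> linear_map_mat d (\<phi> ^^ n)"
  by (induction n) (auto simp: linear_map_mat_def)

section \<open>Matrices as vectors, and maps as \<open>rep_mat\<close>\<close>

definition vec_of_mat :: "nat \<Rightarrow> complex mat \<Rightarrow> complex vec" where
  "vec_of_mat d X = vec (d*d) (\<lambda>p. X $$ (p div d, p mod d))"

definition mat_of_vec :: "nat \<Rightarrow> complex vec \<Rightarrow> complex mat" where
  "mat_of_vec d x = mat d d (\<lambda>(i,j). x $ (i * d + j))"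

lemma vec_of_mat_carrier [simp]: "vec_of_mat d X \<in> carrier_vec (d*d)"
  and mat_of_vec_carrier [simp]: "mat_of_vec d x \<in> carrier_mat d d"
  by (auto simp: vec_of_mat_def mat_of_vec_def)

lemma vec_of_mat_of_vec: "x \<in> carrier_vec (d*d) \<Longrightarrow> vec_of_mat d (mat_of_vec d x) = x"
  by (rule eq_vecI) (auto simp: vec_of_mat_def mat_of_vec_def div_mod_lt)

lemma mat_of_vec_of_mat: "X \<in> carrier_mat d d \<Longrightarrow> mat_of_vec d (vec_of_mat d X) = X"
  by (rule eq_matI) (auto simp: vec_of_mat_def mat_of_vec_def index_lt)

lemma rep_mat_carrier [simp]: "rep_mat d \<phi> \<in> carrier_mat (d*d) (d*d)"
  by (simp add: rep_mat_def)

lemma rep_mat_index: "i < d \<Longrightarrow> j < d \<Longrightarrow> a < d \<Longrightarrow> b < d \<Longrightarrow>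
  rep_mat d \<phi> $$ (i*d+j, a*d+b) = \<phi> (mat_unit d a b) $$ (i,j)"
  by (simp add: rep_mat_def index_lt)

lemma rep_mat_mult_vec:
  assumes l: "linear_map_mat d \<phi>" and X: "X \<in> carrier_mat d d"
  shows "rep_mat d \<phi> *\<^sub>v vec_of_mat d X = vec_of_mat d (\<phi> X)"
proof (rule eq_vecI)
  fix p assume "p < dim_vec (vec_of_mat d (\<phi> X))"
  then have p: "p < d * d" by (simp add: vec_of_mat_def)
  have "(rep_mat d \<phi> *\<^sub>v vec_of_mat d X) $ p = (\<Sum>q<d*d. rep_mat d \<phi> $$ (p,q) * vec_of_mat d X $ q)"
    using p by (simp add: scalar_prod_def lessThan_atLeast0 rep_mat_def vec_of_mat_def)
  also have "\<dots> = (\<Sum>q<d*d. X $$ (q div d, q mod d) * \<phi> (mat_unit d (q div d) (q mod d)) $$ (p div d, p mod d))"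
    using p by (intro sum.cong) (auto simp: rep_mat_def vec_of_mat_def)
  also have "\<dots> = (\<Sum>a<d. \<Sum>b<d. X $$ (a,b) * \<phi> (mat_unit d a b) $$ (p div d, p mod d))"
    by (rule sum_div_mod)
  also have "\<dots> = \<phi> X $$ (p div d, p mod d)"
    by (rule linear_map_expand[OF l X div_mod_lt[OF p], symmetric])
  finally show "(rep_mat d \<phi> *\<^sub>v vec_of_mat d X) $ p = vec_of_mat d (\<phi> X) $ p"
    using p by (simp add: vec_of_mat_def)
qed (simp add: rep_mat_def vec_of_mat_def)

lemma rep_mat_comp:
  assumes "linear_map_mat d \<phi>" "linear_map_mat d \<psi>"
  shows "rep_mat d (\<phi> \<circ> \<psi>) = rep_mat d \<phi> * rep_mat d \<psi>"
proof (rule eq_matI)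
  fix p q assume "p < dim_row (rep_mat d \<phi> * rep_mat d \<psi>)" "q < dim_col (rep_mat d \<phi> * rep_mat d \<psi>)"
  then have pq: "p < d*d" "q < d*d" by (auto simp: rep_mat_def)
  let ?E = "mat_unit d (q div d) (q mod d)"
  have E: "\<psi> ?E \<in> carrier_mat d d" using linear_map_matD[OF assms(2)] by auto
  have "(rep_mat d \<phi> * rep_mat d \<psi>) $$ (p,q) = (\<Sum>l<d*d. rep_mat d \<phi> $$ (p,l) * rep_mat d \<psi> $$ (l,q))"
    by (rule mult_mat_index[OF rep_mat_carrier rep_mat_carrier pq])
  also have "\<dots> = (\<Sum>l<d*d. \<psi> ?E $$ (l div d, l mod d) * \<phi> (mat_unit d (l div d) (l mod d)) $$ (p div d, p mod d))"
    using pq by (intro sum.cong) (auto simp: rep_mat_def)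
  also have "\<dots> = (\<Sum>a<d. \<Sum>b<d. \<psi> ?E $$ (a,b) * \<phi> (mat_unit d a b) $$ (p div d, p mod d))"
    by (rule sum_div_mod)
  also have "\<dots> = \<phi> (\<psi> ?E) $$ (p div d, p mod d)"
    by (rule linear_map_expand[OF assms(1) E div_mod_lt[OF pq(1)], symmetric])
  finally show "rep_mat d (\<phi> \<circ> \<psi>) $$ (p,q) = (rep_mat d \<phi> * rep_mat d \<psi>) $$ (p,q)"
    using pq by (simp add: rep_mat_def)
qed (auto simp: rep_mat_def)

lemma rep_mat_id: "rep_mat d id = 1\<^sub>m (d*d)"
proof (rule eq_matI)
  fix p q assume "p < dim_row (1\<^sub>m (d*d))" "q < dim_col (1\<^sub>m (d*d))"
  then show "rep_mat d id $$ (p,q) = 1\<^sub>m (d*d) $$ (p,q)"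
    using div_mod_lt[of p d d] div_mod_lt[of q d d]
    by (auto simp: rep_mat_def intro: div_mod_eqI)
qed (auto simp: rep_mat_def)

lemma rep_mat_funpow:
  assumes "linear_map_mat d \<phi>"
  shows "rep_mat d (\<phi> ^^ n) = rep_mat d \<phi> ^\<^sub>m n"
proof (induction n)
  case 0
  then show ?case using rep_mat_id[of d] by (simp add: rep_mat_def[of d \<phi>] id_def)
next
  case (Suc n)
  show ?case
    unfolding funpow_Suc_right rep_mat_comp[OF linear_map_funpow[OF assms] assms] Suc by simp
qed

lemma mat_of_vec_eq_zero: "x \<in> carrier_vec (d*d) \<Longrightarrow> mat_of_vec d x = 0\<^sub>m d d \<Longrightarrow> x = 0\<^sub>v (d*d)"
proof -
  assume x: "x \<in> carrier_vec (d*d)" "mat_of_vec d x = 0\<^sub>m d d"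
  then have "x = vec_of_mat d (0\<^sub>m d d)" using vec_of_mat_of_vec by metis
  also have "\<dots> = 0\<^sub>v (d*d)" by (rule eq_vecI) (auto simp: vec_of_mat_def div_mod_lt)
  finally show ?thesis .
qed

lemma rep_mat_eigenmatrix:
  assumes l: "linear_map_mat d \<phi>" and z: "poly (char_poly (rep_mat d \<phi>)) z = 0"
  obtains X where "X \<in> carrier_mat d d" "X \<noteq> 0\<^sub>m d d" "\<phi> X = z \<cdot>\<^sub>m X"
proof -
  from z have "eigenvalue (rep_mat d \<phi>) z" using eigenvalue_root_char_poly[OF rep_mat_carrier] by blast
  then obtain x where x: "x \<in> carrier_vec (d*d)" "x \<noteq> 0\<^sub>v (d*d)" "rep_mat d \<phi> *\<^sub>v x = z \<cdot>\<^sub>v x"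
    unfolding eigenvalue_def eigenvector_def by (auto simp: rep_mat_def)
  let ?X = "mat_of_vec d x"
  have "vec_of_mat d (\<phi> ?X) = z \<cdot>\<^sub>v x"
    using rep_mat_mult_vec[OF l, of ?X] x vec_of_mat_of_vec by simp
  then have "\<phi> ?X = mat_of_vec d (z \<cdot>\<^sub>v x)"
    using mat_of_vec_of_mat[of "\<phi> ?X" d] linear_map_matD(1)[OF l, of ?X] by simp
  also have "\<dots> = z \<cdot>\<^sub>m ?X" using x(1) by (intro eq_matI) (auto simp: mat_of_vec_def index_lt)
  finally show ?thesis using that[of ?X] mat_of_vec_eq_zero x by auto
qed

section \<open>The trace pairing\<close>

lemma mtrace_mult:
  assumes "A \<in> carrier_mat n m" "B \<in> carrier_mat m n"
  shows "mtrace (A * B) = (\<Sum>i<n. \<Sum>j<m. A $$ (i,j) * B $$ (j,i))"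
  using assms mult_mat_index[OF assms] by (auto simp: mtrace_def simp del: index_mult_mat(1))

lemma mtrace_comm:
  assumes "A \<in> carrier_mat n m" "B \<in> carrier_mat m n"
  shows "mtrace (A * B) = mtrace (B * A)"
  unfolding mtrace_mult[OF assms] mtrace_mult[OF assms(2,1)]
  by (subst sum.swap) (simp add: mult.commute)

lemma mtrace_add: "A \<in> carrier_mat n n \<Longrightarrow> B \<in> carrier_mat n n \<Longrightarrow> mtrace (A + B) = mtrace A + mtrace B"
  by (auto simp: mtrace_def sum.distrib)

lemma mtrace_minus: "A \<in> carrier_mat n n \<Longrightarrow> B \<in> carrier_mat n n \<Longrightarrow> mtrace (A - B) = mtrace A - mtrace B"
  by (auto simp: mtrace_def sum_subtractf)

lemma mtrace_smult: "A \<in> carrier_mat n n \<Longrightarrow> mtrace (c \<cdot>\<^sub>m A) = c * mtrace A"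
  by (auto simp: mtrace_def sum_distrib_left)

lemma mtrace_adjoint: "A \<in> carrier_mat n n \<Longrightarrow> mtrace (mat_adjoint A) = cnj (mtrace A)"
  by (auto simp: mtrace_def)

lemma mtrace_mat_unit:
  assumes "B \<in> carrier_mat n n" "a < n" "b < n"
  shows "mtrace (mat_unit n a b * B) = B $$ (b,a)" "mtrace (B * mat_unit n a b) = B $$ (b,a)"
proof -
  have "mtrace (mat_unit n a b * B) = (\<Sum>i<n. \<Sum>j<n. if j = b then if i = a then B $$ (j,i) else 0 else 0)"
    unfolding mtrace_mult[OF mat_unit_carrier assms(1)] by (intro sum.cong) auto
  also have "\<dots> = B $$ (b,a)" using assms by simp
  finally show "mtrace (mat_unit n a b * B) = B $$ (b,a)" .
  then show "mtrace (B * mat_unit n a b) = B $$ (b,a)"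
    using mtrace_comm[OF assms(1) mat_unit_carrier] by simp
qed

lemma mat_eq_of_mtrace:
  assumes "Y \<in> carrier_mat n n" "Z \<in> carrier_mat n n"
    "\<And>B. B \<in> carrier_mat n n \<Longrightarrow> mtrace (B * Y) = mtrace (B * Z)"
  shows "Y = Z"
proof (rule eq_matI)
  fix i j assume "i < dim_row Z" "j < dim_col Z"
  then have "i < n" "j < n" using assms by auto
  then show "Y $$ (i,j) = Z $$ (i,j)"
    using mtrace_mat_unit(1)[OF assms(1), of j i] mtrace_mat_unit(1)[OF assms(2), of j i]
      assms(3)[OF mat_unit_carrier[of n j i]] by simp
qed (use assms in auto)

text \<open>The transpose has the same characteristic polynomial. Its eigenvectors are functionals
  on matrices, and every functional has the form X |-> tr (u X).\<close>

lemma rep_mat_left_eigenmatrix: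
  assumes l: "linear_map_mat d \<phi>" and z: "poly (char_poly (rep_mat d \<phi>)) z = 0"
  obtains u where "u \<in> carrier_mat d d" "u \<noteq> 0\<^sub>m d d"
    "\<And>X. X \<in> carrier_mat d d \<Longrightarrow> mtrace (u * \<phi> X) = z * mtrace (u * X)"
proof -
  let ?M = "rep_mat d \<phi>"
  have T: "transpose_mat ?M \<in> carrier_mat (d*d) (d*d)" by simp
  from z have "poly (char_poly (transpose_mat ?M)) z = 0" by (simp add: char_poly_transpose_mat[of _ "d*d"])
  then have "eigenvalue (transpose_mat ?M) z" using eigenvalue_root_char_poly[OF T] by blast
  then obtain w where w: "w \<in> carrier_vec (d*d)" "w \<noteq> 0\<^sub>v (d*d)" "transpose_mat ?M *\<^sub>v w = z \<cdot>\<^sub>v w"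
    unfolding eigenvalue_def eigenvector_def by (auto simp: rep_mat_def)
  \<comment> \<open>tr (u X) pairs entry (b,a) of \<open>u\<close> with entry (a,b) of X, so the
    reshaped functional has to be transposed.\<close>
  define u where "u = transpose_mat (mat_of_vec d w)"
  have u: "u \<in> carrier_mat d d" by (simp add: u_def)
  have u0: "u \<noteq> 0\<^sub>m d d"
  proof
    assume "u = 0\<^sub>m d d"
    then have "transpose_mat u = 0\<^sub>m d d" by simp
    then have "mat_of_vec d w = 0\<^sub>m d d" unfolding u_def by simp
    then show False using mat_of_vec_eq_zero w by auto
  qed
  have tr: "mtrace (u * X) = w \<bullet> vec_of_mat d X" if X: "X \<in> carrier_mat d d" for X
  proof -
    have "w \<bullet> vec_of_mat d X = (\<Sum>q<d*d. w $ (q div d * d + q mod d) * X $$ (q div d, q mod d))"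
      using w(1) by (auto simp: scalar_prod_def lessThan_atLeast0 vec_of_mat_def intro!: sum.cong)
    also have "\<dots> = (\<Sum>a<d. \<Sum>b<d. w $ (a * d + b) * X $$ (a,b))"
      by (rule sum_div_mod)
    also have "\<dots> = (\<Sum>b<d. \<Sum>a<d. w $ (a * d + b) * X $$ (a,b))" by (rule sum.swap)
    also have "\<dots> = mtrace (u * X)"
      unfolding mtrace_mult[OF u X] by (intro sum.cong) (auto simp: u_def mat_of_vec_def)
    finally show ?thesis by simp
  qed
  have "mtrace (u * \<phi> X) = z * mtrace (u * X)" if X: "X \<in> carrier_mat d d" for X
  proof -
    let ?x = "vec_of_mat d X"
    have "mtrace (u * \<phi> X) = w \<bullet> (?M *\<^sub>v ?x)"
      using tr linear_map_matD(1)[OF l X] rep_mat_mult_vec[OF l X] by simp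
    also have "\<dots> = (transpose_mat ?M *\<^sub>v w) \<bullet> ?x"
      using w(1) by (subst transpose_vec_mult_scalar[of ?M "d*d" "d*d" ?x w]) auto
    also have "\<dots> = z * mtrace (u * X)" unfolding w(3) tr[OF X] using w(1) by simp
    finally show ?thesis .
  qed
  with u u0 that show ?thesis by blast
qed

subsection \<open>Positive trace-preserving maps\<close>

text \<open>What the fixed point arguments use of a channel, in a form stable under powers and under
  change of basis. Preservation of adjoints is carried as a clause of its own;
  \<open>channel_ptp\<close> reads it off the Choi matrix.\<close>

definition ptp :: "nat \<Rightarrow> (complex mat \<Rightarrow> complex mat) \<Rightarrow> bool" where
  "ptp d \<phi> \<longleftrightarrow> linear_map_mat d \<phi> \<and> trace_preserving d \<phi> \<and> (\<forall>X. psd d X \<longrightarrow> psd d (\<phi> X)) \<and>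
     (\<forall>X \<in> carrier_mat d d. \<phi> (mat_adjoint X) = mat_adjoint (\<phi> X))"

lemma ptpD:
  assumes "ptp d \<phi>"
  shows "linear_map_mat d \<phi>" "X \<in> carrier_mat d d \<Longrightarrow> mtrace (\<phi> X) = mtrace X"
    "psd d X \<Longrightarrow> psd d (\<phi> X)" "X \<in> carrier_mat d d \<Longrightarrow> \<phi> (mat_adjoint X) = mat_adjoint (\<phi> X)"
    "X \<in> carrier_mat d d \<Longrightarrow> \<phi> X \<in> carrier_mat d d"
  using assms linear_map_matD(1) unfolding ptp_def trace_preserving_def by blast+

lemma ptp_funpow: "ptp d \<phi> \<Longrightarrow> ptp d (\<phi> ^^ n)"
proof (induction n)
  case 0
  then show ?case by (simp add: ptp_def linear_map_mat_def trace_preserving_def)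
next
  case (Suc n)
  have l: "linear_map_mat d (\<phi> ^^ Suc n)" using linear_map_funpow ptpD(1) Suc.prems by blast
  then show ?case using Suc ptpD[OF Suc.prems] ptpD[OF Suc.IH[OF Suc.prems]]
    unfolding ptp_def[of d "\<phi> ^^ Suc n"] trace_preserving_def by auto
qed

section \<open>The Choi matrix and Kraus operators\<close>

definition max_entangled :: "nat \<Rightarrow> complex mat" where
  "max_entangled d = mat (d*d) (d*d) (\<lambda>(p,q). if p div d = p mod d \<and> q div d = q mod d then 1 else 0)"

lemma psd_max_entangled: "psd (d*d) (max_entangled d)"
proof -
  have "qform (d*d) (max_entangled d) x = of_real ((cmod (\<Sum>p<d*d. if p div d = p mod d then x p else 0))\<^sup>2)" for x
  proof -
    let ?s = "\<Sum>p<d*d. if p div d = p mod d then x p else 0"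
    have "qform (d*d) (max_entangled d) x
      = (\<Sum>p<d*d. \<Sum>q<d*d. cnj (if p div d = p mod d then x p else 0) * (if q div d = q mod d then x q else 0))"
      unfolding qform_def by (intro sum.cong) (auto simp: max_entangled_def)
    also have "\<dots> = cnj ?s * ?s" unfolding cnj_sum sum_product ..
    finally show ?thesis by (subst complex_norm_square) (simp add: mult.commute)
  qed
  then show ?thesis unfolding psd_iff
    by (auto intro!: hermitianI[of _ "d*d"] simp: max_entangled_def)
qed

lemma block_max_entangled: "a < d \<Longrightarrow> b < d \<Longrightarrow> block d d (max_entangled d) a b = mat_unit d a b"
  by (rule eq_matI) (auto simp: block_def max_entangled_def index_lt)

text \<open>\<open>max_entangled\<close> is the unnormalised projection onto the sum of the e_i
  tensor e_i, and its (a,b) block is the matrix unit E_ab. Hence \<open>tensor_id\<close> turns it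
  into the Choi matrix of the map, which contains the images of all matrix units.\<close>

lemma tensor_max_entangled:
  assumes "i < d" "a < d" "j < d" "b < d"
  shows "tensor_id \<phi> d d (max_entangled d) $$ (i*d+a, j*d+b) = \<phi> (mat_unit d a b) $$ (i,j)"
  using assms by (simp add: tensor_id_def index_lt block_max_entangled)

text \<open>Positivity is complete positivity with \<open>k = 1\<close>; preservation of adjoints is
  hermiticity of the Choi matrix.\<close>

lemma channel_ptp:
  assumes "quantum_channel d \<phi>" "0 < d"
  shows "ptp d \<phi>"
proof -
  have l: "linear_map_mat d \<phi>" and cp: "completely_positive d \<phi>" and tp: "trace_preserving d \<phi>"
    using assms(1) unfolding quantum_channel_def by auto
  have pos: "psd d (\<phi> X)" if X: "psd d X" for X
  proof -
    have "block d 1 X 0 0 = X" using psdD(1)[OF X] by (intro eq_matI) (auto simp: block_def)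
    then have "tensor_id \<phi> d 1 X = \<phi> X"
      using linear_map_matD(1)[OF l psdD(1)[OF X]] by (intro eq_matI) (auto simp: tensor_id_def)
    moreover have "psd (d*1) (tensor_id \<phi> d 1 X)"
      using cp X unfolding completely_positive_def by auto
    ultimately show ?thesis by simp
  qed
  have choi: "psd (d*d) (tensor_id \<phi> d d (max_entangled d))"
    using cp psd_max_entangled assms(2) unfolding completely_positive_def by auto
  have sym: "\<phi> (mat_unit d a b) $$ (i,j) = cnj (\<phi> (mat_unit d b a) $$ (j,i))"
    if "i < d" "j < d" "a < d" "b < d" for i j a b
    using psd_herm[OF choi index_lt index_lt, of j b i a] that by (simp add: tensor_max_entangled)
  have "\<phi> (mat_adjoint X) = mat_adjoint (\<phi> X)" if X: "X \<in> carrier_mat d d" for X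
  proof (rule eq_matI)
    have c: "\<phi> X \<in> carrier_mat d d" "\<phi> (mat_adjoint X) \<in> carrier_mat d d" using linear_map_matD(1)[OF l] X by auto
    fix i j assume "i < dim_row (mat_adjoint (\<phi> X))" "j < dim_col (mat_adjoint (\<phi> X))"
    then have ij: "i < d" "j < d" using c by auto
    have "mat_adjoint (\<phi> X) $$ (i,j) = cnj (\<phi> X $$ (j,i))" using c ij by simp
    also have "\<dots> = (\<Sum>a<d. \<Sum>b<d. cnj (X $$ (a,b)) * \<phi> (mat_unit d b a) $$ (i,j))"
      unfolding linear_map_expand[OF l X ij(2,1)] cnj_sum complex_cnj_mult
      by (intro sum.cong refl, subst sym[OF ij]) auto
    also have "\<dots> = (\<Sum>b<d. \<Sum>a<d. cnj (X $$ (a,b)) * \<phi> (mat_unit d b a) $$ (i,j))" by (rule sum.swap)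
    also have "\<dots> = \<phi> (mat_adjoint X) $$ (i,j)"
      unfolding linear_map_expand[OF l mat_adjoint_carrier[OF X] ij]
      using X by (intro sum.cong refl) auto
    finally show "\<phi> (mat_adjoint X) $$ (i,j) = mat_adjoint (\<phi> X) $$ (i,j)" by simp
  qed (use linear_map_matD(1)[OF l X] linear_map_matD(1)[OF l mat_adjoint_carrier[OF X]] in auto)
  then show ?thesis using l tp pos unfolding ptp_def by blast
qed

lemma sandwich_index:
  assumes "K \<in> carrier_mat d d" "X \<in> carrier_mat d d" "i < d" "j < d"
  shows "(K * X * mat_adjoint K) $$ (i,j) = (\<Sum>a<d. \<Sum>b<d. X $$ (a,b) * (K $$ (i,a) * cnj (K $$ (j,b))))"
proof -
  have "(K * X * mat_adjoint K) $$ (i,j) = (\<Sum>b<d. (K * X) $$ (i,b) * cnj (K $$ (j,b)))"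
    using mult_mat_index[of "K * X" d d "mat_adjoint K" d i j] assms by auto
  also have "\<dots> = (\<Sum>b<d. \<Sum>a<d. X $$ (a,b) * (K $$ (i,a) * cnj (K $$ (j,b))))"
    using mult_mat_index[OF assms(1,2,3)] by (intro sum.cong) (auto simp: sum_distrib_left sum_distrib_right mult_ac)
  also have "\<dots> = (\<Sum>a<d. \<Sum>b<d. X $$ (a,b) * (K $$ (i,a) * cnj (K $$ (j,b))))" by (rule sum.swap)
  finally show ?thesis .
qed

text \<open>Kraus operators, in the weak form in which the sum is taken only after pairing with a test matrix.\<close>
definition kraus_family :: "nat \<Rightarrow> (complex mat \<Rightarrow> complex mat) \<Rightarrow> nat \<Rightarrow> (nat \<Rightarrow> complex mat) \<Rightarrow> bool" where
  "kraus_family d \<phi> N K \<longleftrightarrow> (\<forall>m. K m \<in> carrier_mat d d) \<and>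
     (\<forall>B \<in> carrier_mat d d. \<forall>X \<in> carrier_mat d d.
       mtrace (B * \<phi> X) = (\<Sum>m<N. mtrace (B * (K m * X * mat_adjoint (K m)))))"

lemma kraus_familyD:
  assumes "kraus_family d \<phi> N K"
  shows "K m \<in> carrier_mat d d" "B \<in> carrier_mat d d \<Longrightarrow> X \<in> carrier_mat d d \<Longrightarrow>
    mtrace (B * \<phi> X) = (\<Sum>m<N. mtrace (B * (K m * X * mat_adjoint (K m))))"
  using assms unfolding kraus_family_def by auto

text \<open>The Gram vectors of the Choi matrix, reshaped into d by d matrices with the output index
  as row, are Kraus operators.\<close>

lemma channel_kraus:
  assumes "quantum_channel d \<phi>" "0 < d"
  obtains K where "kraus_family d \<phi> (d*d) K"
proof -
  have l: "linear_map_mat d \<phi>" and cp: "completely_positive d \<phi>"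
    using assms(1) unfolding quantum_channel_def by auto
  have "psd (d*d) (tensor_id \<phi> d d (max_entangled d))"
    using cp psd_max_entangled assms(2) unfolding completely_positive_def by auto
  from psd_gram[OF this] obtain e :: "nat \<Rightarrow> nat \<Rightarrow> complex" where
    e: "\<And>p q. p < d*d \<Longrightarrow> q < d*d \<Longrightarrow> tensor_id \<phi> d d (max_entangled d) $$ (p,q) = (\<Sum>l<d*d. e l p * cnj (e l q))"
    by blast
  define K where "K l = mat d d (\<lambda>(i,a). e l (i*d+a))" for l
  have K: "K m \<in> carrier_mat d d" for m by (simp add: K_def)
  have u: "\<phi> (mat_unit d a b) $$ (i,j) = (\<Sum>l<d*d. K l $$ (i,a) * cnj (K l $$ (j,b)))"
    if "i < d" "j < d" "a < d" "b < d" for i j a b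
    using e[OF index_lt index_lt, of i a j b] that by (simp add: tensor_max_entangled K_def)
  have phi: "\<phi> X $$ (i,j) = (\<Sum>l<d*d. (K l * X * mat_adjoint (K l)) $$ (i,j))"
    if X: "X \<in> carrier_mat d d" and ij: "i < d" "j < d" for X i j
  proof -
    have "\<phi> X $$ (i,j) = (\<Sum>a<d. \<Sum>b<d. \<Sum>l<d*d. X $$ (a,b) * (K l $$ (i,a) * cnj (K l $$ (j,b))))"
      unfolding linear_map_expand[OF l X ij] using u ij by (intro sum.cong) (auto simp: sum_distrib_left)
    also have "\<dots> = (\<Sum>a<d. \<Sum>l<d*d. \<Sum>b<d. X $$ (a,b) * (K l $$ (i,a) * cnj (K l $$ (j,b))))"
      by (intro sum.cong refl sum.swap)
    also have "\<dots> = (\<Sum>l<d*d. \<Sum>a<d. \<Sum>b<d. X $$ (a,b) * (K l $$ (i,a) * cnj (K l $$ (j,b))))"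
      by (rule sum.swap)
    finally show ?thesis using sandwich_index[OF K X ij] by simp
  qed
  have "mtrace (B * \<phi> X) = (\<Sum>m<d*d. mtrace (B * (K m * X * mat_adjoint (K m))))"
    if B: "B \<in> carrier_mat d d" and X: "X \<in> carrier_mat d d" for B X
  proof -
    have "mtrace (B * \<phi> X) = (\<Sum>i<d. \<Sum>j<d. \<Sum>l<d*d. B $$ (i,j) * (K l * X * mat_adjoint (K l)) $$ (j,i))"
      unfolding mtrace_mult[OF B linear_map_matD(1)[OF l X]] using phi[OF X]
      by (intro sum.cong) (auto simp: sum_distrib_left)
    also have "\<dots> = (\<Sum>i<d. \<Sum>l<d*d. \<Sum>j<d. B $$ (i,j) * (K l * X * mat_adjoint (K l)) $$ (j,i))"
      by (intro sum.cong refl sum.swap)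
    also have "\<dots> = (\<Sum>l<d*d. \<Sum>i<d. \<Sum>j<d. B $$ (i,j) * (K l * X * mat_adjoint (K l)) $$ (j,i))"
      by (rule sum.swap)
    also have "\<dots> = (\<Sum>m<d*d. mtrace (B * (K m * X * mat_adjoint (K m))))"
    proof (intro sum.cong refl)
      fix l
      have "K l * X * mat_adjoint (K l) \<in> carrier_mat d d" using K X by (meson mat_adjoint_carrier mult_carrier_mat)
      from mtrace_mult[OF B this] show "(\<Sum>i<d. \<Sum>j<d. B $$ (i,j) * (K l * X * mat_adjoint (K l)) $$ (j,i))
        = mtrace (B * (K l * X * mat_adjoint (K l)))" by simp
    qed
    finally show ?thesis .
  qed
  with K that show ?thesis unfolding kraus_family_def by blast
qed

subsection \<open>Fixed points of positive trace-preserving maps\<close>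

definition sandwich :: "complex mat \<Rightarrow> complex mat \<Rightarrow> complex mat" where
  "sandwich B X = B * X * mat_adjoint B"

lemma sandwich_carrier [simp, intro]: "B \<in> carrier_mat d d \<Longrightarrow> X \<in> carrier_mat d d \<Longrightarrow> sandwich B X \<in> carrier_mat d d"
  unfolding sandwich_def by (meson mat_adjoint_carrier mult_carrier_mat)

lemma sandwich_comp:
  assumes "A \<in> carrier_mat n n" "B \<in> carrier_mat n n" "C \<in> carrier_mat n n"
  shows "sandwich C (sandwich B A) = sandwich (C * B) A"
  unfolding sandwich_def by (rule sandwich_sandwich[OF assms])

lemma sandwich_one: "A \<in> carrier_mat n n \<Longrightarrow> sandwich (1\<^sub>m n) A = A"
  by (simp add: sandwich_def)

lemma sandwich_unitary:
  assumes "unitary_mat n U" "A \<in> carrier_mat n n"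
  shows "sandwich (mat_adjoint U) (sandwich U A) = A" "sandwich U (sandwich (mat_adjoint U) A) = A"
  using unitary_matD[OF assms(1)] sandwich_comp[OF assms(2), of U "mat_adjoint U"]
    sandwich_comp[OF assms(2), of "mat_adjoint U" U] sandwich_one[OF assms(2)] by auto

lemma linear_sandwich:
  assumes B: "B \<in> carrier_mat d d"
  shows "linear_map_mat d (sandwich B)"
proof -
  have B': "mat_adjoint B \<in> carrier_mat d d" using B by auto
  have "sandwich B (X + Y) = sandwich B X + sandwich B Y" if "X \<in> carrier_mat d d" "Y \<in> carrier_mat d d" for X Y
    unfolding sandwich_def mult_add_distrib_mat[OF B that]
    using B that by (intro add_mult_distrib_mat[OF _ _ B']) auto
  moreover have "sandwich B (c \<cdot>\<^sub>m X) = c \<cdot>\<^sub>m sandwich B X" if "X \<in> carrier_mat d d" for c X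
    unfolding sandwich_def mult_smult_distrib[OF B that]
    using B that by (intro mult_smult_assoc_mat[OF _ B']) auto
  ultimately show ?thesis unfolding linear_map_mat_def using B by auto
qed

lemma ptp_sandwich:
  assumes "unitary_mat d U"
  shows "ptp d (sandwich U)"
proof -
  note u = unitary_matD[OF assms]
  have "mtrace (sandwich U X) = mtrace X" if X: "X \<in> carrier_mat d d" for X
  proof -
    have "mtrace (sandwich U X) = mtrace (mat_adjoint U * (U * X))"
      unfolding sandwich_def by (rule mtrace_comm[of _ d d]) (use u X in auto)
    also have "mat_adjoint U * (U * X) = mat_adjoint U * U * X"
      using assoc_mult_mat[OF u(2,1) X] by simp
    finally show ?thesis unfolding u(3) using X by simp
  qed
  moreover have "sandwich U (mat_adjoint X) = mat_adjoint (sandwich U X)" if X: "X \<in> carrier_mat d d" for X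
  proof -
    have "mat_adjoint (sandwich U X) = U * mat_adjoint (U * X)"
      unfolding sandwich_def by (subst mat_adjoint_mult[of _ d d _ d]) (use u X in auto)
    also have "\<dots> = sandwich U (mat_adjoint X)"
      unfolding sandwich_def mat_adjoint_mult[OF u(1) X]
      using assoc_mult_mat[OF u(1) mat_adjoint_carrier[OF X] u(2)] by simp
    finally show ?thesis by simp
  qed
  ultimately show ?thesis
    using linear_sandwich[OF u(1)] psd_conj[OF _ u(1)] unfolding ptp_def trace_preserving_def
    by (auto simp: sandwich_def)
qed

lemma ptp_comp:
  assumes "ptp d \<phi>" "ptp d \<psi>"
  shows "ptp d (\<phi> \<circ> \<psi>)"
  using linear_map_comp[OF ptpD(1)[OF assms(1)] ptpD(1)[OF assms(2)]] ptpD[OF assms(1)] ptpD[OF assms(2)]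
  unfolding ptp_def[of d "\<phi> \<circ> \<psi>"] trace_preserving_def by auto

text \<open>Comparing traces forces the diagonal of \<open>\<phi> D\<^sub>+\<close> to be that of \<open>D\<^sub>+\<close>, and likewise for
  \<open>D\<^sub>-\<close>; positivity then kills every off-diagonal entry, because one of the two images vanishes
  on that row or column.\<close>
lemma fixed_diag_positive_part:
  assumes "ptp d \<phi>" "\<phi> (real_diag d f) = real_diag d f"
  shows "\<phi> (real_diag d (\<lambda>i. max 0 (f i))) = real_diag d (\<lambda>i. max 0 (f i))"
proof -
  note ph = ptpD[OF assms(1)]
  let ?P = "real_diag d (\<lambda>i. max 0 (f i))" and ?N = "real_diag d (\<lambda>i. max 0 (- f i))"
  have P: "psd d (\<phi> ?P)" and N: "psd d (\<phi> ?N)" by (auto intro!: ph(3) psd_real_diag)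
  note Pc = psdD(1)[OF P] and Nc = psdD(1)[OF N]
  have "?P = real_diag d f + ?N"
    by (rule eq_matI) (auto simp: max_def)
  then have "\<phi> ?P = real_diag d f + \<phi> ?N"
    using linear_map_matD(2)[OF ph(1), of "real_diag d f" ?N] assms(2) by simp
  then have e: "\<phi> ?P $$ (i,j) = real_diag d f $$ (i,j) + \<phi> ?N $$ (i,j)" if "i < d" "j < d" for i j
    using that Nc by simp
  define a where "a i = Re (\<phi> ?P $$ (i,i))" for i
  define b where "b i = Re (\<phi> ?N $$ (i,i))" for i
  have ab: "a i = f i + b i" "0 \<le> a i" "0 \<le> b i" if "i < d" for i
    using e[OF that that] psd_diag_entry(1)[OF P that] psd_diag_entry(1)[OF N that] that
    by (auto simp: a_def b_def)
  have "(\<Sum>i<d. a i) = Re (mtrace (\<phi> ?P))"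
    using Pc by (auto simp: mtrace_def a_def)
  also have "\<dots> = (\<Sum>i<d. max 0 (f i))"
    using ph(2)[of ?P] by (simp add: mtrace_def)
  finally have "(\<Sum>i<d. a i - max 0 (f i)) = 0" by (simp add: sum_subtractf)
  \<comment> \<open>\<open>a i = f i + b i\<close> with \<open>a i\<close> and \<open>b i\<close>
    nonnegative, so \<open>a i\<close> dominates both 0 and \<open>f i\<close>; equality of the sums
    leaves no slack in any term.\<close>
  moreover have "0 \<le> a i - max 0 (f i)" if "i \<in> {..<d}" for i using ab[of i] that by auto
  ultimately have "\<forall>i\<in>{..<d}. a i - max 0 (f i) = 0"
    using sum_nonneg_eq_0_iff[of "{..<d}" "\<lambda>i. a i - max 0 (f i)"] by simp
  then have aeq: "a i = max 0 (f i)" if "i < d" for i using that by auto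
  have Pd: "\<phi> ?P $$ (i,i) = of_real (max 0 (f i))" if "i < d" for i
    using psd_diag_entry(3)[OF P that] aeq[OF that] by (simp add: a_def)
  have Nd: "\<phi> ?N $$ (i,i) = 0" if "i < d" "0 < f i" for i
    using psd_diag_entry(3)[OF N that(1)] aeq[OF that(1)] ab(1)[OF that(1)] that(2) by (simp add: b_def)
  show ?thesis
  proof (rule eq_matI)
    fix i j assume "i < dim_row ?P" "j < dim_col ?P"
    then have ij: "i < d" "j < d" by auto
    consider "i = j" | "i \<noteq> j" "f i \<le> 0" | "i \<noteq> j" "0 < f i" by linarith
    then show "\<phi> ?P $$ (i,j) = ?P $$ (i,j)"
    proof cases
      case 1
      then show ?thesis using Pd ij by simp
    next
      case 2
      then show ?thesis using psd_zero_diag_row(1)[OF P ij] Pd[OF ij(1)] ij by simp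
    next
      case 3
      then show ?thesis using psd_zero_diag_row(1)[OF N ij] Nd[OF ij(1)] ij e[OF ij] by simp
    qed
  qed (use Pc in auto)
qed

lemma smult_real_diag: "of_real c \<cdot>\<^sub>m real_diag d f = real_diag d (\<lambda>i. c * f i)"
  by (rule eq_matI) auto

lemma semipositive_of_spectral:
  assumes U: "unitary_mat d U" and g: "\<And>i. i < d \<Longrightarrow> 0 \<le> g i"
    and fixg: "\<phi> (sandwich U (real_diag d g)) = sandwich U (real_diag d g)"
    and pos: "i < d" "0 < g i" and zero: "j < d" "g j = 0"
  shows "has_semipositive_fixed_point d \<phi>"
proof -
  let ?A = "sandwich U (real_diag d g)"
  have "psd d ?A" unfolding sandwich_def
    using g by (intro psd_conj[OF _ unitary_matD(1)[OF U]] psd_real_diag) auto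
  moreover have "det ?A = 0"
    unfolding sandwich_def det_spectral[OF U] using zero by auto
  moreover have "?A \<noteq> 0\<^sub>m d d"
  proof
    assume "?A = 0\<^sub>m d d"
    then have "real_diag d g = sandwich (mat_adjoint U) (0\<^sub>m d d)"
      using sandwich_unitary(1)[OF U, of "real_diag d g"] by simp
    also have "\<dots> = 0\<^sub>m d d"
      using linear_map_zero[OF linear_sandwich[OF unitary_matD(2)[OF U]]] .
    finally have "real_diag d g $$ (i,i) = 0" using pos by simp
    then show False using pos by simp
  qed
  ultimately show ?thesis
    unfolding has_semipositive_fixed_point_def semipositive_fixed_point_def using fixg by blast
qed

text \<open>In an eigenbasis of \<open>A\<close> its positive and negative parts are fixed too. If
  the eigenvalues do not all have the same strict sign, one of these parts is nonzero and singular;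
  otherwise a real multiple of \<open>A\<close> is a faithful state.\<close>

lemma fixed_hermitian_cases:
  assumes \<phi>: "ptp d \<phi>" and A: "A \<in> carrier_mat d d" "mat_adjoint A = A" "A \<noteq> 0\<^sub>m d d" "\<phi> A = A"
  shows "has_semipositive_fixed_point d \<phi> \<or>
    (\<exists>c. psd d (of_real c \<cdot>\<^sub>m A) \<and> det (of_real c \<cdot>\<^sub>m A) \<noteq> 0 \<and> mtrace (of_real c \<cdot>\<^sub>m A) = 1)"
proof -
  obtain U f where U: "unitary_mat d U" and AU: "A = sandwich U (real_diag d f)"
    using hermitian_spectral[OF A(1,2)] unfolding sandwich_def by auto
  note u = unitary_matD[OF U]
  define \<psi> where "\<psi> = sandwich (mat_adjoint U) \<circ> (\<phi> \<circ> sandwich U)"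
  have \<psi>: "ptp d \<psi>" unfolding \<psi>_def
    by (intro ptp_comp ptp_sandwich \<phi> U unitary_mat_adjoint)
  have \<psi>A: "\<psi> (real_diag d f) = real_diag d f"
    unfolding \<psi>_def using A(4) sandwich_unitary(1)[OF U, of "real_diag d f"] by (simp add: AU)
  have lift: "\<phi> (sandwich U (real_diag d g)) = sandwich U (real_diag d g)"
    if "\<psi> (real_diag d g) = real_diag d g" for g
    using sandwich_unitary(2)[OF U, of "\<phi> (sandwich U (real_diag d g))"] that
      ptpD(5)[OF \<phi>, of "sandwich U (real_diag d g)"] u(1) unfolding \<psi>_def by simp
  \<comment> \<open>The negative part of \<open>f\<close> is the positive part of
    \<open>- f\<close>, so both come from the same lemma.\<close>
  have \<psi>A': "\<psi> (real_diag d (\<lambda>i. - f i)) = real_diag d (\<lambda>i. - f i)"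
    using linear_map_matD(3)[OF ptpD(1)[OF \<psi>], of "real_diag d f" "of_real (- 1)"] \<psi>A
      smult_real_diag[of "- 1" d f] by simp
  note p = lift[OF fixed_diag_positive_part[OF \<psi> \<psi>A]] and q = lift[OF fixed_diag_positive_part[OF \<psi> \<psi>A']]
  \<comment> \<open>It is applied with \<open>c\<close> the reciprocal of the trace. For negative
    definite \<open>A\<close> this is a negative number, so both definite cases end here.\<close>
  have main: "\<exists>c. psd d (of_real c \<cdot>\<^sub>m A) \<and> det (of_real c \<cdot>\<^sub>m A) \<noteq> 0 \<and> mtrace (of_real c \<cdot>\<^sub>m A) = 1"
    if pos: "\<And>i. i < d \<Longrightarrow> 0 < c * f i" and s: "(\<Sum>i<d. c * f i) = 1" for c
  proof -
    have cA: "of_real c \<cdot>\<^sub>m A = sandwich U (real_diag d (\<lambda>i. c * f i))"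
      unfolding AU smult_real_diag[symmetric] using linear_map_matD(3)[OF linear_sandwich[OF u(1)], of "real_diag d f"] by simp
    have "psd d (of_real c \<cdot>\<^sub>m A)" unfolding cA sandwich_def
      using pos by (intro psd_conj[OF _ u(1)] psd_real_diag) (auto simp: less_imp_le)
    moreover have "(\<Prod>i<d. c * f i) > 0" using pos by (intro prod_pos) auto
    then have "det (of_real c \<cdot>\<^sub>m A) \<noteq> 0"
      unfolding cA sandwich_def det_spectral[OF U] of_real_eq_0_iff by (rule less_imp_neq[THEN not_sym])
    moreover have "mtrace (of_real c \<cdot>\<^sub>m A) = of_real (\<Sum>i<d. c * f i)"
      unfolding cA using ptpD(2)[OF ptp_sandwich[OF U], of "real_diag d (\<lambda>i. c * f i)"] by (simp add: mtrace_def)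
    ultimately show ?thesis unfolding s by auto
  qed
  consider (a) i j where "i < d" "j < d" "0 < f i" "f j \<le> 0" | (b) i j where "i < d" "j < d" "f i < 0" "0 \<le> f j"
    | (c) "\<forall>i<d. 0 < f i" | (n) "\<forall>i<d. f i < 0" | (e) "\<forall>i<d. f i = 0" by (metis linorder_neqE_linordered_idom order_less_imp_le linorder_not_less)
  then show ?thesis
  proof cases
    case a
    then show ?thesis
      using semipositive_of_spectral[where g = "\<lambda>i. max 0 (f i)" and i = i and j = j and \<phi> = \<phi>, OF U _ p] by simp
  next
    case b
    then show ?thesis
      using semipositive_of_spectral[where g = "\<lambda>i. max 0 (- f i)" and i = i and j = j and \<phi> = \<phi>, OF U _ q] by simp
  next
    case e
    then have "real_diag d f = 0\<^sub>m d d" by (intro eq_matI) auto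
    then have "A = 0\<^sub>m d d" unfolding AU using linear_map_zero[OF linear_sandwich[OF u(1)]] by simp
    with A show ?thesis by simp
  next
    case c
    have d: "0 < d" using A by (cases d) auto
    have s: "(\<Sum>i<d. f i) > 0" using c d by (intro sum_pos) auto
    then show ?thesis
      using c main[of "1 / (\<Sum>i<d. f i)"] by (simp add: sum_divide_distrib[symmetric])
  next
    case n
    have d: "0 < d" using A by (cases d) auto
    have "(\<Sum>i<d. - f i) > 0" using n d by (intro sum_pos) auto
    then have s: "(\<Sum>i<d. f i) < 0" by (simp add: sum_negf)
    then show ?thesis
      using n main[of "1 / (\<Sum>i<d. f i)"] by (simp add: sum_divide_distrib[symmetric] divide_neg_neg)
  qed
qed

text \<open>For c = 1 this is twice the real part of \<open>Y\<close>, for c = \<i> minus twice its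
  imaginary part. They determine \<open>Y\<close>, so one of the two is nonzero when
  \<open>Y\<close> is.\<close>

definition herm_part :: "complex \<Rightarrow> complex mat \<Rightarrow> complex mat" where
  "herm_part c Y = c \<cdot>\<^sub>m Y + cnj c \<cdot>\<^sub>m mat_adjoint Y"

lemma fixed_hermitian_of_fixed:
  assumes \<phi>: "ptp d \<phi>" and Y: "Y \<in> carrier_mat d d" "Y \<noteq> 0\<^sub>m d d" "\<phi> Y = Y"
  obtains c where "herm_part c Y \<noteq> 0\<^sub>m d d"
    "mat_adjoint (herm_part c Y) = herm_part c Y"
    "\<phi> (herm_part c Y) = herm_part c Y"
proof -
  let ?H = "\<lambda>c. herm_part c Y"
  have Y': "mat_adjoint Y \<in> carrier_mat d d" using Y by auto
  have "mat_adjoint (?H c) = ?H c" for c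
    using Y by (intro eq_matI) (auto simp: herm_part_def)
  moreover have "\<phi> (?H c) = ?H c" for c
    using linear_map_matD[OF ptpD(1)[OF \<phi>]] ptpD(4)[OF \<phi> Y(1)] Y Y' by (simp add: herm_part_def)
  moreover have "?H 1 \<noteq> 0\<^sub>m d d \<or> ?H \<i> \<noteq> 0\<^sub>m d d"
  proof (rule ccontr)
    assume "\<not> ?thesis"
    then have h: "?H 1 = 0\<^sub>m d d" "?H \<i> = 0\<^sub>m d d" by auto
    have "Y = 0\<^sub>m d d"
    proof (rule eq_matI)
      fix i j assume "i < dim_row (0\<^sub>m d d)" "j < dim_col (0\<^sub>m d d)"
      then have ij: "i < d" "j < d" by auto
      have "?H 1 $$ (i,j) = 0" "?H \<i> $$ (i,j) = 0" unfolding h using ij by auto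
      then have "Y $$ (i,j) + cnj (Y $$ (j,i)) = 0" "\<i> * (Y $$ (i,j) - cnj (Y $$ (j,i))) = 0"
        using ij Y by (auto simp: herm_part_def algebra_simps)
      then show "Y $$ (i,j) = 0\<^sub>m d d $$ (i,j)" using ij by (auto simp: complex_eq_iff)
    qed (use Y in auto)
    with Y show False by simp
  qed
  ultimately show ?thesis using that by blast
qed

text \<open>The hermitian matrix made from \<open>Y\<close> is still traceless, so none of its
  multiples has trace one; this rules out the second alternative of
  \<open>fixed_hermitian_cases\<close>.\<close>

lemma fixed_trace_zero_imp_semipositive:
  assumes \<phi>: "ptp d \<phi>" and Y: "Y \<in> carrier_mat d d" "Y \<noteq> 0\<^sub>m d d" "\<phi> Y = Y" "mtrace Y = 0"
  shows "has_semipositive_fixed_point d \<phi>"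
proof -
  obtain c where H: "herm_part c Y \<noteq> 0\<^sub>m d d" (is "?H \<noteq> _")
    "mat_adjoint (herm_part c Y) = herm_part c Y"
    "\<phi> (herm_part c Y) = herm_part c Y"
    using fixed_hermitian_of_fixed[OF \<phi> Y(1,2,3)] by blast
  have Hc: "?H \<in> carrier_mat d d" using Y by (auto simp: herm_part_def)
  have "mtrace ?H = 0"
    unfolding herm_part_def using Y mtrace_adjoint[OF Y(1)] by (subst mtrace_add[of _ d]) (auto simp: mtrace_smult[of _ d])
  then have "mtrace (of_real a \<cdot>\<^sub>m ?H) \<noteq> 1" for a using mtrace_smult[OF Hc] by simp
  then show ?thesis using fixed_hermitian_cases[OF \<phi> Hc H(2,1,3)] by blast
qed

text \<open>The vectorised identity matrix. As a functional it is the trace, so trace preservation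
  makes it a left eigenvector of \<open>rep_mat\<close> for the eigenvalue one.\<close>

definition trace_vec :: "nat \<Rightarrow> complex vec" where
  "trace_vec d = vec (d*d) (\<lambda>p. if p div d = p mod d then 1 else 0)"

lemma trace_vec_carrier [simp]: "trace_vec d \<in> carrier_vec (d*d)"
  by (simp add: trace_vec_def)

lemma trace_vec_scalar_prod:
  assumes "X \<in> carrier_mat d d"
  shows "trace_vec d \<bullet> vec_of_mat d X = mtrace X"
proof -
  have "trace_vec d \<bullet> vec_of_mat d X = (\<Sum>q<d*d. if q div d = q mod d then X $$ (q div d, q mod d) else 0)"
    by (auto simp: scalar_prod_def lessThan_atLeast0 vec_of_mat_def trace_vec_def intro!: sum.cong)
  also have "\<dots> = (\<Sum>a<d. \<Sum>b<d. if a = b then X $$ (a,b) else 0)"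
    by (rule sum_div_mod)
  also have "\<dots> = mtrace X" using assms by (simp add: mtrace_def)
  finally show ?thesis .
qed

lemma trace_vec_left_fixed:
  assumes "linear_map_mat d \<phi>" "trace_preserving d \<phi>"
  shows "transpose_mat (rep_mat d \<phi>) *\<^sub>v trace_vec d = trace_vec d"
proof (rule eq_vecI)
  fix q assume "q < dim_vec (trace_vec d)"
  then have q: "q < d*d" by (simp add: trace_vec_def)
  let ?E = "mat_unit d (q div d) (q mod d)"
  have col: "col (rep_mat d \<phi>) q = vec_of_mat d (\<phi> ?E)"
    using q by (intro eq_vecI) (auto simp: rep_mat_def vec_of_mat_def)
  have "(transpose_mat (rep_mat d \<phi>) *\<^sub>v trace_vec d) $ q = col (rep_mat d \<phi>) q \<bullet> trace_vec d"
    using q by (simp add: rep_mat_def)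
  also have "\<dots> = mtrace (\<phi> ?E)"
    unfolding col trace_vec_scalar_prod[OF linear_map_matD(1)[OF assms(1) mat_unit_carrier], symmetric]
    by (rule comm_scalar_prod[of _ "d*d"]) auto
  also have "\<dots> = mtrace ?E" using assms(2) unfolding trace_preserving_def by auto
  also have "\<dots> = trace_vec d $ q"
    using q div_mod_lt[OF q] by (auto simp: mtrace_def trace_vec_def intro!: sum.neutral)
  finally show "(transpose_mat (rep_mat d \<phi>) *\<^sub>v trace_vec d) $ q = trace_vec d $ q" .
qed (auto simp: rep_mat_def trace_vec_def)

lemma one_root_char_poly:
  assumes "linear_map_mat d \<phi>" "trace_preserving d \<phi>" "0 < d"
  shows "poly (char_poly (rep_mat d \<phi>)) 1 = 0"
proof -
  have T: "transpose_mat (rep_mat d \<phi>) \<in> carrier_mat (d*d) (d*d)" by simp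
  have "trace_vec d $ 0 = 1" using assms(3) by (simp add: trace_vec_def)
  then have "trace_vec d \<noteq> 0\<^sub>v (d*d)" using assms(3) by (metis index_zero_vec(1) nat_0_less_mult_iff zero_neq_one)
  then have "eigenvalue (transpose_mat (rep_mat d \<phi>)) 1"
    unfolding eigenvalue_def eigenvector_def using trace_vec_left_fixed[OF assms(1,2)]
    by (intro exI[of _ "trace_vec d"]) (auto simp: rep_mat_def)
  then have "poly (char_poly (transpose_mat (rep_mat d \<phi>))) 1 = 0"
    using eigenvalue_root_char_poly[OF T] by blast
  then show ?thesis by (simp add: char_poly_transpose_mat[of _ "d*d"])
qed

text \<open>Trace preservation provides the eigenvalue one, hence a nonzero hermitian fixed point,
  to which \<open>fixed_hermitian_cases\<close> applies.\<close>

lemma semipositive_or_faithful_fixed_state: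
  assumes \<phi>: "ptp d \<phi>" and d: "0 < d" and no: "\<not> has_semipositive_fixed_point d \<phi>"
  obtains \<rho> where "psd d \<rho>" "det \<rho> \<noteq> 0" "\<phi> \<rho> = \<rho>" "mtrace \<rho> = 1"
proof -
  have l: "linear_map_mat d \<phi>" and t: "trace_preserving d \<phi>" using \<phi> unfolding ptp_def by auto
  obtain Y where Y: "Y \<in> carrier_mat d d" "Y \<noteq> 0\<^sub>m d d" "\<phi> Y = 1 \<cdot>\<^sub>m Y"
    using rep_mat_eigenmatrix[OF l one_root_char_poly[OF l t d]] by blast
  have "1 \<cdot>\<^sub>m Y = Y" by (rule eq_matI) auto
  with Y have Y1: "\<phi> Y = Y" by simp
  obtain c where H: "herm_part c Y \<noteq> 0\<^sub>m d d" (is "?H \<noteq> _")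
    "mat_adjoint (herm_part c Y) = herm_part c Y"
    "\<phi> (herm_part c Y) = herm_part c Y"
    using fixed_hermitian_of_fixed[OF \<phi> Y(1,2) Y1] by blast
  have Hc: "?H \<in> carrier_mat d d" using Y by (auto simp: herm_part_def)
  obtain a where "psd d (of_real a \<cdot>\<^sub>m ?H)" "det (of_real a \<cdot>\<^sub>m ?H) \<noteq> 0" "mtrace (of_real a \<cdot>\<^sub>m ?H) = 1"
    using fixed_hermitian_cases[OF \<phi> Hc H(2,1,3)] no by blast
  moreover have "\<phi> (of_real a \<cdot>\<^sub>m ?H) = of_real a \<cdot>\<^sub>m ?H"
    using linear_map_matD(3)[OF l Hc] H(3) by simp
  ultimately show ?thesis using that by blast
qed

subsection \<open>Peripheral eigenvalues of a channel with a faithful fixed state\<close>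

lemma mat_adjoint_minus:
  assumes "A \<in> carrier_mat n m" "B \<in> carrier_mat n m"
  shows "mat_adjoint (A - B) = mat_adjoint A - mat_adjoint (B :: complex mat)"
  using assms by (intro eq_matI) auto

lemma sandwich_diag_entry:
  assumes "Z \<in> carrier_mat d d" "\<rho> \<in> carrier_mat d d" "i < d"
  shows "sandwich Z \<rho> $$ (i,i) = qform d \<rho> (\<lambda>k. cnj (Z $$ (i,k)))"
  unfolding sandwich_def sandwich_index[OF assms(1,2,3,3)] qform_def
  by (intro sum.cong) (auto simp: mult_ac)

text \<open>The trace is the sum of the forms of \<open>\<rho>\<close> at the conjugated rows of
  \<open>Z\<close>: a squared norm of \<open>Z\<close> weighted by \<open>\<rho>\<close>, definite
  because \<open>\<rho>\<close> is coercive.\<close>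

lemma mtrace_sandwich_faithful:
  assumes \<rho>: "psd d \<rho>" "det \<rho> \<noteq> 0" and Z: "Z \<in> carrier_mat d d"
  shows "Im (mtrace (sandwich Z \<rho>)) = 0" "0 \<le> Re (mtrace (sandwich Z \<rho>))"
    "Z \<noteq> 0\<^sub>m d d \<Longrightarrow> 0 < Re (mtrace (sandwich Z \<rho>))"
proof -
  note r = psdD[OF \<rho>(1)]
  have t: "mtrace (sandwich Z \<rho>) = (\<Sum>i<d. qform d \<rho> (\<lambda>k. cnj (Z $$ (i,k))))"
    using sandwich_diag_entry[OF Z r(1)] Z by (auto simp: mtrace_def sandwich_def)
  show "Im (mtrace (sandwich Z \<rho>)) = 0" "0 \<le> Re (mtrace (sandwich Z \<rho>))"
    unfolding t using r by (auto intro!: sum_nonneg)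
  assume "Z \<noteq> 0\<^sub>m d d"
  then obtain i k where ik: "i < d" "k < d" "Z $$ (i,k) \<noteq> 0" using Z by (metis carrier_matD eq_matI index_zero_mat)
  obtain c where c: "c > 0" "\<And>x. c * (\<Sum>i<d. (cmod (x i))\<^sup>2) \<le> Re (qform d \<rho> x)"
    using posdef_coercive[OF \<rho>] by blast
  have "0 < c * (\<Sum>l<d. (cmod (cnj (Z $$ (i,l))))\<^sup>2)"
    using c(1) ik by (intro mult_pos_pos sum_pos2[of _ k]) auto
  also have "\<dots> \<le> Re (qform d \<rho> (\<lambda>k. cnj (Z $$ (i,k))))" by (rule c(2))
  also have "\<dots> \<le> (\<Sum>i<d. Re (qform d \<rho> (\<lambda>k. cnj (Z $$ (i,k)))))"
    using ik r(3) by (intro member_le_sum) auto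
  finally show "0 < Re (mtrace (sandwich Z \<rho>))" unfolding t by simp
qed

text \<open>The expansion of the weighted squared norm of P - z Q. It is used with P = u K and Q = K
  u, where its vanishing is the intertwining relation.\<close>

lemma mtrace_sandwich_diff:
  assumes c: "P \<in> carrier_mat d d" "Q \<in> carrier_mat d d" "\<rho> \<in> carrier_mat d d"
  shows "mtrace (sandwich (P - z \<cdot>\<^sub>m Q) \<rho>) = mtrace (P * \<rho> * mat_adjoint P) - cnj z * mtrace (P * \<rho> * mat_adjoint Q)
    - z * mtrace (Q * \<rho> * mat_adjoint P) + z * cnj z * mtrace (Q * \<rho> * mat_adjoint Q)"
proof -
  have a: "mat_adjoint P \<in> carrier_mat d d" "mat_adjoint Q \<in> carrier_mat d d" using c by auto
  have 1: "(P - z \<cdot>\<^sub>m Q) * \<rho> = P * \<rho> - z \<cdot>\<^sub>m (Q * \<rho>)"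
    using c by (subst minus_mult_distrib_mat[of _ d d]) auto
  have 2: "mat_adjoint (P - z \<cdot>\<^sub>m Q) = mat_adjoint P - cnj z \<cdot>\<^sub>m mat_adjoint Q"
    using c by (subst mat_adjoint_minus[of _ d d]) (auto simp: mat_adjoint_smult)
  have 3: "sandwich (P - z \<cdot>\<^sub>m Q) \<rho> = (P * \<rho> - z \<cdot>\<^sub>m (Q * \<rho>)) * mat_adjoint P
     - cnj z \<cdot>\<^sub>m ((P * \<rho> - z \<cdot>\<^sub>m (Q * \<rho>)) * mat_adjoint Q)"
    unfolding sandwich_def 1 2 using c a by (subst mult_minus_distrib_mat[of _ d d]) auto
  have 4: "mtrace ((P * \<rho> - z \<cdot>\<^sub>m (Q * \<rho>)) * B) = mtrace (P * \<rho> * B) - z * mtrace (Q * \<rho> * B)"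
    if B: "B \<in> carrier_mat d d" for B
  proof -
    have "(P * \<rho> - z \<cdot>\<^sub>m (Q * \<rho>)) * B = P * \<rho> * B - z \<cdot>\<^sub>m (Q * \<rho> * B)"
      using c B by (subst minus_mult_distrib_mat[of _ d d]) (auto simp: mult_smult_assoc_mat[of _ d d])
    then show ?thesis using c B by (simp add: mtrace_minus[of _ d] mtrace_smult[of _ d])
  qed
  have 5: "mtrace (cnj z \<cdot>\<^sub>m ((P * \<rho> - z \<cdot>\<^sub>m (Q * \<rho>)) * mat_adjoint Q))
    = cnj z * mtrace ((P * \<rho> - z \<cdot>\<^sub>m (Q * \<rho>)) * mat_adjoint Q)"
    by (rule mtrace_smult[of _ d]) (use c a in auto)
  have "mtrace (sandwich (P - z \<cdot>\<^sub>m Q) \<rho>) = mtrace ((P * \<rho> - z \<cdot>\<^sub>m (Q * \<rho>)) * mat_adjoint P)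
     - mtrace (cnj z \<cdot>\<^sub>m ((P * \<rho> - z \<cdot>\<^sub>m (Q * \<rho>)) * mat_adjoint Q))"
    unfolding 3 by (rule mtrace_minus[of _ d]) (use c a in auto)
  then show ?thesis unfolding 5 4[OF a(1)] 4[OF a(2)] by (simp add: algebra_simps)
qed

text \<open>With \<open>Z\<^sub>m = u K\<^sub>m - z K\<^sub>m u\<close> one has \<open>\<Sum>\<^sub>m tr (Z\<^sub>m \<rho> Z\<^sub>m\<^sup>*) = (1 - |z|\<^sup>2) tr (u \<rho> u\<^sup>*)\<close>.
  All terms on the left are nonnegative, and they vanish only if \<open>Z\<^sub>m = 0\<close>.\<close>
lemma left_eigenmatrix_intertwines:
  assumes \<phi>: "ptp d \<phi>"
    and KF: "kraus_family d \<phi> N K"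
    and \<rho>: "psd d \<rho>" "det \<rho> \<noteq> 0" "\<phi> \<rho> = \<rho>"
    and u: "u \<in> carrier_mat d d" "u \<noteq> 0\<^sub>m d d"
    and eig: "\<And>X. X \<in> carrier_mat d d \<Longrightarrow> mtrace (u * \<phi> X) = z * mtrace (u * X)"
  shows "cmod z \<le> 1" "cmod z = 1 \<Longrightarrow> m < N \<Longrightarrow> u * K m = z \<cdot>\<^sub>m (K m * u)"
proof -
  note K = kraus_familyD(1)[OF KF] and kraus = kraus_familyD(2)[OF KF]
  note r = psdD(1,2)[OF \<rho>(1)]
  define t where "t = Re (mtrace (sandwich u \<rho>))"
  have t0: "t > 0" and tt: "mtrace (sandwich u \<rho>) = of_real t"
    using mtrace_sandwich_faithful[OF \<rho>(1,2) u(1)] u(2) by (auto simp: t_def complex_eq_iff)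
  define Z where "Z m = u * K m - z \<cdot>\<^sub>m (K m * u)" for m
  have Z: "Z m \<in> carrier_mat d d" for m using u K[of m] by (auto simp: Z_def)
  let ?u' = "mat_adjoint u"
  have u': "?u' \<in> carrier_mat d d" using u by auto
  \<comment> \<open>Cyclicity of the trace brings each of the four terms into the form tr (B K X K')
    with K' the adjoint of K, so that summation over \<open>m\<close> turns it into tr (B
    \<phi>(X)).\<close>
  have eq: "mtrace (sandwich (Z m) \<rho>) = mtrace (?u' * u * (K m * \<rho> * mat_adjoint (K m)))
      - cnj z * mtrace (u * (K m * (\<rho> * ?u') * mat_adjoint (K m)))
      - z * mtrace (?u' * (K m * (u * \<rho>) * mat_adjoint (K m)))
      + z * cnj z * mtrace (1\<^sub>m d * (K m * sandwich u \<rho> * mat_adjoint (K m)))" for m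
  proof -
    let ?K = "K m" and ?K' = "mat_adjoint (K m)"
    have k: "?K \<in> carrier_mat d d" "?K' \<in> carrier_mat d d" using K by auto
    note as = assoc_mult_mat[of _ d d _ d _ d]
    have m1: "mtrace (u * ?K * \<rho> * mat_adjoint (u * ?K)) = mtrace (?u' * u * (?K * \<rho> * ?K'))"
    proof -
      have "u * ?K * \<rho> * mat_adjoint (u * ?K) = (u * (?K * \<rho> * ?K')) * ?u'"
        unfolding mat_adjoint_mult[OF u(1) k(1)] using u(1) u' k r(1) by (simp add: as del: mat_adjoint_carrier)
      also have "mtrace \<dots> = mtrace (?u' * (u * (?K * \<rho> * ?K')))"
        by (rule mtrace_comm[of _ d d]) (use u(1) u' k r(1) in auto)
      also have "?u' * (u * (?K * \<rho> * ?K')) = ?u' * u * (?K * \<rho> * ?K')"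
        using u(1) u' k r(1) by (simp add: as del: mat_adjoint_carrier)
      finally show ?thesis .
    qed
    have m2: "mtrace (u * ?K * \<rho> * mat_adjoint (?K * u)) = mtrace (u * (?K * (\<rho> * ?u') * ?K'))"
      unfolding mat_adjoint_mult[OF k(1) u(1)] using u(1) u' k r(1) by (simp add: as del: mat_adjoint_carrier)
    have m3: "mtrace (?K * u * \<rho> * mat_adjoint (u * ?K)) = mtrace (?u' * (?K * (u * \<rho>) * ?K'))"
    proof -
      have "?K * u * \<rho> * mat_adjoint (u * ?K) = (?K * (u * \<rho>) * ?K') * ?u'"
        unfolding mat_adjoint_mult[OF u(1) k(1)] using u(1) u' k r(1) by (simp add: as del: mat_adjoint_carrier)
      also have "mtrace \<dots> = mtrace (?u' * (?K * (u * \<rho>) * ?K'))"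
        by (rule mtrace_comm[of _ d d]) (use u(1) u' k r(1) in auto)
      finally show ?thesis .
    qed
    have m4: "mtrace (?K * u * \<rho> * mat_adjoint (?K * u)) = mtrace (1\<^sub>m d * (?K * sandwich u \<rho> * ?K'))"
    proof -
      have "?K * u * \<rho> * mat_adjoint (?K * u) = ?K * sandwich u \<rho> * ?K'"
        unfolding mat_adjoint_mult[OF k(1) u(1)] sandwich_def using u(1) u' k r(1) by (simp add: as del: mat_adjoint_carrier)
      moreover have "?K * sandwich u \<rho> * ?K' \<in> carrier_mat d d"
        using k u(1) r(1) by (meson mult_carrier_mat sandwich_carrier)
      ultimately show ?thesis by (metis left_mult_one_mat)
    qed
    show ?thesis
      unfolding Z_def mtrace_sandwich_diff[OF mult_carrier_mat[OF u(1) k(1)] mult_carrier_mat[OF k(1) u(1)] r(1)]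
        m1 m2 m3 m4 ..
  qed
  have c: "?u' * u \<in> carrier_mat d d" "\<rho> * ?u' \<in> carrier_mat d d" "u * \<rho> \<in> carrier_mat d d"
    "sandwich u \<rho> \<in> carrier_mat d d" "1\<^sub>m d \<in> carrier_mat d d"
    using u(1) u' r(1) by auto
  \<comment> \<open>The four traces are t, z t, cnj z t and t: the first because
    \<open>\<rho>\<close> is fixed, the second by the eigenvalue equation, the third by taking
    adjoints in the second, the last by trace preservation.\<close>
  have "(\<Sum>m<N. mtrace (sandwich (Z m) \<rho>)) = mtrace (?u' * u * \<phi> \<rho>) - cnj z * mtrace (u * \<phi> (\<rho> * ?u'))
      - z * mtrace (?u' * \<phi> (u * \<rho>)) + z * cnj z * mtrace (1\<^sub>m d * \<phi> (sandwich u \<rho>))"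
    unfolding eq kraus[OF c(1) r(1)] kraus[OF u(1) c(2)] kraus[OF u' c(3)] kraus[OF c(5,4)]
    by (simp add: sum.distrib sum_subtractf sum_distrib_left)
  also have "mtrace (?u' * u * \<phi> \<rho>) = of_real t"
  proof -
    have "?u' * u * \<rho> = ?u' * (u * \<rho>)" using u(1) u' r(1) assoc_mult_mat by blast
    then show ?thesis unfolding \<rho>(3) tt[symmetric] sandwich_def using mtrace_comm[OF u' c(3)] by simp
  qed
  also have e1: "mtrace (u * \<phi> (\<rho> * ?u')) = z * of_real t"
  proof -
    have "u * (\<rho> * ?u') = sandwich u \<rho>" unfolding sandwich_def using u(1) u' r(1) assoc_mult_mat by metis
    then show ?thesis using eig[OF c(2)] tt by simp
  qed
  also have "mtrace (?u' * \<phi> (u * \<rho>)) = cnj z * of_real t"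
  proof -
    have a: "mat_adjoint (\<rho> * ?u') = u * \<rho>" using mat_adjoint_mult[OF r(1) u'] r(2) by simp
    have p: "\<phi> (\<rho> * ?u') \<in> carrier_mat d d" by (rule ptpD(5)[OF \<phi> c(2)])
    have "mtrace (?u' * \<phi> (u * \<rho>)) = mtrace (\<phi> (u * \<rho>) * ?u')"
      by (rule mtrace_comm[OF u' ptpD(5)[OF \<phi> c(3)]])
    also have "\<phi> (u * \<rho>) * ?u' = mat_adjoint (u * \<phi> (\<rho> * ?u'))"
      using ptpD(4)[OF \<phi> c(2)] unfolding a by (simp only: mat_adjoint_mult[OF u(1) p])
    also have "mtrace (mat_adjoint (u * \<phi> (\<rho> * ?u'))) = cnj (mtrace (u * \<phi> (\<rho> * ?u')))"
      by (rule mtrace_adjoint[of _ d]) (use u(1) p in auto)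
    finally show ?thesis unfolding e1 by simp
  qed
  also have "mtrace (1\<^sub>m d * \<phi> (sandwich u \<rho>)) = of_real t"
    using ptpD(2,5)[OF \<phi> c(4)] tt by simp
  also have "of_real t - cnj z * (z * of_real t) - z * (cnj z * of_real t) + z * cnj z * of_real t
     = of_real (1 - (cmod z)\<^sup>2) * complex_of_real t"
    using complex_norm_square[of z] by (simp add: algebra_simps)
  finally have "(\<Sum>m<N. mtrace (sandwich (Z m) \<rho>)) = of_real ((1 - (cmod z)\<^sup>2) * t)" by simp
  then have s: "(\<Sum>m<N. Re (mtrace (sandwich (Z m) \<rho>))) = (1 - (cmod z)\<^sup>2) * t"
    by (metis Re_complex_of_real Re_sum)
  have "0 \<le> (1 - (cmod z)\<^sup>2) * t"
    unfolding s[symmetric] using mtrace_sandwich_faithful(2)[OF \<rho>(1,2) Z] by (intro sum_nonneg) auto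
  then have "(cmod z)\<^sup>2 \<le> 1" using t0 by (simp add: zero_le_mult_iff)
  then show "cmod z \<le> 1" by (simp add: power2_le_iff_abs_le abs_square_le_1)
  assume "cmod z = 1" "m < N"
  then have "(\<Sum>m<N. Re (mtrace (sandwich (Z m) \<rho>))) = 0" using s by simp
  then have "Re (mtrace (sandwich (Z m) \<rho>)) = 0"
    using mtrace_sandwich_faithful(2)[OF \<rho>(1,2) Z] \<open>m < N\<close> by (subst (asm) sum_nonneg_eq_0_iff) auto
  then have "Z m = 0\<^sub>m d d" using mtrace_sandwich_faithful(3)[OF \<rho>(1,2) Z[of m]] by force
  then have *: "Z m $$ (i,j) = 0" if "i < d" "j < d" for i j using that by simp
  show "u * K m = z \<cdot>\<^sub>m (K m * u)"
  proof (rule eq_matI)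
    have k: "u * K m \<in> carrier_mat d d" "K m * u \<in> carrier_mat d d" using u(1) K[of m] by auto
    show "dim_row (u * K m) = dim_row (z \<cdot>\<^sub>m (K m * u))" "dim_col (u * K m) = dim_col (z \<cdot>\<^sub>m (K m * u))"
      using k u(1) K[of m] by auto
    fix i j assume "i < dim_row (z \<cdot>\<^sub>m (K m * u))" "j < dim_col (z \<cdot>\<^sub>m (K m * u))"
    then have ij: "i < d" "j < d" using k K[of m] u(1) by auto
    have "Z m $$ (i,j) = (u * K m) $$ (i,j) - (z \<cdot>\<^sub>m (K m * u)) $$ (i,j)"
      unfolding Z_def by (rule index_minus_mat(1)) (use ij k K[of m] u(1) in auto)
    then show "(u * K m) $$ (i,j) = (z \<cdot>\<^sub>m (K m * u)) $$ (i,j)" using *[OF ij] by simp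
  qed
qed

lemma smult_mult_mat_vec:
  assumes "A \<in> carrier_mat n m" "v \<in> carrier_vec m"
  shows "(c \<cdot>\<^sub>m A) *\<^sub>v v = c \<cdot>\<^sub>v (A *\<^sub>v (v :: complex vec))"
  using assms by (intro eq_vecI) auto

text \<open>If \<open>u K\<^sub>m = z K\<^sub>m u\<close> for all \<open>m\<close>, every \<open>K\<^sub>m\<close> maps the \<open>x\<close>-eigenspace of \<open>u\<close> into the \<open>z x\<close>-eigenspace;
  as \<open>\<phi>\<close> preserves traces, some \<open>K\<^sub>m\<close> does not annihilate a given eigenvector.\<close>
lemma intertwiner_spectrum:
  assumes \<phi>: "ptp d \<phi>" and KF: "kraus_family d \<phi> N K"
    and u: "u \<in> carrier_mat d d"
    and comm: "\<And>m. m < N \<Longrightarrow> u * K m = z \<cdot>\<^sub>m (K m * u)"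
    and x: "x \<in> spectrum u"
  shows "z * x \<in> spectrum u"
proof -
  note K = kraus_familyD(1)[OF KF] and kraus = kraus_familyD(2)[OF KF]
  obtain v where v: "v \<in> carrier_vec d" "v \<noteq> 0\<^sub>v d" "u *\<^sub>v v = x \<cdot>\<^sub>v v"
    using x u unfolding spectrum_def eigenvalue_def eigenvector_def by auto
  have "\<exists>m<N. K m *\<^sub>v v \<noteq> 0\<^sub>v d"
  proof (rule ccontr)
    assume "\<not> ?thesis"
    then have Kv: "K m *\<^sub>v v = 0\<^sub>v d" if "m < N" for m using that by auto
    \<comment> \<open>X = v v^* has the squared norm of v as its trace, while all its Kraus terms
      would vanish.\<close>
    define X where "X = mat d d (\<lambda>(i,j). v $ i * cnj (v $ j))"
    have X: "X \<in> carrier_mat d d" by (simp add: X_def)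
    have z0: "K m * X * mat_adjoint (K m) = 0\<^sub>m d d" if m: "m < N" for m
    proof (rule eq_matI)
      fix i j assume "i < dim_row (0\<^sub>m d d)" "j < dim_col (0\<^sub>m d d)"
      then have ij: "i < d" "j < d" by auto
      have "(\<Sum>a<d. K m $$ (i,a) * v $ a) = (K m *\<^sub>v v) $ i"
        using K[of m] v ij by (auto simp: scalar_prod_def lessThan_atLeast0 intro!: sum.cong)
      then have s: "(\<Sum>a<d. K m $$ (i,a) * v $ a) = 0" using Kv[OF m] ij by simp
      have "(K m * X * mat_adjoint (K m)) $$ (i,j)
        = (\<Sum>a<d. \<Sum>b<d. (K m $$ (i,a) * v $ a) * (cnj (v $ b) * cnj (K m $$ (j,b))))"
        unfolding sandwich_index[OF K X ij] by (intro sum.cong) (auto simp: X_def mult_ac)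
      also have "\<dots> = 0" unfolding sum_product[symmetric] s by simp
      finally show "(K m * X * mat_adjoint (K m)) $$ (i,j) = 0\<^sub>m d d $$ (i,j)" using ij by simp
    qed (use K[of m] in auto)
    have "mtrace X = mtrace (1\<^sub>m d * \<phi> X)" using ptpD(2,5)[OF \<phi> X] by simp
    also have "\<dots> = (\<Sum>m<N. mtrace (1\<^sub>m d * (K m * X * mat_adjoint (K m))))" by (rule kraus[OF _ X]) simp
    also have "\<dots> = 0" using z0 by (intro sum.neutral) (auto simp: mtrace_def)
    finally have "(\<Sum>i<d. v $ i * cnj (v $ i)) = 0" by (simp add: mtrace_def X_def)
    then have "complex_of_real (\<Sum>i<d. (cmod (v $ i))\<^sup>2) = 0"
      unfolding of_real_sum complex_norm_square .
    then have "(\<Sum>i<d. (cmod (v $ i))\<^sup>2) = 0" using of_real_eq_0_iff by blast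
    then have "v $ i = 0" if "i < d" for i using that by (subst (asm) sum_nonneg_eq_0_iff) auto
    then have "v = 0\<^sub>v d" using v(1) by (intro eq_vecI) auto
    with v show False by simp
  qed
  then obtain m where m: "m < N" "K m *\<^sub>v v \<noteq> 0\<^sub>v d" by auto
  have Kv: "K m *\<^sub>v v \<in> carrier_vec d" using K[of m] v by auto
  have "u *\<^sub>v (K m *\<^sub>v v) = (u * K m) *\<^sub>v v" using assoc_mult_mat_vec[OF u K v(1)] by simp
  also have "\<dots> = z \<cdot>\<^sub>v ((K m * u) *\<^sub>v v)"
    unfolding comm[OF m(1)] by (rule smult_mult_mat_vec[of _ d d]) (use K[of m] u v in auto)
  also have "(K m * u) *\<^sub>v v = K m *\<^sub>v (x \<cdot>\<^sub>v v)" using assoc_mult_mat_vec[OF K u v(1)] v(3) by simp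
  also have "\<dots> = x \<cdot>\<^sub>v (K m *\<^sub>v v)" using mult_mat_vec[OF K v(1)] by simp
  finally have "u *\<^sub>v (K m *\<^sub>v v) = (z * x) \<cdot>\<^sub>v (K m *\<^sub>v v)" by (simp add: smult_smult_assoc)
  then show ?thesis
    unfolding spectrum_def eigenvalue_def eigenvector_def using Kv m u by auto
qed

lemma peripheral_imp_semipositive_power:
  assumes ch: "quantum_channel d \<phi>" and d: "0 < d"
    and root: "poly (char_poly (rep_mat d \<phi>)) z = 0" and z: "cmod z = 1" "z \<noteq> 1"
  shows "\<exists>n. 1 \<le> n \<and> n \<le> d \<and> has_semipositive_fixed_point d (\<phi> ^^ n)"
proof (cases "has_semipositive_fixed_point d \<phi>")
  case True
  then show ?thesis using d by (intro exI[of _ 1]) auto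
next
  case False
  have \<phi>: "ptp d \<phi>" by (rule channel_ptp[OF ch d])
  note l = ptpD(1)[OF \<phi>]
  obtain \<rho> where \<rho>: "psd d \<rho>" "det \<rho> \<noteq> 0" "\<phi> \<rho> = \<rho>"
    using semipositive_or_faithful_fixed_state[OF \<phi> d False] by blast
  note r = psdD(1,2)[OF \<rho>(1)]
  obtain K where KF: "kraus_family d \<phi> (d*d) K" using channel_kraus[OF ch d] by blast
  note K = kraus_familyD(1)[OF KF] and kraus = kraus_familyD(2)[OF KF]
  obtain u where u: "u \<in> carrier_mat d d" "u \<noteq> 0\<^sub>m d d"
    and eig: "\<And>X. X \<in> carrier_mat d d \<Longrightarrow> mtrace (u * \<phi> X) = z * mtrace (u * X)"
    using rep_mat_left_eigenmatrix[OF l root] by blast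
  have comm: "u * K m = z \<cdot>\<^sub>m (K m * u)" if "m < d*d" for m
    using left_eigenmatrix_intertwines(2)[OF \<phi> KF \<rho> u eig z(1) that] .
  have zz: "cnj z * z = 1" using complex_norm_square[of z] z(1) by (simp add: mult.commute)
  let ?u' = "mat_adjoint u"
  have u': "?u' \<in> carrier_mat d d" using u by auto
  note as = assoc_mult_mat[of _ d d _ d _ d]
  have Ku: "K m * u = cnj z \<cdot>\<^sub>m (u * K m)" if "m < d*d" for m
    unfolding comm[OF that] by (rule eq_matI) (use zz in \<open>auto simp: mult.assoc[symmetric]\<close>)
  \<comment> \<open>Each Kraus term lets \<open>u\<close> pass to the left at the cost of a factor
    cnj z, the inverse of z. Taking the fixed state for \<open>X\<close> makes
    \<open>u * \<rho>\<close> an eigenmatrix for cnj z.\<close>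
  have \<phi>u: "\<phi> (u * X) = cnj z \<cdot>\<^sub>m (u * \<phi> X)" if X: "X \<in> carrier_mat d d" for X
  proof (rule mat_eq_of_mtrace)
    have uX: "u * X \<in> carrier_mat d d" and pX: "\<phi> X \<in> carrier_mat d d" using u X ptpD(5)[OF \<phi>] by auto
    show "\<phi> (u * X) \<in> carrier_mat d d" "cnj z \<cdot>\<^sub>m (u * \<phi> X) \<in> carrier_mat d d"
      using ptpD(5)[OF \<phi> uX] pX u by auto
    fix B :: "complex mat" assume B: "B \<in> carrier_mat d d"
    have Bu: "B * u \<in> carrier_mat d d" using B u by auto
    have "mtrace (B * \<phi> (u * X)) = (\<Sum>m<d*d. mtrace (B * (K m * (u * X) * mat_adjoint (K m))))"
      by (rule kraus[OF B uX])
    also have "\<dots> = (\<Sum>m<d*d. cnj z * mtrace (B * u * (K m * X * mat_adjoint (K m))))"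
    proof (intro sum.cong refl)
      fix m assume "m \<in> {..<d*d}"
      then have m: "m < d*d" by simp
      have K': "mat_adjoint (K m) \<in> carrier_mat d d" using K by auto
      have "B * (K m * (u * X) * mat_adjoint (K m)) = B * (K m * u) * (X * mat_adjoint (K m))"
        using B u X K[of m] K' by (simp add: as del: mat_adjoint_carrier)
      also have "\<dots> = cnj z \<cdot>\<^sub>m (B * (u * K m)) * (X * mat_adjoint (K m))"
        unfolding Ku[OF m] using mult_smult_distrib[of B d d "u * K m" d "cnj z"] B u K[of m] by simp
      also have "\<dots> = cnj z \<cdot>\<^sub>m (B * (u * K m) * (X * mat_adjoint (K m)))"
        using B u X K[of m] K' by (intro mult_smult_assoc_mat[of _ d d _ d]) auto
      also have "B * (u * K m) * (X * mat_adjoint (K m)) = B * u * (K m * X * mat_adjoint (K m))"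
        using B u X K[of m] K' by (simp add: as del: mat_adjoint_carrier)
      also have "mtrace (cnj z \<cdot>\<^sub>m (B * u * (K m * X * mat_adjoint (K m)))) = cnj z * mtrace (B * u * (K m * X * mat_adjoint (K m)))"
        by (rule mtrace_smult[of _ d]) (use B u X K[of m] K' in auto)
      finally show "mtrace (B * (K m * (u * X) * mat_adjoint (K m))) = cnj z * mtrace (B * u * (K m * X * mat_adjoint (K m)))" .
    qed
    also have "\<dots> = cnj z * mtrace (B * u * \<phi> X)"
      unfolding kraus[OF Bu X] sum_distrib_left ..
    also have "\<dots> = mtrace (B * (cnj z \<cdot>\<^sub>m (u * \<phi> X)))"
      using B u pX mult_smult_distrib[of B d d "u * \<phi> X" d "cnj z"] by (simp add: mtrace_smult[of _ d] as)
    finally show "mtrace (B * \<phi> (u * X)) = mtrace (B * (cnj z \<cdot>\<^sub>m (u * \<phi> X)))" .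
  qed
  have Y: "u * \<rho> \<in> carrier_mat d d" "\<rho> * ?u' \<in> carrier_mat d d" using u u' r by auto
  have \<phi>Y: "\<phi> (u * \<rho>) = cnj z \<cdot>\<^sub>m (u * \<rho>)" using \<phi>u[OF r(1)] \<rho>(3) by simp
  have sand: "u * (\<rho> * ?u') = sandwich u \<rho>" unfolding sandwich_def using u(1) u' r(1) by (simp add: as)
  have tpos: "0 < Re (mtrace (sandwich u \<rho>))" by (rule mtrace_sandwich_faithful(3)[OF \<rho>(1,2) u])
  \<comment> \<open>The factors cnj z and z cancel in u \<rho> u^* , which is therefore a fixed
    point; it is nonzero, and singular if \<open>u\<close> is.\<close>
  have "det u \<noteq> 0"
  proof
    assume du: "det u = 0"
    have "\<phi> (\<rho> * ?u') = mat_adjoint (\<phi> (u * \<rho>))"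
      using ptpD(4)[OF \<phi> Y(1)] mat_adjoint_mult[OF u(1) r(1)] r(2) by simp
    also have "\<dots> = z \<cdot>\<^sub>m (\<rho> * ?u')"
      unfolding \<phi>Y mat_adjoint_smult using mat_adjoint_mult[OF u(1) r(1)] r(2) by simp
    finally have 1: "\<phi> (\<rho> * ?u') = z \<cdot>\<^sub>m (\<rho> * ?u')" .
    have "\<phi> (sandwich u \<rho>) = cnj z \<cdot>\<^sub>m (u * (z \<cdot>\<^sub>m (\<rho> * ?u')))"
      using \<phi>u[OF Y(2)] unfolding sand 1 .
    also have "u * (z \<cdot>\<^sub>m (\<rho> * ?u')) = z \<cdot>\<^sub>m sandwich u \<rho>"
      using mult_smult_distrib[OF u(1) Y(2)] sand by simp
    also have "cnj z \<cdot>\<^sub>m (z \<cdot>\<^sub>m sandwich u \<rho>) = sandwich u \<rho>"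
      by (rule eq_matI) (use zz in \<open>auto simp: mult.assoc[symmetric]\<close>)
    finally have "\<phi> (sandwich u \<rho>) = sandwich u \<rho>" .
    moreover have "psd d (sandwich u \<rho>)" unfolding sandwich_def by (rule psd_conj[OF \<rho>(1) u(1)])
    moreover have "det (sandwich u \<rho>) = 0"
      unfolding sand[symmetric] using det_mult[OF u(1) Y(2)] du by simp
    moreover have "sandwich u \<rho> \<noteq> 0\<^sub>m d d"
      using tpos by (auto simp: mtrace_def)
    ultimately show False using False
      unfolding has_semipositive_fixed_point_def semipositive_fixed_point_def by blast
  qed
  have nz: "x \<noteq> 0" if x: "x \<in> spectrum u" for x
  proof
    assume "x = 0"
    then obtain v where v: "v \<in> carrier_vec d" "v \<noteq> 0\<^sub>v d" "u *\<^sub>v v = 0 \<cdot>\<^sub>v v"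
      using x u(1) unfolding spectrum_def eigenvalue_def eigenvector_def by auto
    have "0 \<cdot>\<^sub>v v = 0\<^sub>v d" using v(1) by (intro eq_vecI) auto
    then show False using v det_0_iff_vec_prod_zero[OF u(1)] \<open>det u \<noteq> 0\<close> by auto
  qed
  obtain x where x: "x \<in> spectrum u" using spectrum_non_empty[OF u(1) d] by auto
  have pw: "z ^ k * x \<in> spectrum u" for k
  proof (induction k)
    case (Suc k)
    then show ?case using intertwiner_spectrum[OF \<phi> KF u(1) comm, of "z ^ k * x"] by (simp add: mult.assoc)
  qed (use x in simp)
  \<comment> \<open>There are \<open>d + 1\<close> exponents in \<open>{..d}\<close> but at most
    \<open>d\<close> points in the spectrum. The difference of two colliding exponents is the
    \<open>n\<close> sought, which is why it does not exceed \<open>d\<close>.\<close>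
  have "\<not> inj_on (\<lambda>k. z ^ k * x) {..d}"
  proof
    assume "inj_on (\<lambda>k. z ^ k * x) {..d}"
    then have "card ((\<lambda>k. z ^ k * x) ` {..d}) = Suc d" by (simp add: card_image)
    moreover have "card ((\<lambda>k. z ^ k * x) ` {..d}) \<le> card (spectrum u)"
      using pw card_finite_spectrum(1)[OF u(1)] by (intro card_mono) auto
    ultimately show False using card_finite_spectrum(2)[OF u(1)] by simp
  qed
  then obtain i j where ij: "i \<le> d" "j \<le> d" "i \<noteq> j" "z ^ i * x = z ^ j * x" unfolding inj_on_def by auto
  obtain i j where ij: "i < j" "j \<le> d" "z ^ i = z ^ j"
    using ij nz[OF x] by (cases "i < j") (auto, metis linorder_neqE_nat)
  define n where "n = j - i"
  have n: "1 \<le> n" "n \<le> d" using ij by (auto simp: n_def)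
  have "z ^ i * z ^ n = z ^ (i + n)" by (simp add: power_add)
  also have "i + n = j" using ij by (simp add: n_def)
  finally have "z ^ i * z ^ n = z ^ i * 1" using ij by simp
  then have zn: "z ^ n = 1" using z by auto
  have "(\<phi> ^^ k) (u * \<rho>) = (cnj z ^ k) \<cdot>\<^sub>m (u * \<rho>)" for k
  proof (induction k)
    case (Suc k)
    have "(\<phi> ^^ Suc k) (u * \<rho>) = cnj z ^ k \<cdot>\<^sub>m (cnj z \<cdot>\<^sub>m (u * \<rho>))"
      using Suc linear_map_matD(3)[OF l Y(1)] \<phi>Y by simp
    also have "\<dots> = cnj z ^ Suc k \<cdot>\<^sub>m (u * \<rho>)" by (rule eq_matI) auto
    finally show ?case .
  qed (auto intro: eq_matI)
  then have "(\<phi> ^^ n) (u * \<rho>) = (cnj (z ^ n)) \<cdot>\<^sub>m (u * \<rho>)" by simp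
  then have fix_n: "(\<phi> ^^ n) (u * \<rho>) = u * \<rho>" unfolding zn by (auto intro: eq_matI)
  \<comment> \<open>Although fixed by the \<open>n\<close>-th power, \<open>u * \<rho>\<close> is an
    eigenmatrix of \<phi> itself for cnj z, which differs from 1; trace preservation makes it
    traceless.\<close>
  have "mtrace (u * \<rho>) = cnj z * mtrace (u * \<rho>)"
    using ptpD(2)[OF \<phi> Y(1)] \<phi>Y mtrace_smult[OF Y(1)] by simp
  then have "(1 - cnj z) * mtrace (u * \<rho>) = 0" by (simp add: algebra_simps)
  moreover have "1 - cnj z \<noteq> 0" using z(2) by (metis complex_cnj_one complex_cnj_cancel_iff right_minus_eq)
  ultimately have tr0: "mtrace (u * \<rho>) = 0" by simp
  have "u * \<rho> \<noteq> 0\<^sub>m d d"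
  proof
    assume "u * \<rho> = 0\<^sub>m d d"
    then have "sandwich u \<rho> = 0\<^sub>m d d" unfolding sandwich_def using left_mult_zero_mat[OF u'] by simp
    then show False using tpos by (simp add: mtrace_def)
  qed
  then have "has_semipositive_fixed_point d (\<phi> ^^ n)"
    using fixed_trace_zero_imp_semipositive[OF ptp_funpow[OF \<phi>] Y(1) _ fix_n tr0] by blast
  with n show ?thesis by blast
qed

subsection \<open>The multiplicity of the eigenvalue one\<close>

text \<open>In a basis of the dual space containing \<open>t\<close>, the transpose of \<open>M\<close> fixes a basis vector, so \<open>M\<close>
  becomes block triangular and \<open>char_poly M = (X - 1) * char_poly B\<close>, where \<open>B\<close> is the restriction of
  \<open>M\<close> to the kernel of \<open>t\<close>.\<close>
lemma double_root_one_fixed_vector: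
  fixes M :: "complex mat"
  assumes M: "M \<in> carrier_mat n n" and n: "0 < n" and t: "t \<in> carrier_vec n" "t $ 0 = 1"
    and fixt: "transpose_mat M *\<^sub>v t = t"
    and ord: "2 \<le> Polynomial.order 1 (char_poly M)"
  obtains x where "x \<in> carrier_vec n" "x \<noteq> 0\<^sub>v n" "M *\<^sub>v x = x" "t \<bullet> x = 0"
proof -
  obtain m where nm: "n = Suc m" using n by (cases n) auto
  \<comment> \<open>The first row of \<open>S\<close> is \<open>t\<close>, the other rows are those
    of the identity. It is invertible because \<open>t $ 0 = 1\<close>, and \<open>S'\<close> is its
    inverse.\<close>
  define S where "S = mat n n (\<lambda>(i,j). if i = 0 then t $ j else if i = j then 1 else 0)"
  define S' where "S' = mat n n (\<lambda>(i,j). if i = 0 then (if j = 0 then 1 else - t $ j) else if i = j then 1 else 0)"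
  have S: "S \<in> carrier_mat n n" "S' \<in> carrier_mat n n" by (auto simp: S_def S'_def)
  have SS': "S * S' = 1\<^sub>m n"
  proof (rule eq_matI)
    fix i j assume "i < dim_row (1\<^sub>m n)" "j < dim_col (1\<^sub>m n)"
    then have ij: "i < n" "j < n" by auto
    have "(S * S') $$ (i,j) = (\<Sum>k<n. S $$ (i,k) * S' $$ (k,j))" by (rule mult_mat_index[OF S ij])
    also have "\<dots> = (\<Sum>k<n. if i = 0 then
        (if k = 0 then (if j = 0 then 1 else - t $ j) else 0) + (if k = j then if j = 0 then 0 else t $ j else 0)
        else if k = i then (if i = j then 1 else 0) else 0)"
      using ij by (intro sum.cong refl) (auto simp: S_def S'_def t)
    also have "\<dots> = 1\<^sub>m n $$ (i,j)"
      using ij by (cases "i = 0") (auto simp: sum.distrib)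
    finally show "(S * S') $$ (i,j) = 1\<^sub>m n $$ (i,j)" .
  qed (use S in auto)
  then have S'S: "S' * S = 1\<^sub>m n" using mat_mult_left_right_inverse[OF S] by simp
  define A where "A = S * M * S'"
  have A: "A \<in> carrier_mat n n" using S M by (auto simp: A_def)
  have sim: "similar_mat A M"
    unfolding similar_mat_def similar_mat_wit_def
    by (intro exI[of _ S] exI[of _ S']) (use A M S SS' S'S in \<open>auto simp: Let_def A_def\<close>)
  have SM: "(S * M) $$ (0,k) = S $$ (0,k)" if k: "k < n" for k
  proof -
    have "(S * M) $$ (0,k) = (\<Sum>l<n. S $$ (0,l) * M $$ (l,k))" by (rule mult_mat_index[OF S(1) M n k])
    also have "\<dots> = (transpose_mat M *\<^sub>v t) $ k"
      using M t(1) n k by (auto simp: scalar_prod_def lessThan_atLeast0 S_def mult.commute intro!: sum.cong)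
    finally show ?thesis unfolding fixt using k n by (simp add: S_def)
  qed
  have row0: "A $$ (0,j) = (if j = 0 then 1 else 0)" if j: "j < n" for j
  proof -
    have "A $$ (0,j) = (\<Sum>k<n. (S * M) $$ (0,k) * S' $$ (k,j))"
      unfolding A_def by (rule mult_mat_index[of _ n n]) (use S M n j in auto)
    also have "\<dots> = (\<Sum>k<n. S $$ (0,k) * S' $$ (k,j))" using SM by simp
    also have "\<dots> = (S * S') $$ (0,j)" using mult_mat_index[OF S n j] by simp
    finally show ?thesis unfolding SS' using n j by simp
  qed
  define B where "B = mat m m (\<lambda>(i,j). A $$ (Suc i, Suc j))"
  define C where "C = mat m 1 (\<lambda>(i,j). A $$ (Suc i, 0))"
  have B: "B \<in> carrier_mat m m" and C: "C \<in> carrier_mat m 1" by (auto simp: B_def C_def)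
  have blk: "A = four_block_mat (1\<^sub>m 1) (0\<^sub>m 1 m) C B"
    using A row0 unfolding nm by (intro eq_matI) (auto simp: four_block_mat_def Let_def B_def C_def)
  have "transpose_mat A = four_block_mat (1\<^sub>m 1) (transpose_mat C) (0\<^sub>m m 1) (transpose_mat B)"
    unfolding blk using B C by (subst transpose_four_block_mat[of _ 1 1 _ m _ m]) auto
  then have "char_poly (transpose_mat A) = char_poly (1\<^sub>m 1) * char_poly (transpose_mat B)"
    using char_poly_four_block_zeros_col[of "1\<^sub>m 1" "transpose_mat C" m "transpose_mat B"] B C by simp
  then have "char_poly A = char_poly (1\<^sub>m 1) * char_poly B"
    using char_poly_transpose_mat[OF A] char_poly_transpose_mat[OF B] by simp
  moreover have "char_poly (1\<^sub>m 1) = [:- 1, 1 :: complex:]"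
    by (subst char_poly_upper_triangular[of _ 1]) (auto simp: diag_mat_def)
  ultimately have cp: "char_poly M = [:- 1, 1:] * char_poly B"
    using char_poly_similar[OF sim] by simp
  have B0: "char_poly B \<noteq> 0" using degree_monic_char_poly[OF B] by auto
  have "Polynomial.order 1 ([:- 1, 1:] * char_poly B) = 1 + Polynomial.order 1 (char_poly B)"
  proof (subst order_mult)
    show "[:- 1, 1:] * char_poly B \<noteq> 0" using B0 by (simp only: mult_eq_0_iff) simp
  qed (use order_power_n_n[of "1 :: complex" 1] in simp)
  then have "Polynomial.order 1 (char_poly B) \<noteq> 0" using ord unfolding cp by linarith
  then have "poly (char_poly B) 1 = 0" using order_root by blast
  then have "eigenvalue B 1" using eigenvalue_root_char_poly[OF B] by blast
  then obtain y where y: "y \<in> carrier_vec m" "y \<noteq> 0\<^sub>v m" "B *\<^sub>v y = 1 \<cdot>\<^sub>v y"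
    using B unfolding eigenvalue_def eigenvector_def by auto
  \<comment> \<open>The first coordinate in the new basis is the value of \<open>t\<close>, so the 0
    placed there encodes \<open>t \<bullet> x = 0\<close>.\<close>
  define w where "w = vec n (\<lambda>i. if i = 0 then 0 else y $ (i - 1))"
  have w: "w \<in> carrier_vec n" by (simp add: w_def)
  have w0: "w \<noteq> 0\<^sub>v n"
  proof
    assume e: "w = 0\<^sub>v n"
    have "y $ i = 0" if "i < m" for i
    proof -
      have "w $ Suc i = 0" unfolding e using that nm by simp
      then show ?thesis using that nm by (simp add: w_def)
    qed
    then have "y = 0\<^sub>v m" using y(1) by (intro eq_vecI) auto
    with y show False by simp
  qed
  have Aw: "A *\<^sub>v w = w"
  proof (rule eq_vecI)
    fix i assume "i < dim_vec w"
    then have i: "i < n" by (simp add: w_def)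
    have s: "(A *\<^sub>v w) $ i = (\<Sum>k<m. A $$ (i, Suc k) * y $ k)"
    proof -
      have "(A *\<^sub>v w) $ i = (\<Sum>k<Suc m. A $$ (i,k) * w $ k)"
        using A w i nm by (auto simp: scalar_prod_def lessThan_atLeast0 intro!: sum.cong)
      also have "\<dots> = (\<Sum>k<m. A $$ (i, Suc k) * w $ Suc k)"
        unfolding sum.lessThan_Suc_shift using nm by (simp add: w_def)
      finally show ?thesis using nm by (simp add: w_def)
    qed
    show "(A *\<^sub>v w) $ i = w $ i"
    proof (cases i)
      case 0
      then show ?thesis unfolding s using row0 nm by (simp add: w_def)
    next
      case (Suc k)
      have "(\<Sum>l<m. A $$ (i, Suc l) * y $ l) = (B *\<^sub>v y) $ k"
        using Suc i nm y(1) by (auto simp: scalar_prod_def lessThan_atLeast0 B_def intro!: sum.cong)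
      then show ?thesis unfolding s y(3) using Suc i nm y(1) by (simp add: w_def)
    qed
  qed (use A w in auto)
  let ?x = "S' *\<^sub>v w"
  have x: "?x \<in> carrier_vec n" using S w by auto
  have Sx: "S *\<^sub>v ?x = w" using assoc_mult_mat_vec[OF S w] SS' w by simp
  have "M * S' = S' * A"
  proof -
    have "S' * A = (S' * S) * (M * S')"
      unfolding A_def using S M by (simp add: assoc_mult_mat[of _ n n _ n _ n])
    then show ?thesis unfolding S'S using S M by simp
  qed
  then have "M *\<^sub>v ?x = S' *\<^sub>v (A *\<^sub>v w)"
    using assoc_mult_mat_vec[OF M S(2) w] assoc_mult_mat_vec[OF S(2) A w] by simp
  then have Mx: "M *\<^sub>v ?x = ?x" unfolding Aw .
  have "t \<bullet> ?x = (S *\<^sub>v ?x) $ 0"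
  proof -
    have "row S 0 = t" using t(1) n by (intro eq_vecI) (auto simp: S_def)
    then show ?thesis using S(1) n by simp
  qed
  also have "\<dots> = 0" unfolding Sx using n by (simp add: w_def)
  finally have tx: "t \<bullet> ?x = 0" .
  have "?x \<noteq> 0\<^sub>v n"
  proof
    assume "?x = 0\<^sub>v n"
    then have "w = S *\<^sub>v 0\<^sub>v n" using Sx by simp
    also have "\<dots> = 0\<^sub>v n" using S(1) by (intro eq_vecI) auto
    finally show False using w0 by simp
  qed
  with that x Mx tx show ?thesis by blast
qed

text \<open>Algebraic multiplicity suffices, even if there is a Jordan block: one of the two roots
  is used up by the trace functional, the other remains on the traceless matrices and has an
  eigenvector there.\<close>

lemma double_one_imp_traceless_fixed:
  assumes l: "linear_map_mat d \<phi>" and tp: "trace_preserving d \<phi>" and d: "0 < d"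
    and "2 \<le> alg_mult d \<phi> 1"
  obtains Y where "Y \<in> carrier_mat d d" "Y \<noteq> 0\<^sub>m d d" "\<phi> Y = Y" "mtrace Y = 0"
proof -
  have t0: "trace_vec d $ 0 = 1" using d by (simp add: trace_vec_def)
  obtain x where x: "x \<in> carrier_vec (d*d)" "x \<noteq> 0\<^sub>v (d*d)" "rep_mat d \<phi> *\<^sub>v x = x" "trace_vec d \<bullet> x = 0"
    using double_root_one_fixed_vector[OF rep_mat_carrier _ trace_vec_carrier t0 trace_vec_left_fixed[OF l tp]]
      assms(4) d unfolding alg_mult_def by auto
  let ?Y = "mat_of_vec d x"
  have "vec_of_mat d (\<phi> ?Y) = x"
    using rep_mat_mult_vec[OF l, of ?Y] x vec_of_mat_of_vec by simp
  then have "\<phi> ?Y = ?Y"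
    using mat_of_vec_of_mat[of "\<phi> ?Y" d] linear_map_matD(1)[OF l, of ?Y] by simp
  moreover have "mtrace ?Y = 0"
    using trace_vec_scalar_prod[of ?Y d] vec_of_mat_of_vec[OF x(1)] x(4) by simp
  ultimately show ?thesis using that[of ?Y] mat_of_vec_eq_zero[OF x(1)] x(2) by auto
qed

definition peripheral_set :: "nat \<Rightarrow> (complex mat \<Rightarrow> complex mat) \<Rightarrow> complex set" where
  "peripheral_set d \<phi> = {z. poly (char_poly (rep_mat d \<phi>)) z = 0 \<and> cmod z = 1}"

lemma char_poly_rep_mat_nonzero: "char_poly (rep_mat d \<phi>) \<noteq> 0"
  using degree_monic_char_poly[OF rep_mat_carrier[of d \<phi>]] by auto

lemma finite_peripheral_set: "finite (peripheral_set d \<phi>)"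
  unfolding peripheral_set_def
  by (rule finite_subset[OF _ poly_roots_finite[OF char_poly_rep_mat_nonzero]]) auto

lemma alg_mult_pos: "z \<in> peripheral_set d \<phi> \<Longrightarrow> 1 \<le> alg_mult d \<phi> z"
  using char_poly_rep_mat_nonzero[of d \<phi>] order_root[of "char_poly (rep_mat d \<phi>)" z]
  by (auto simp: peripheral_set_def alg_mult_def)

lemma peripheral_count_ge_2_cases:
  assumes "2 \<le> peripheral_count d \<phi>"
  shows "2 \<le> alg_mult d \<phi> 1 \<or> (\<exists>z. poly (char_poly (rep_mat d \<phi>)) z = 0 \<and> cmod z = 1 \<and> z \<noteq> 1)"
proof (cases "peripheral_set d \<phi> \<subseteq> {1}")
  case True
  have "peripheral_count d \<phi> \<le> (\<Sum>z\<in>{1}. alg_mult d \<phi> z)"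
    unfolding peripheral_count_def peripheral_set_def[symmetric] using True by (intro sum_mono2) auto
  then show ?thesis using assms by simp
qed (auto simp: peripheral_set_def)

lemma peripheral_count_less_2:
  assumes "\<not> 2 \<le> peripheral_count d \<phi>" "poly (char_poly (rep_mat d \<phi>)) 1 = 0"
    and z: "poly (char_poly (rep_mat d \<phi>)) z = 0" "cmod z = 1"
  shows "z = 1"
proof (rule ccontr)
  assume "z \<noteq> 1"
  then have "2 = (\<Sum>z\<in>{1,z}. 1 :: nat)" by simp
  also have "\<dots> \<le> (\<Sum>z\<in>{1,z}. alg_mult d \<phi> z)"
    using assms by (intro sum_mono alg_mult_pos) (auto simp: peripheral_set_def)
  also have "\<dots> \<le> peripheral_count d \<phi>"
    unfolding peripheral_count_def peripheral_set_def[symmetric]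
    using assms finite_peripheral_set[of d \<phi>] by (intro sum_mono2) (auto simp: peripheral_set_def)
  finally show False using assms by simp
qed

subsection \<open>Convergence to the completely depolarizing map\<close>

lemma pow_smult_mat:
  assumes A: "A \<in> carrier_mat n n"
  shows "(c \<cdot>\<^sub>m A) ^\<^sub>m k = c ^ k \<cdot>\<^sub>m (A ^\<^sub>m k :: complex mat)"
proof (induction k)
  case 0
  then show ?case using A by (intro eq_matI) auto
next
  case (Suc k)
  have p: "A ^\<^sub>m k \<in> carrier_mat n n" using A by simp
  have "(c \<cdot>\<^sub>m A) ^\<^sub>m Suc k = c ^ k \<cdot>\<^sub>m (A ^\<^sub>m k) * (c \<cdot>\<^sub>m A)" by (simp add: Suc)
  also have "\<dots> = c ^ k \<cdot>\<^sub>m (c \<cdot>\<^sub>m (A ^\<^sub>m k * A))"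
    using mult_smult_assoc_mat[OF p, of "c \<cdot>\<^sub>m A" n "c ^ k"] mult_smult_distrib[OF p A, of c] A by simp
  also have "\<dots> = c ^ Suc k \<cdot>\<^sub>m (A ^\<^sub>m Suc k)" by (rule eq_matI) auto
  finally show ?case .
qed

text \<open>Bounded powers become decaying ones by rescaling: \<open>A\<close> divided by some
  \<open>s\<close> strictly between its spectral radius and one still has bounded powers, and
  multiplying back gives the factor \<open>s ^ k\<close>.\<close>

lemma power_mat_entries_tendsto_zero:
  fixes A :: "complex mat"
  assumes A: "A \<in> carrier_mat n n" and n: "0 < n"
    and ev: "\<And>z. poly (char_poly A) z = 0 \<Longrightarrow> cmod z < 1" and \<epsilon>: "0 < \<epsilon>"
  obtains k where "1 \<le> k" "\<And>i j. i < n \<Longrightarrow> j < n \<Longrightarrow> cmod ((A ^\<^sub>m k) $$ (i,j)) < \<epsilon>"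
proof -
  have sr: "spectral_radius A < 1"
    using spectral_radius_mem_max(1)[OF A n] ev unfolding spectrum_root_char_poly[OF A] by auto
  \<comment> \<open>The \<open>max 0\<close> makes \<open>s\<close> positive, so that one can divide
    by it.\<close>
  obtain s where s: "max 0 (spectral_radius A) < s" "s < 1" using dense[of "max 0 (spectral_radius A)" 1] sr by auto
  then have s0: "0 < s" by simp
  define B where "B = complex_of_real (1 / s) \<cdot>\<^sub>m A"
  have B: "B \<in> carrier_mat n n" using A by (simp add: B_def)
  have AB: "A = of_real s \<cdot>\<^sub>m B" using s0 by (intro eq_matI) (auto simp: B_def)
  have "cmod w < 1" if w: "w \<in> spectrum B" for w
  proof -
    obtain v where v: "v \<in> carrier_vec n" "v \<noteq> 0\<^sub>v n" "B *\<^sub>v v = w \<cdot>\<^sub>v v"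
      using w B unfolding spectrum_def eigenvalue_def eigenvector_def by auto
    have "A *\<^sub>v v = of_real s \<cdot>\<^sub>v (B *\<^sub>v v)"
      using smult_mult_mat_vec[OF B v(1), of "of_real s"] unfolding AB[symmetric] .
    also have "\<dots> = (of_real s * w) \<cdot>\<^sub>v v" unfolding v(3) by (simp add: smult_smult_assoc)
    finally have "of_real s * w \<in> spectrum A"
      unfolding spectrum_def eigenvalue_def eigenvector_def using v A by auto
    then have "cmod (of_real s * w) \<le> spectral_radius A"
      by (intro spectral_radius_mem_max(2)[OF A n]) auto
    then have "s * cmod w \<le> spectral_radius A" using s0 by (simp add: norm_mult)
    then have "s * cmod w < s * 1" using s by linarith
    then show ?thesis using s0 mult_less_cancel_left_pos by blast
  qed
  then have "spectral_radius B < 1" using spectral_radius_mem_max(1)[OF B n] by auto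
  then obtain c where c: "\<And>k. norm_bound (B ^\<^sub>m k) c"
    using spectral_radius_jnf_norm_bound_less_1_upper_triangular[OF B] by blast
  have "(\<lambda>k. s ^ k * (\<bar>c\<bar> + 1)) \<longlonglongrightarrow> 0 * (\<bar>c\<bar> + 1)"
    using s0 s(2) by (intro tendsto_mult_right LIMSEQ_power_zero) auto
  then have "\<forall>\<^sub>F k in sequentially. s ^ k * (\<bar>c\<bar> + 1) < \<epsilon>"
    using \<epsilon> by (intro order_tendstoD(2)) auto
  then obtain k0 where k0: "\<And>k. k0 \<le> k \<Longrightarrow> s ^ k * (\<bar>c\<bar> + 1) < \<epsilon>"
    unfolding eventually_sequentially by blast
  define k where "k = max 1 k0"
  have "cmod ((A ^\<^sub>m k) $$ (i,j)) < \<epsilon>" if ij: "i < n" "j < n" for i j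
  proof -
    have Bk: "B ^\<^sub>m k \<in> carrier_mat n n" using B by simp
    have "(A ^\<^sub>m k) $$ (i,j) = of_real s ^ k * (B ^\<^sub>m k) $$ (i,j)"
      unfolding AB pow_smult_mat[OF B]
      using carrier_matD[OF Bk] ij by (intro index_smult_mat(1)) (simp_all del: pow_mat_dim)
    then have "cmod ((A ^\<^sub>m k) $$ (i,j)) = s ^ k * cmod ((B ^\<^sub>m k) $$ (i,j))"
      using s0 by (simp add: norm_mult norm_power)
    also have "\<dots> \<le> s ^ k * (\<bar>c\<bar> + 1)"
    proof (rule mult_left_mono)
      have "cmod ((B ^\<^sub>m k) $$ (i,j)) \<le> c" using c[of k] ij unfolding norm_bound_def carrier_matD[OF Bk] by blast
      then show "cmod ((B ^\<^sub>m k) $$ (i,j)) \<le> \<bar>c\<bar> + 1" by simp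
    qed (use s0 in simp)
    also have "\<dots> < \<epsilon>" by (rule k0) (simp add: k_def)
    finally show ?thesis .
  qed
  then show ?thesis using that[of k] by (simp add: k_def)
qed

lemma eigenmatrix_root:
  assumes l: "linear_map_mat d \<phi>" and X: "X \<in> carrier_mat d d" "X \<noteq> 0\<^sub>m d d" "\<phi> X = z \<cdot>\<^sub>m X"
  shows "poly (char_poly (rep_mat d \<phi>)) z = 0"
proof -
  have "vec_of_mat d (z \<cdot>\<^sub>m X) = z \<cdot>\<^sub>v vec_of_mat d X"
    using X(1) by (intro eq_vecI) (auto simp: vec_of_mat_def div_mod_lt)
  then have "rep_mat d \<phi> *\<^sub>v vec_of_mat d X = z \<cdot>\<^sub>v vec_of_mat d X"
    using rep_mat_mult_vec[OF l X(1)] X(3) by simp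
  moreover have "vec_of_mat d X \<noteq> 0\<^sub>v (d*d)"
  proof
    assume "vec_of_mat d X = 0\<^sub>v (d*d)"
    then have "X = mat_of_vec d (0\<^sub>v (d*d))" using mat_of_vec_of_mat[OF X(1)] by simp
    also have "\<dots> = 0\<^sub>m d d" by (rule eq_matI) (auto simp: mat_of_vec_def index_lt)
    finally show False using X by simp
  qed
  ultimately have "eigenvalue (rep_mat d \<phi>) z"
    unfolding eigenvalue_def eigenvector_def
    by (intro exI[of _ "vec_of_mat d X"]) (auto simp: rep_mat_def)
  then show ?thesis using eigenvalue_root_char_poly[OF rep_mat_carrier] by blast
qed

text \<open>Subtracting tr(X) \<rho> deflates the eigenvalue one. The difference \<psi> has only
  traceless values, so its eigenmatrices for nonzero eigenvalues are traceless eigenmatrices of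
  \<phi>, and \<open>gap\<close> puts its whole spectrum inside the unit disc.\<close>

lemma funpow_tendsto_depolarizing:
  assumes \<phi>: "ptp d \<phi>" and d: "0 < d"
    and \<rho>: "\<rho> \<in> carrier_mat d d" "\<phi> \<rho> = \<rho>" "mtrace \<rho> = 1"
    and gap: "\<And>X z. X \<in> carrier_mat d d \<Longrightarrow> X \<noteq> 0\<^sub>m d d \<Longrightarrow> \<phi> X = z \<cdot>\<^sub>m X \<Longrightarrow> mtrace X = 0 \<Longrightarrow> cmod z < 1"
    and \<epsilon>: "0 < \<epsilon>"
  obtains n where "1 \<le> n" "\<And>a b i j. a < d \<Longrightarrow> b < d \<Longrightarrow> i < d \<Longrightarrow> j < d \<Longrightarrow>
    cmod ((\<phi> ^^ n) (mat_unit d a b) $$ (i,j) - (if a = b then \<rho> $$ (i,j) else 0)) < \<epsilon>"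
proof -
  note ph = ptpD[OF \<phi>]
  define \<psi> where "\<psi> X = \<phi> X - mtrace X \<cdot>\<^sub>m \<rho>" for X
  have \<psi>c: "\<psi> X \<in> carrier_mat d d" if "X \<in> carrier_mat d d" for X
    using \<rho>(1) ph(5)[OF that] by (auto simp: \<psi>_def)
  have l: "linear_map_mat d \<psi>"
    unfolding linear_map_mat_def
  proof (intro conjI ballI allI)
    fix A B :: "complex mat" assume A: "A \<in> carrier_mat d d" "B \<in> carrier_mat d d"
    show "\<psi> (A + B) = \<psi> A + \<psi> B"
      unfolding \<psi>_def linear_map_matD(2)[OF ph(1) A] mtrace_add[OF A]
      using \<rho>(1) ph(5)[OF A(1)] ph(5)[OF A(2)] by (intro eq_matI) (auto simp: algebra_simps)
  next
    fix c and A :: "complex mat" assume A: "A \<in> carrier_mat d d"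
    show "\<psi> (c \<cdot>\<^sub>m A) = c \<cdot>\<^sub>m \<psi> A"
      unfolding \<psi>_def linear_map_matD(3)[OF ph(1) A] mtrace_smult[OF A]
      using \<rho>(1) ph(5)[OF A] by (intro eq_matI) (auto simp: algebra_simps)
  qed (use \<psi>c in auto)
  have tr\<psi>: "mtrace (\<psi> X) = 0" if X: "X \<in> carrier_mat d d" for X
  proof -
    have "mtrace (\<psi> X) = mtrace (\<phi> X) - mtrace (mtrace X \<cdot>\<^sub>m \<rho>)"
      unfolding \<psi>_def by (rule mtrace_minus[of _ d]) (use ph(5)[OF X] \<rho>(1) in auto)
    then show ?thesis using ph(2)[OF X] \<rho>(3) mtrace_smult[OF \<rho>(1)] by simp
  qed
  have ev: "cmod z < 1" if z: "poly (char_poly (rep_mat d \<psi>)) z = 0" for z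
  proof -
    obtain X where X: "X \<in> carrier_mat d d" "X \<noteq> 0\<^sub>m d d" "\<psi> X = z \<cdot>\<^sub>m X"
      using rep_mat_eigenmatrix[OF l z] by blast
    show ?thesis
    proof (cases "z = 0")
      case False
      have "z * mtrace X = 0" using tr\<psi>[OF X(1)] unfolding X(3) mtrace_smult[OF X(1)] .
      then have t: "mtrace X = 0" using False by simp
      have "\<phi> X = \<psi> X" unfolding \<psi>_def t using ph(5)[OF X(1)] \<rho>(1) by (intro eq_matI) auto
      then show ?thesis using gap[OF X(1,2) _ t] X(3) by simp
    qed simp
  qed
  \<comment> \<open>This starts at \<open>n = 1\<close>: for \<open>n = 0\<close> the left side is
    \<open>X\<close> without the subtracted term.\<close>
  have pw: "(\<psi> ^^ n) X = (\<phi> ^^ n) X - mtrace X \<cdot>\<^sub>m \<rho>" if "1 \<le> n" and X: "X \<in> carrier_mat d d" for n X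
    using that(1)
  proof (induction n rule: dec_induct)
    case base
    then show ?case by (simp add: \<psi>_def)
  next
    case (step n)
    note p = ptpD[OF ptp_funpow[OF \<phi>, of n]]
    let ?Y = "(\<phi> ^^ n) X"
    have Y: "?Y \<in> carrier_mat d d" using p(5)[OF X] .
    have t: "mtrace (?Y - mtrace X \<cdot>\<^sub>m \<rho>) = 0"
      using p(2)[OF X] \<rho> Y by (subst mtrace_minus[of _ d]) (auto simp: mtrace_smult[of _ d])
    have "\<phi> (?Y - mtrace X \<cdot>\<^sub>m \<rho>) = \<phi> ?Y - mtrace X \<cdot>\<^sub>m \<rho>"
    proof -
      have e: "?Y - mtrace X \<cdot>\<^sub>m \<rho> = ?Y + (- mtrace X) \<cdot>\<^sub>m \<rho>" using Y \<rho>(1) by (intro eq_matI) auto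
      have "\<phi> (?Y + (- mtrace X) \<cdot>\<^sub>m \<rho>) = \<phi> ?Y + (- mtrace X) \<cdot>\<^sub>m \<rho>"
        using linear_map_matD(2)[OF ph(1) Y, of "(- mtrace X) \<cdot>\<^sub>m \<rho>"] linear_map_matD(3)[OF ph(1) \<rho>(1), of "- mtrace X"] \<rho> by simp
      also have "\<dots> = \<phi> ?Y - mtrace X \<cdot>\<^sub>m \<rho>" using ph(5)[OF Y] \<rho>(1) by (intro eq_matI) auto
      finally show ?thesis unfolding e .
    qed
    moreover have "0 \<cdot>\<^sub>m \<rho> = 0\<^sub>m d d" using \<rho>(1) by (intro eq_matI) auto
    ultimately have "\<psi> (?Y - mtrace X \<cdot>\<^sub>m \<rho>) = \<phi> ?Y - mtrace X \<cdot>\<^sub>m \<rho>"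
      unfolding \<psi>_def t using ph(5)[OF Y] \<rho>(1) by (intro eq_matI) auto
    then show ?case using step.IH by simp
  qed
  obtain n where n: "1 \<le> n" "\<And>p q. p < d*d \<Longrightarrow> q < d*d \<Longrightarrow> cmod ((rep_mat d \<psi> ^\<^sub>m n) $$ (p,q)) < \<epsilon>"
    using power_mat_entries_tendsto_zero[OF rep_mat_carrier _ ev \<epsilon>] d by (metis nat_0_less_mult_iff)
  have "cmod ((\<phi> ^^ n) (mat_unit d a b) $$ (i,j) - (if a = b then \<rho> $$ (i,j) else 0)) < \<epsilon>"
    if h: "a < d" "b < d" "i < d" "j < d" for a b i j
  proof -
    have t: "mtrace (mat_unit d a b) = (if a = b then 1 else 0)"
      using h by (auto simp: mtrace_def)
    have "(rep_mat d \<psi> ^\<^sub>m n) $$ (i*d+j, a*d+b) = (\<psi> ^^ n) (mat_unit d a b) $$ (i,j)"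
      unfolding rep_mat_funpow[OF l, symmetric] by (rule rep_mat_index[OF h(3,4,1,2)])
    also have "\<dots> = (\<phi> ^^ n) (mat_unit d a b) $$ (i,j) - (if a = b then \<rho> $$ (i,j) else 0)"
      unfolding pw[OF n(1) mat_unit_carrier] t using \<rho>(1) h by auto
    finally show ?thesis using n(2)[OF index_lt[OF h(3,4)] index_lt[OF h(1,2)]] by simp
  qed
  then show ?thesis using that n(1) by blast
qed

text \<open>A faithful state is an interior point of the positive cone in the space of hermitian
  matrices; the size of the perturbation is measured entrywise.\<close>

lemma psd_perturb:
  assumes \<rho>: "psd d \<rho>" "det \<rho> \<noteq> 0"
  obtains \<delta> where "0 < \<delta>" "\<And>H. H \<in> carrier_mat d d \<Longrightarrow> mat_adjoint H = H \<Longrightarrow>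
    (\<And>i j. i < d \<Longrightarrow> j < d \<Longrightarrow> cmod (H $$ (i,j)) \<le> \<delta>) \<Longrightarrow> psd d (\<rho> + H)"
proof -
  note r = psdD[OF \<rho>(1)]
  obtain c where c: "c > 0" "\<And>x. c * (\<Sum>i<d. (cmod (x i))\<^sup>2) \<le> Re (qform d \<rho> x)"
    using posdef_coercive[OF \<rho>] by blast
  \<comment> \<open>Entries of modulus at most \<delta> bound the form of \<open>H\<close> by
    \<delta> d |x|^2. The \<open>+ 1\<close> keeps the denominator positive when
    \<open>d = 0\<close>.\<close>
  define \<delta> where "\<delta> = c / (real d + 1)"
  have \<delta>: "0 < \<delta>" using c(1) by (simp add: \<delta>_def)
  have "psd d (\<rho> + H)" if H: "H \<in> carrier_mat d d" "mat_adjoint H = H"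
    and small: "\<And>i j. i < d \<Longrightarrow> j < d \<Longrightarrow> cmod (H $$ (i,j)) \<le> \<delta>" for H
  proof -
    have "0 \<le> Re (qform d (\<rho> + H) x)" for x
    proof -
      let ?s = "\<Sum>i<d. (cmod (x i))\<^sup>2"
      have "cmod (qform d H x) \<le> (\<Sum>i<d. \<Sum>j<d. cmod (cnj (x i) * H $$ (i,j) * x j))"
        unfolding qform_def by (intro order_trans[OF norm_sum] sum_mono order_refl)
      also have "\<dots> \<le> (\<Sum>i<d. \<Sum>j<d. \<delta> * (((cmod (x i))\<^sup>2 + (cmod (x j))\<^sup>2) / 2))"
      proof (intro sum_mono)
        fix i j assume "i \<in> {..<d}" "j \<in> {..<d}"
        then have "cmod (H $$ (i,j)) \<le> \<delta>" using small by auto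
        moreover have "cmod (x i) * cmod (x j) \<le> ((cmod (x i))\<^sup>2 + (cmod (x j))\<^sup>2) / 2"
          using sum_squares_bound[of "cmod (x i)" "cmod (x j)"] by simp
        ultimately have "cmod (H $$ (i,j)) * (cmod (x i) * cmod (x j)) \<le> \<delta> * (((cmod (x i))\<^sup>2 + (cmod (x j))\<^sup>2) / 2)"
          using \<delta> by (intro mult_mono) auto
        then show "cmod (cnj (x i) * H $$ (i,j) * x j) \<le> \<delta> * (((cmod (x i))\<^sup>2 + (cmod (x j))\<^sup>2) / 2)"
          by (simp add: norm_mult mult_ac)
      qed
      also have "\<dots> = \<delta> * (real d * ?s)"
        by (simp add: sum_distrib_left[symmetric] sum_divide_distrib[symmetric] sum.distrib)
      also have "\<dots> \<le> c * ?s"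
      proof -
        have "\<delta> * real d \<le> c" using c(1) by (simp add: \<delta>_def field_simps)
        then have "\<delta> * real d * ?s \<le> c * ?s" by (intro mult_right_mono sum_nonneg) auto
        then show ?thesis by (simp add: mult.assoc)
      qed
      also have "\<dots> \<le> Re (qform d \<rho> x)" by (rule c(2))
      finally have "\<bar>Re (qform d H x)\<bar> \<le> Re (qform d \<rho> x)" using abs_Re_le_cmod order_trans by blast
      moreover have "qform d (\<rho> + H) x = qform d \<rho> x + qform d H x"
        using r(1) H(1) unfolding qform_def sum.distrib[symmetric]
        by (intro sum.cong) (auto simp: algebra_simps)
      ultimately show ?thesis by simp
    qed
    then show ?thesis unfolding psd_iff using r(1,2) H mat_adjoint_add[OF r(1) H(1)] by auto
  qed
  with \<delta> that show ?thesis by blast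
qed

subsection \<open>Entanglement-breaking maps are measure-and-prepare maps\<close>

text \<open>The measure-and-prepare form X |-> sum of tr(E_l X) R_l. Effects and prepared matrices
  are not normalised, so scalars can be absorbed into either of them.\<close>

definition holevo :: "nat \<Rightarrow> (complex mat \<Rightarrow> complex mat) \<Rightarrow> bool" where
  "holevo d \<psi> \<longleftrightarrow> (\<exists>(N::nat) E R. (\<forall>l<N. psd d (E l) \<and> psd d (R l)) \<and>
     (\<forall>X \<in> carrier_mat d d. \<psi> X = mat d d (\<lambda>(i,j). \<Sum>l<N. mtrace (E l * X) * R l $$ (i,j))))"

text \<open>Allows any finite index set; the polarization argument for maps near the depolarizing
  one is indexed by triples.\<close>

lemma holevoI:
  fixes S :: "'s set"
  assumes S: "finite S" and ER: "\<And>s. s \<in> S \<Longrightarrow> psd d (E s)" "\<And>s. s \<in> S \<Longrightarrow> psd d (R s)"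
    and c: "\<And>X. X \<in> carrier_mat d d \<Longrightarrow> \<psi> X \<in> carrier_mat d d"
    and eq: "\<And>X i j. X \<in> carrier_mat d d \<Longrightarrow> i < d \<Longrightarrow> j < d \<Longrightarrow>
      \<psi> X $$ (i,j) = (\<Sum>s\<in>S. mtrace (E s * X) * R s $$ (i,j))"
  shows "holevo d \<psi>"
proof -
  obtain h where h: "bij_betw h {0..<card S} S" using ex_bij_betw_nat_finite[OF S] by blast
  have hS: "h l \<in> S" if "l < card S" for l using h that unfolding bij_betw_def by auto
  have "\<psi> X = mat d d (\<lambda>(i,j). \<Sum>l<card S. mtrace (E (h l) * X) * R (h l) $$ (i,j))" (is "_ = ?R")
    if X: "X \<in> carrier_mat d d" for X
  proof (rule eq_matI)
    fix i j assume "i < dim_row ?R" "j < dim_col ?R"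
    then have ij: "i < d" "j < d" by auto
    have "\<psi> X $$ (i,j) = (\<Sum>s\<in>S. mtrace (E s * X) * R s $$ (i,j))" by (rule eq[OF X ij])
    also have "\<dots> = (\<Sum>l\<in>{0..<card S}. mtrace (E (h l) * X) * R (h l) $$ (i,j))"
      by (rule sum.reindex_bij_betw[OF h, symmetric])
    finally show "\<psi> X $$ (i,j) = ?R $$ (i,j)"
      using ij by (simp add: lessThan_atLeast0)
  qed (use c[OF X] in auto)
  then show ?thesis unfolding holevo_def
    using ER hS by (intro exI[of _ "card S"] exI[of _ "E \<circ> h"] exI[of _ "R \<circ> h"]) auto
qed

text \<open>A positive map applied afterwards acts on the prepared matrices only.\<close>

lemma holevo_comp:
  assumes \<psi>: "holevo d \<psi>" and \<chi>: "linear_map_mat d \<chi>" "\<And>X. psd d X \<Longrightarrow> psd d (\<chi> X)"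
  shows "holevo d (\<chi> \<circ> \<psi>)"
proof -
  obtain N :: nat and E R where ER: "\<And>l. l < N \<Longrightarrow> psd d (E l)" "\<And>l. l < N \<Longrightarrow> psd d (R l)"
    and eq: "\<And>X. X \<in> carrier_mat d d \<Longrightarrow> \<psi> X = mat d d (\<lambda>(i,j). \<Sum>l<N. mtrace (E l * X) * R l $$ (i,j))"
    using \<psi> unfolding holevo_def by blast
  show ?thesis
  proof (rule holevoI[of "{..<N}" d E "\<chi> \<circ> R"])
    fix X :: "complex mat" and i j assume h: "X \<in> carrier_mat d d" "i < d" "j < d"
    show "(\<chi> \<circ> \<psi>) X $$ (i,j) = (\<Sum>s<N. mtrace (E s * X) * (\<chi> \<circ> R) s $$ (i,j))"
      unfolding comp_def eq[OF h(1)]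
      by (rule linear_map_sum[OF \<chi>(1) _ h(2,3)]) (use psdD(1)[OF ER(2)] in auto)
  qed (use ER \<chi> eq linear_map_matD(1)[OF \<chi>(1)] in auto)
qed

text \<open>By cyclicity of the trace, a conjugation applied beforehand moves into the
  effects.\<close>

lemma holevo_precomp_sandwich:
  assumes \<psi>: "holevo d \<psi>" and U: "U \<in> carrier_mat d d"
  shows "holevo d (\<psi> \<circ> sandwich U)"
proof -
  obtain N :: nat and E R where ER: "\<And>l. l < N \<Longrightarrow> psd d (E l)" "\<And>l. l < N \<Longrightarrow> psd d (R l)"
    and eq: "\<And>X. X \<in> carrier_mat d d \<Longrightarrow> \<psi> X = mat d d (\<lambda>(i,j). \<Sum>l<N. mtrace (E l * X) * R l $$ (i,j))"
    using \<psi> unfolding holevo_def by blast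
  have U': "mat_adjoint U \<in> carrier_mat d d" using U by auto
  show ?thesis
  proof (rule holevoI[of "{..<N}" d "\<lambda>l. sandwich (mat_adjoint U) (E l)" R])
    fix X :: "complex mat" and i j assume h: "X \<in> carrier_mat d d" "i < d" "j < d"
    have "mtrace (E l * sandwich U X) = mtrace (sandwich (mat_adjoint U) (E l) * X)" if l: "l < N" for l
    proof -
      have E: "E l \<in> carrier_mat d d" using psdD(1)[OF ER(1)[OF l]] .
      have "E l * sandwich U X = (E l * U * X) * mat_adjoint U"
        unfolding sandwich_def using E U U' h(1) by (simp add: assoc_mult_mat[of _ d d _ d _ d] del: mat_adjoint_carrier)
      also have "mtrace \<dots> = mtrace (mat_adjoint U * (E l * U * X))"
        by (rule mtrace_comm[of _ d d]) (use E U U' h(1) in auto)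
      also have "mat_adjoint U * (E l * U * X) = sandwich (mat_adjoint U) (E l) * X"
        unfolding sandwich_def using E U U' h(1) by (simp add: assoc_mult_mat[of _ d d _ d _ d] del: mat_adjoint_carrier)
      finally show ?thesis .
    qed
    then show "(\<psi> \<circ> sandwich U) X $$ (i,j) = (\<Sum>s<N. mtrace (sandwich (mat_adjoint U) (E s) * X) * R s $$ (i,j))"
      using eq[OF sandwich_carrier[OF U h(1)]] h by simp
  qed (use ER eq sandwich_carrier[OF U] psd_conj[OF _ U'] in \<open>auto simp: sandwich_def\<close>)
qed

text \<open>It suffices to use separability of the image of the maximally entangled state. This is
  the normalised Choi matrix, and in a decomposition of it the first factors are the prepared
  matrices and the second factors give the effects.\<close>

lemma entanglement_breaking_imp_holevo:
  assumes l: "linear_map_mat d \<psi>" and d: "0 < d" and eb: "entanglement_breaking d \<psi>"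
  shows "holevo d \<psi>"
proof -
  define \<omega> where "\<omega> = of_real (1 / d) \<cdot>\<^sub>m max_entangled d"
  note me = psdD[OF psd_max_entangled[of d]]
  have \<omega>: "\<omega> \<in> carrier_mat (d*d) (d*d)" using me(1) by (simp add: \<omega>_def)
  have "qform (d*d) \<omega> x = of_real (1 / d) * qform (d*d) (max_entangled d) x" for x
    unfolding qform_def sum_distrib_left using me(1) by (intro sum.cong) (auto simp: \<omega>_def)
  then have "psd (d*d) \<omega>"
    unfolding psd_iff using me d mat_adjoint_smult[of "of_real (1 / d)" "max_entangled d"] \<omega>
    by (auto simp: \<omega>_def)
  moreover have "mtrace \<omega> = 1"
  proof -
    have "mtrace (max_entangled d) = (\<Sum>p<d*d. if p div d = p mod d then 1 else 0)"
      using me(1) by (auto simp: mtrace_def max_entangled_def intro!: sum.cong)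
    also have "\<dots> = (\<Sum>a<d. \<Sum>b<d. if a = b then 1 else 0)" by (rule sum_div_mod)
    also have "\<dots> = of_nat d" by simp
    finally show ?thesis unfolding \<omega>_def mtrace_smult[OF me(1)] using d by simp
  qed
  ultimately have "separable_state d d (tensor_id \<psi> d d \<omega>)"
    using eb d unfolding entanglement_breaking_def density_def by auto
  then obtain N :: nat and A B where AB: "\<And>l. l < (N::nat) \<Longrightarrow> psd d (A l)" "\<And>l. l < N \<Longrightarrow> psd d (B l)"
    and sep: "tensor_id \<psi> d d \<omega> = mat (d*d) (d*d) (\<lambda>(p,q). \<Sum>l<N. kron (A l) (B l) $$ (p,q))"
    unfolding separable_state_def by blast
  have unit: "\<psi> (mat_unit d a b) $$ (i,j) = (\<Sum>l<N. of_nat d * B l $$ (a,b) * A l $$ (i,j))"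
    if h: "i < d" "j < d" "a < d" "b < d" for i j a b
  proof -
    have "block d d \<omega> a b = of_real (1 / d) \<cdot>\<^sub>m mat_unit d a b"
      using h me(1) by (intro eq_matI) (auto simp: \<omega>_def block_def max_entangled_def index_lt)
    then have "tensor_id \<psi> d d \<omega> $$ (i*d+a, j*d+b) = of_real (1 / d) * \<psi> (mat_unit d a b) $$ (i,j)"
      using h linear_map_matD(3)[OF l, of "mat_unit d a b" "of_real (1/d)"] linear_map_matD(1)[OF l, of "mat_unit d a b"]
      by (simp add: tensor_id_def index_lt)
    moreover have "tensor_id \<psi> d d \<omega> $$ (i*d+a, j*d+b) = (\<Sum>l<N. A l $$ (i,j) * B l $$ (a,b))"
    proof -
      have "kron (A l) (B l) $$ (i*d+a, j*d+b) = A l $$ (i,j) * B l $$ (a,b)" if "l < N" for l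
        using psdD(1)[OF AB(1)[OF that]] psdD(1)[OF AB(2)[OF that]] h by (auto simp: kron_def index_lt)
      then show ?thesis unfolding sep using h by (simp add: index_lt)
    qed
    ultimately have "of_real (1 / d) * \<psi> (mat_unit d a b) $$ (i,j) = (\<Sum>l<N. A l $$ (i,j) * B l $$ (a,b))" by simp
    then have "of_nat d * (of_real (1 / d) * \<psi> (mat_unit d a b) $$ (i,j)) = of_nat d * (\<Sum>l<N. A l $$ (i,j) * B l $$ (a,b))" by simp
    then show ?thesis using d by (simp add: sum_distrib_left mult_ac)
  qed
  \<comment> \<open>The transpose appears because tr (E X) pairs entry (j,i) with entry (i,j); it
    stays positive since its form at x is that of the original at the conjugate of x. The factor
    \<open>d\<close> undoes the normalisation of \<open>\<omega>\<close>.\<close>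
  define E where "E l = mat d d (\<lambda>(i,j). of_nat d * B l $$ (j,i))" for l
  have E: "psd d (E l)" if l: "l < N" for l
  proof -
    note b = psdD[OF AB(2)[OF l]]
    have "qform d (E l) x = of_nat d * qform d (B l) (\<lambda>k. cnj (x k))" for x
    proof -
      have "qform d (E l) x = (\<Sum>i<d. \<Sum>j<d. of_nat d * (x j * B l $$ (j,i) * cnj (x i)))"
        unfolding qform_def by (intro sum.cong) (auto simp: E_def)
      also have "\<dots> = (\<Sum>j<d. \<Sum>i<d. of_nat d * (x j * B l $$ (j,i) * cnj (x i)))" by (rule sum.swap)
      finally show ?thesis by (simp add: qform_def sum_distrib_left)
    qed
    moreover have "mat_adjoint (E l) = E l"
    proof (rule hermitianI[of _ d])
      fix i j assume "i < d" "j < d"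
      then show "E l $$ (j,i) = cnj (E l $$ (i,j))" using psd_herm[OF AB(2)[OF l], of j i] by (simp add: E_def)
    qed (simp add: E_def)
    ultimately show ?thesis unfolding psd_iff using b(3) by (auto simp: E_def)
  qed
  show ?thesis
  proof (rule holevoI[of "{..<N}" d E A])
    fix X :: "complex mat" and i j assume h: "X \<in> carrier_mat d d" "i < d" "j < d"
    have "\<psi> X $$ (i,j) = (\<Sum>a<d. \<Sum>b<d. \<Sum>l<N. (of_nat d * B l $$ (a,b) * X $$ (a,b)) * A l $$ (i,j))"
      unfolding linear_map_expand[OF l h] using unit h by (intro sum.cong) (auto simp: sum_distrib_left mult_ac)
    also have "\<dots> = (\<Sum>a<d. \<Sum>l<N. \<Sum>b<d. (of_nat d * B l $$ (a,b) * X $$ (a,b)) * A l $$ (i,j))"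
      by (intro sum.cong refl sum.swap)
    also have "\<dots> = (\<Sum>l<N. \<Sum>a<d. \<Sum>b<d. (of_nat d * B l $$ (a,b) * X $$ (a,b)) * A l $$ (i,j))" by (rule sum.swap)
    also have "\<dots> = (\<Sum>l<N. mtrace (E l * X) * A l $$ (i,j))"
    proof (intro sum.cong refl)
      fix l assume "l \<in> {..<N}"
      have "mtrace (E l * X) = (\<Sum>b<d. \<Sum>a<d. of_nat d * B l $$ (a,b) * X $$ (a,b))"
        by (subst mtrace_mult[of _ d d]) (use h(1) in \<open>auto simp: E_def intro!: sum.cong\<close>)
      also have "\<dots> = (\<Sum>a<d. \<Sum>b<d. of_nat d * B l $$ (a,b) * X $$ (a,b))" by (rule sum.swap)
      finally show "(\<Sum>a<d. \<Sum>b<d. (of_nat d * B l $$ (a,b) * X $$ (a,b)) * A l $$ (i,j)) = mtrace (E l * X) * A l $$ (i,j)"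
        by (simp add: sum_distrib_right)
    qed
    finally show "\<psi> X $$ (i,j) = (\<Sum>l<N. mtrace (E l * X) * A l $$ (i,j))" .
  qed (use E AB linear_map_matD(1)[OF l] in auto)
qed

text \<open>This is the partial trace of (E tensor 1) \<rho> over the first factor. With Gram
  vectors e_l of \<open>E\<close>, its form at x is the sum over l of the forms of \<rho> at e_l
  tensor x.\<close>

lemma partial_trace_psd:
  assumes E: "psd d E" and \<rho>: "psd (d*k) \<rho>"
  shows "psd k (mat k k (\<lambda>(a,b). mtrace (E * block d k \<rho> a b)))" (is "psd k ?B")
proof -
  note e = psdD[OF E] and r = psdD[OF \<rho>]
  have blk: "block d k \<rho> a b \<in> carrier_mat d d" for a b by (simp add: block_def)
  have tr: "mtrace (E * block d k \<rho> a b) = (\<Sum>i<d. \<Sum>j<d. E $$ (i,j) * \<rho> $$ (j*k+a, i*k+b))" for a b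
    unfolding mtrace_mult[OF e(1) blk] by (intro sum.cong) (auto simp: block_def)
  have herm: "mat_adjoint ?B = ?B"
  proof (rule hermitianI[of _ k])
    fix a b assume ab: "a < k" "b < k"
    have "cnj (?B $$ (a,b)) = (\<Sum>i<d. \<Sum>j<d. cnj (E $$ (i,j)) * cnj (\<rho> $$ (j*k+a, i*k+b)))"
      using ab by (simp add: tr)
    also have "\<dots> = (\<Sum>i<d. \<Sum>j<d. E $$ (j,i) * \<rho> $$ (i*k+b, j*k+a))"
      by (intro sum.cong refl arg_cong2[of _ _ _ _ "(*)"] psd_herm[OF E, symmetric] psd_herm[OF \<rho>, symmetric] index_lt)
        (use ab in auto)
    also have "\<dots> = ?B $$ (b,a)"
      using ab by (simp add: tr) (rule sum.swap)
    finally show "?B $$ (b,a) = cnj (?B $$ (a,b))" by simp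
  qed simp
  obtain e :: "nat \<Rightarrow> nat \<Rightarrow> complex" where
    Ee: "\<And>i j. i < d \<Longrightarrow> j < d \<Longrightarrow> E $$ (i,j) = (\<Sum>l<d. e l i * cnj (e l j))"
    using psd_gram[OF E] by blast
  have "qform k ?B x = (\<Sum>l<d. qform (d*k) \<rho> (\<lambda>p. e l (p div k) * x (p mod k)))" for x
  proof -
    let ?F = "\<lambda>l j a i b. cnj (e l j * x a) * \<rho> $$ (j*k+a, i*k+b) * (e l i * x b)"
    have q: "qform (d*k) \<rho> (\<lambda>p. e l (p div k) * x (p mod k)) = (\<Sum>a<k. \<Sum>b<k. \<Sum>i<d. \<Sum>j<d. ?F l j a i b)" for l
    proof -
      have "qform (d*k) \<rho> (\<lambda>p. e l (p div k) * x (p mod k))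
        = (\<Sum>p<d*k. \<Sum>q<d*k. ?F l (p div k) (p mod k) (q div k) (q mod k))"
        unfolding qform_def by simp
      also have "\<dots> = (\<Sum>p<d*k. \<Sum>i<d. \<Sum>b<k. ?F l (p div k) (p mod k) i b)"
        by (intro sum.cong refl sum_div_mod)
      also have "\<dots> = (\<Sum>j<d. \<Sum>a<k. \<Sum>i<d. \<Sum>b<k. ?F l j a i b)" by (rule sum_div_mod)
      also have "\<dots> = (\<Sum>a<k. \<Sum>j<d. \<Sum>i<d. \<Sum>b<k. ?F l j a i b)" by (rule sum.swap)
      also have "\<dots> = (\<Sum>a<k. \<Sum>j<d. \<Sum>b<k. \<Sum>i<d. ?F l j a i b)" by (intro sum.cong refl sum.swap)
      also have "\<dots> = (\<Sum>a<k. \<Sum>b<k. \<Sum>j<d. \<Sum>i<d. ?F l j a i b)" by (intro sum.cong refl sum.swap)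
      also have "\<dots> = (\<Sum>a<k. \<Sum>b<k. \<Sum>i<d. \<Sum>j<d. ?F l j a i b)" by (intro sum.cong refl sum.swap)
      finally show ?thesis .
    qed
    have "qform k ?B x = (\<Sum>a<k. \<Sum>b<k. \<Sum>i<d. \<Sum>j<d. \<Sum>l<d. ?F l j a i b)"
      unfolding qform_def
    proof (intro sum.cong refl)
      fix a b assume ab: "a \<in> {..<k}" "b \<in> {..<k}"
      have "cnj (x a) * ?B $$ (a,b) * x b = (\<Sum>i<d. \<Sum>j<d. cnj (x a) * (E $$ (i,j) * \<rho> $$ (j*k+a, i*k+b)) * x b)"
        using ab by (simp add: tr sum_distrib_left sum_distrib_right)
      also have "\<dots> = (\<Sum>i<d. \<Sum>j<d. \<Sum>l<d. ?F l j a i b)"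
        using Ee by (intro sum.cong refl) (auto simp: sum_distrib_left sum_distrib_right mult_ac)
      finally show "cnj (x a) * ?B $$ (a,b) * x b = (\<Sum>i<d. \<Sum>j<d. \<Sum>l<d. ?F l j a i b)" .
    qed
    also have "\<dots> = (\<Sum>a<k. \<Sum>b<k. \<Sum>i<d. \<Sum>l<d. \<Sum>j<d. ?F l j a i b)" by (intro sum.cong refl sum.swap)
    also have "\<dots> = (\<Sum>a<k. \<Sum>b<k. \<Sum>l<d. \<Sum>i<d. \<Sum>j<d. ?F l j a i b)" by (intro sum.cong refl sum.swap)
    also have "\<dots> = (\<Sum>a<k. \<Sum>l<d. \<Sum>b<k. \<Sum>i<d. \<Sum>j<d. ?F l j a i b)" by (intro sum.cong refl sum.swap)
    also have "\<dots> = (\<Sum>l<d. \<Sum>a<k. \<Sum>b<k. \<Sum>i<d. \<Sum>j<d. ?F l j a i b)" by (rule sum.swap)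
    finally show ?thesis unfolding q .
  qed
  then show ?thesis unfolding psd_iff using herm r(3) by (auto intro!: sum_nonneg)
qed

text \<open>Blockwise application gives the sum of R_l tensor B_l, where B_l is the unnormalised
  state of the second factor conditioned on outcome l.\<close>

lemma holevo_imp_entanglement_breaking:
  assumes "holevo d \<psi>"
  shows "entanglement_breaking d \<psi>"
  unfolding entanglement_breaking_def
proof (intro allI impI)
  fix k \<rho> assume k: "1 \<le> k" and \<rho>: "density (d*k) \<rho>"
  obtain N :: nat and E R where ER: "\<And>l. l < N \<Longrightarrow> psd d (E l)" "\<And>l. l < N \<Longrightarrow> psd d (R l)"
    and eq: "\<And>X. X \<in> carrier_mat d d \<Longrightarrow> \<psi> X = mat d d (\<lambda>(i,j). \<Sum>l<N. mtrace (E l * X) * R l $$ (i,j))"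
    using assms unfolding holevo_def by blast
  define B where "B l = mat k k (\<lambda>(a,b). mtrace (E l * block d k \<rho> a b))" for l
  have B: "psd k (B l)" if "l < N" for l
    unfolding B_def using partial_trace_psd ER(1)[OF that] \<rho> unfolding density_def by blast
  have blk: "block d k \<rho> a b \<in> carrier_mat d d" for a b by (simp add: block_def)
  have "tensor_id \<psi> d k \<rho> = mat (d*k) (d*k) (\<lambda>(p,q). \<Sum>l<N. kron (R l) (B l) $$ (p,q))" (is "_ = ?R")
  proof (rule eq_matI)
    fix p q assume "p < dim_row ?R" "q < dim_col ?R"
    then have pq: "p < d*k" "q < d*k" by auto
    note lt = div_mod_lt[OF pq(1)] div_mod_lt[OF pq(2)]
    have "tensor_id \<psi> d k \<rho> $$ (p,q) = (\<Sum>l<N. mtrace (E l * block d k \<rho> (p mod k) (q mod k)) * R l $$ (p div k, q div k))"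
      using pq lt by (simp add: tensor_id_def eq[OF blk])
    also have "\<dots> = (\<Sum>l<N. kron (R l) (B l) $$ (p,q))"
    proof (intro sum.cong refl)
      fix l assume "l \<in> {..<N}"
      then have "R l \<in> carrier_mat d d" using psdD(1)[OF ER(2)] by auto
      then show "mtrace (E l * block d k \<rho> (p mod k) (q mod k)) * R l $$ (p div k, q div k) = kron (R l) (B l) $$ (p,q)"
        using pq lt by (auto simp: kron_def B_def)
    qed
    finally show "tensor_id \<psi> d k \<rho> $$ (p,q) = ?R $$ (p,q)"
      using pq by simp
  qed (auto simp: tensor_id_def)
  then show "separable_state d k (tensor_id \<psi> d k \<rho>)"
    unfolding separable_state_def using ER(2) B by blast
qed

section \<open>Maps close to the completely depolarizing map\<close>

lemma psd_rank_one:
  assumes "0 \<le> c"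
  shows "psd n (mat n n (\<lambda>(i,j). complex_of_real c * (g i * cnj (g j))))"
proof -
  let ?A = "mat n n (\<lambda>(i,j). complex_of_real c * (g i * cnj (g j)))"
  have "qform n ?A x = of_real (c * (cmod (\<Sum>i<n. cnj (x i) * g i))\<^sup>2)" for x
  proof -
    let ?s = "\<Sum>i<n. cnj (x i) * g i"
    have "qform n ?A x = (\<Sum>i<n. \<Sum>j<n. of_real c * ((cnj (x i) * g i) * cnj (cnj (x j) * g j)))"
      unfolding qform_def by (intro sum.cong) auto
    also have "\<dots> = of_real c * (?s * cnj ?s)"
      unfolding cnj_sum sum_product by (simp add: sum_distrib_left)
    finally show ?thesis unfolding of_real_mult by (subst complex_norm_square) simp
  qed
  then show ?thesis unfolding psd_iff using assms by (auto intro!: hermitianI[of _ n])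
qed

lemma sum_two_deltas:
  fixes a b n :: nat
  assumes "a < n" "b < n"
  shows "(\<Sum>i<n. ((if i = a then 1 else 0) + w * (if i = b then 1 else 0)) * f i) = f a + (w :: complex) * f b"
proof -
  have "(\<Sum>i<n. ((if i = a then 1 else 0) + w * (if i = b then 1 else 0)) * f i)
    = (\<Sum>i<n. (if i = a then f i else 0) + (if i = b then w * f i else 0))"
    by (intro sum.cong) (auto simp: algebra_simps)
  also have "\<dots> = f a + w * f b" using assms by (simp add: sum.distrib)
  finally show ?thesis .
qed

lemma mtrace_rank_one_two_deltas:
  fixes X :: "complex mat"
  assumes X: "X \<in> carrier_mat d d" and ab: "a < d" "b < d" and w: "w * cnj w = 1"
  defines "g \<equiv> \<lambda>i. (if i = a then 1 else 0) + w * (if i = b then 1 else 0)"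
  shows "mtrace (mat d d (\<lambda>(i,j). c * (g i * cnj (g j))) * X)
    = c * (X $$ (a,a) + X $$ (b,b) + w * X $$ (a,b) + cnj w * X $$ (b,a))"
proof -
  have inner: "(\<Sum>j<d. cnj (g j) * X $$ (j,i)) = X $$ (a,i) + cnj w * X $$ (b,i)" for i
  proof -
    have "(\<Sum>j<d. cnj (g j) * X $$ (j,i)) = (\<Sum>j<d. ((if j = a then 1 else 0) + cnj w * (if j = b then 1 else 0)) * X $$ (j,i))"
      by (intro sum.cong) (auto simp: g_def)
    then show ?thesis unfolding sum_two_deltas[OF ab] .
  qed
  have "mtrace (mat d d (\<lambda>(i,j). c * (g i * cnj (g j))) * X) = (\<Sum>i<d. \<Sum>j<d. c * (g i * (cnj (g j) * X $$ (j,i))))"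
    by (subst mtrace_mult[of _ d d]) (use X in \<open>auto simp: mult_ac intro!: sum.cong\<close>)
  also have "\<dots> = c * (\<Sum>i<d. g i * (X $$ (a,i) + cnj w * X $$ (b,i)))"
    by (simp add: sum_distrib_left[symmetric] inner)
  also have "(\<Sum>i<d. g i * (X $$ (a,i) + cnj w * X $$ (b,i))) = X $$ (a,a) + cnj w * X $$ (b,a) + w * (X $$ (a,b) + cnj w * X $$ (b,b))"
    unfolding g_def by (rule sum_two_deltas[OF ab])
  also have "\<dots> = X $$ (a,a) + cnj w * X $$ (b,a) + w * X $$ (a,b) + (w * cnj w) * X $$ (b,b)"
    by (simp add: algebra_simps)
  finally show ?thesis unfolding w by (simp add: algebra_simps)
qed

text \<open>The sums of \<i>^k, of its conjugates and of \<i>^(2k) over k < 4 vanish, so only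
  products of opposite phases and the constant term survive.\<close>

lemma fourth_roots_sum:
  fixes P U V p A B r :: complex
  shows "(\<Sum>k<4. (P + U + \<i> ^ k * V + cnj (\<i> ^ k) * A) * (p + r * (cnj (\<i> ^ k) * B + \<i> ^ k * q)))
    = 4 * (P + U) * p + 4 * r * (V * B + A * q)"
  by (simp add: eval_nat_numeral algebra_simps)

text \<open>Polarization: with \<open>g = e\<^sub>a + i\<^sup>k e\<^sub>b\<close>, the rank-one matrices \<open>g g\<^sup>*\<close> (\<open>a, b < d\<close>, \<open>k < 4\<close>) add up to
  \<open>8 d\<close> times the identity and span all matrices, so any \<open>\<chi>\<close> is a combination of the functionals
  \<open>X \<mapsto> tr (g g\<^sup>* X)\<close> with hermitian coefficients close to \<open>\<rho>\<close>.\<close>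
lemma near_depolarizing_holevo:
  assumes \<rho>: "psd d \<rho>" "det \<rho> \<noteq> 0" and d: "0 < d"
  obtains \<epsilon> where "0 < \<epsilon>" "\<And>\<chi>. ptp d \<chi> \<Longrightarrow>
    (\<And>a b i j. a < d \<Longrightarrow> b < d \<Longrightarrow> i < d \<Longrightarrow> j < d \<Longrightarrow>
      cmod (\<chi> (mat_unit d a b) $$ (i,j) - (if a = b then \<rho> $$ (i,j) else 0)) < \<epsilon>) \<Longrightarrow> holevo d \<chi>"
proof -
  obtain \<delta> where \<delta>: "0 < \<delta>" and pert: "\<And>H. H \<in> carrier_mat d d \<Longrightarrow> mat_adjoint H = H \<Longrightarrow>
    (\<And>i j. i < d \<Longrightarrow> j < d \<Longrightarrow> cmod (H $$ (i,j)) \<le> \<delta>) \<Longrightarrow> psd d (\<rho> + H)"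
    using psd_perturb[OF \<rho>] by blast
  note r = psdD[OF \<rho>(1)]
  \<comment> \<open>The matrices \<open>H\<close> below consist of two terms of modulus less than
    \<epsilon>, multiplied by \<open>d\<close>.\<close>
  define \<epsilon> where "\<epsilon> = \<delta> / (2 * real d)"
  have \<epsilon>: "0 < \<epsilon>" using \<delta> d by (simp add: \<epsilon>_def)
  have "holevo d \<chi>" if \<chi>: "ptp d \<chi>"
    and close: "\<And>a b i j. a < d \<Longrightarrow> b < d \<Longrightarrow> i < d \<Longrightarrow> j < d \<Longrightarrow>
      cmod (\<chi> (mat_unit d a b) $$ (i,j) - (if a = b then \<rho> $$ (i,j) else 0)) < \<epsilon>" for \<chi>
  proof -
    note ph = ptpD[OF \<chi>]
    define D where "D a b i j = \<chi> (mat_unit d a b) $$ (i,j) - (if a = b then \<rho> $$ (i,j) else 0)" for a b i j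
    have Dsym: "D b a j i = cnj (D a b i j)" if "a < d" "b < d" "i < d" "j < d" for a b i j
    proof -
      have "mat_adjoint (mat_unit d a b) = mat_unit d b a" by (rule eq_matI) auto
      then have "\<chi> (mat_unit d b a) = mat_adjoint (\<chi> (mat_unit d a b))"
        using ph(4)[OF mat_unit_carrier, of a b] by simp
      then have "\<chi> (mat_unit d b a) $$ (j,i) = cnj (\<chi> (mat_unit d a b) $$ (i,j))"
        using ph(5)[OF mat_unit_carrier, of a b] that by simp
      then show ?thesis using psd_herm[OF \<rho>(1) that(3,4)] by (simp add: D_def)
    qed
    define w where "w k = \<i> ^ k" for k :: nat
    have ww: "w k * cnj (w k) = 1" for k
      using complex_norm_square[of "w k"] by (simp add: w_def norm_power)
    have cw: "cmod (w k) = 1" for k by (simp add: w_def norm_power)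
    \<comment> \<open>Summing 4 (X_aa + X_bb) over all a and b gives 8 d tr X, which
      \<open>c\<close> has to scale back to tr X.\<close>
    define c where "c = 1 / (8 * real d)"
    define g where "g a b k i = (if i = a then 1 else 0) + w k * (if i = b then 1 else 0)" for a b k and i :: nat
    define E where "E = (\<lambda>(a,b,k). mat d d (\<lambda>(i,j). complex_of_real c * (g a b k i * cnj (g a b k j))))"
    \<comment> \<open>The phases are opposite to those in tr (E X), so that summation over k pairs
      X_ab with \<open>D a b\<close> and X_ba with \<open>D b a\<close>. Each \<open>D a b\<close>
      is thus met twice with weight 4, and the factor \<open>d\<close> completes 8 d c = 1.\<close>
    define H where "H = (\<lambda>(a,b,k). mat d d (\<lambda>(i,j). of_nat d * (cnj (w k) * D a b i j + w k * D b a i j)))"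
    define S where "S = {..<d} \<times> {..<d} \<times> {..<4::nat}"
    have H: "psd d (\<rho> + H s)" if "s \<in> S" for s
    proof -
      obtain a b k where s: "s = (a,b,k)" and ab: "a < d" "b < d" using \<open>s \<in> S\<close> by (auto simp: S_def)
      have "mat_adjoint (H s) = H s"
      proof (rule hermitianI[of _ d])
        fix i j assume ij: "i < d" "j < d"
        show "H s $$ (j,i) = cnj (H s $$ (i,j))"
          using ij Dsym[OF ab ij] Dsym[OF ab(2,1) ij] by (simp add: s H_def add.commute)
      qed (simp add: s H_def)
      moreover have "cmod (H s $$ (i,j)) \<le> \<delta>" if ij: "i < d" "j < d" for i j
      proof -
        have "cmod (H s $$ (i,j)) = real d * cmod (cnj (w k) * D a b i j + w k * D b a i j)"
          using ij by (simp add: s H_def norm_mult)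
        also have "\<dots> \<le> real d * (cmod (D a b i j) + cmod (D b a i j))"
          by (intro mult_left_mono order_trans[OF norm_triangle_ineq]) (auto simp: norm_mult cw)
        also have "\<dots> \<le> real d * (\<epsilon> + \<epsilon>)"
          using close[OF ab ij] close[OF ab(2,1) ij] unfolding D_def by (intro mult_left_mono add_mono) auto
        also have "\<dots> = \<delta>" using d by (simp add: \<epsilon>_def)
        finally show ?thesis .
      qed
      ultimately show ?thesis by (intro pert) (auto simp: s H_def)
    qed
    show ?thesis
    proof (rule holevoI[of S d E "\<lambda>s. \<rho> + H s"])
      show "finite S" by (simp add: S_def)
      show "psd d (E s)" if "s \<in> S" for s
        using psd_rank_one[of c d] by (auto simp: E_def c_def split: prod.splits)
      show "psd d (\<rho> + H s)" if "s \<in> S" for s by (rule H[OF that])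
      fix X :: "complex mat" assume X: "X \<in> carrier_mat d d"
      show "\<chi> X \<in> carrier_mat d d" by (rule ph(5)[OF X])
      fix i j assume ij: "i < d" "j < d"
      have "(\<Sum>s\<in>S. mtrace (E s * X) * (\<rho> + H s) $$ (i,j))
        = (\<Sum>a<d. \<Sum>b<d. \<Sum>k<4. mtrace (E (a,b,k) * X) * (\<rho> + H (a,b,k)) $$ (i,j))"
        unfolding S_def by (simp add: sum.cartesian_product split_def)
      also have "\<dots> = (\<Sum>a<d. \<Sum>b<d. of_real c * (4 * (X $$ (a,a) + X $$ (b,b)) * \<rho> $$ (i,j)
          + 4 * of_nat d * (X $$ (a,b) * D a b i j + X $$ (b,a) * D b a i j)))"
      proof (intro sum.cong refl)
        fix a b assume "a \<in> {..<d}" "b \<in> {..<d}"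
        then have ab: "a < d" "b < d" by auto
        have "(\<Sum>k<4. mtrace (E (a,b,k) * X) * (\<rho> + H (a,b,k)) $$ (i,j))
          = (\<Sum>k<4. of_real c * ((X $$ (a,a) + X $$ (b,b) + \<i> ^ k * X $$ (a,b) + cnj (\<i> ^ k) * X $$ (b,a))
              * (\<rho> $$ (i,j) + of_nat d * (cnj (\<i> ^ k) * D a b i j + \<i> ^ k * D b a i j))))"
        proof (intro sum.cong refl)
          fix k
          have "mtrace (E (a,b,k) * X) = of_real c * (X $$ (a,a) + X $$ (b,b) + w k * X $$ (a,b) + cnj (w k) * X $$ (b,a))"
            unfolding E_def prod.case g_def by (rule mtrace_rank_one_two_deltas[OF X ab ww])
          moreover have "(\<rho> + H (a,b,k)) $$ (i,j) = \<rho> $$ (i,j) + of_nat d * (cnj (w k) * D a b i j + w k * D b a i j)"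
            using r(1) ij by (simp add: H_def)
          ultimately show "mtrace (E (a,b,k) * X) * (\<rho> + H (a,b,k)) $$ (i,j)
            = of_real c * ((X $$ (a,a) + X $$ (b,b) + \<i> ^ k * X $$ (a,b) + cnj (\<i> ^ k) * X $$ (b,a))
              * (\<rho> $$ (i,j) + of_nat d * (cnj (\<i> ^ k) * D a b i j + \<i> ^ k * D b a i j)))"
            unfolding w_def by (simp only: mult.assoc)
        qed
        then show "(\<Sum>k<4. mtrace (E (a,b,k) * X) * (\<rho> + H (a,b,k)) $$ (i,j))
          = of_real c * (4 * (X $$ (a,a) + X $$ (b,b)) * \<rho> $$ (i,j)
          + 4 * of_nat d * (X $$ (a,b) * D a b i j + X $$ (b,a) * D b a i j))"
          unfolding sum_distrib_left[symmetric] fourth_roots_sum .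
      qed
      also have "\<dots> = of_real c * (8 * of_nat d * mtrace X * \<rho> $$ (i,j)
          + 8 * of_nat d * (\<Sum>a<d. \<Sum>b<d. X $$ (a,b) * D a b i j))"
      proof -
        have t: "(\<Sum>a<d. \<Sum>b<d. X $$ (a,a) + X $$ (b,b)) = 2 * of_nat d * mtrace X"
          using X by (simp add: mtrace_def sum.distrib sum_distrib_left mult.assoc)
        have sw: "(\<Sum>a<d. \<Sum>b<d. X $$ (b,a) * D b a i j) = (\<Sum>a<d. \<Sum>b<d. X $$ (a,b) * D a b i j)"
          by (rule sum.swap)
        have "(\<Sum>a<d. \<Sum>b<d. of_real c * (4 * (X $$ (a,a) + X $$ (b,b)) * \<rho> $$ (i,j)
          + 4 * of_nat d * (X $$ (a,b) * D a b i j + X $$ (b,a) * D b a i j)))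
          = of_real c * (4 * (\<Sum>a<d. \<Sum>b<d. X $$ (a,a) + X $$ (b,b)) * \<rho> $$ (i,j)
            + 4 * of_nat d * ((\<Sum>a<d. \<Sum>b<d. X $$ (a,b) * D a b i j) + (\<Sum>a<d. \<Sum>b<d. X $$ (b,a) * D b a i j)))"
          by (simp only: sum_distrib_left sum_distrib_right sum.distrib distrib_left distrib_right)
        then show ?thesis unfolding t sw by (simp add: algebra_simps)
      qed
      also have "\<dots> = mtrace X * \<rho> $$ (i,j) + (\<Sum>a<d. \<Sum>b<d. X $$ (a,b) * D a b i j)"
        using d by (simp add: c_def field_simps)
      also have "mtrace X * \<rho> $$ (i,j) = (\<Sum>a<d. \<Sum>b<d. X $$ (a,b) * (if a = b then \<rho> $$ (i,j) else 0))"
      proof -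
        have "(\<Sum>a<d. \<Sum>b<d. X $$ (a,b) * (if a = b then \<rho> $$ (i,j) else 0)) = (\<Sum>a<d. X $$ (a,a) * \<rho> $$ (i,j))"
        proof (intro sum.cong refl)
          fix a assume "a \<in> {..<d}"
          have "(\<Sum>b<d. X $$ (a,b) * (if a = b then \<rho> $$ (i,j) else 0)) = (\<Sum>b<d. if b = a then X $$ (a,b) * \<rho> $$ (i,j) else 0)"
            by (intro sum.cong) auto
          then show "(\<Sum>b<d. X $$ (a,b) * (if a = b then \<rho> $$ (i,j) else 0)) = X $$ (a,a) * \<rho> $$ (i,j)"
            using \<open>a \<in> {..<d}\<close> by simp
        qed
        then show ?thesis using X by (simp add: mtrace_def sum_distrib_right)
      qed
      also have "(\<Sum>a<d. \<Sum>b<d. X $$ (a,b) * (if a = b then \<rho> $$ (i,j) else 0)) + (\<Sum>a<d. \<Sum>b<d. X $$ (a,b) * D a b i j)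
        = (\<Sum>a<d. \<Sum>b<d. X $$ (a,b) * \<chi> (mat_unit d a b) $$ (i,j))"
        unfolding sum.distrib[symmetric] by (intro sum.cong refl) (simp add: D_def algebra_simps)
      also have "\<dots> = \<chi> X $$ (i,j)" by (rule linear_map_expand[OF ph(1) X ij, symmetric])
      finally show "\<chi> X $$ (i,j) = (\<Sum>s\<in>S. mtrace (E s * X) * (\<rho> + H s) $$ (i,j))" by simp
    qed
  qed
  with \<epsilon> that show ?thesis by blast
qed

subsection \<open>The multiplicity of the eigenvalue zero\<close>

text \<open>In the Leibniz expansion of the characteristic polynomial, a permutation with a nonzero product must
  preserve \<open>S\<^sub>0\<close> and then fix every element of \<open>S\<^sub>1\<close>, each of which contributes a factor \<open>X\<close>.\<close>
lemma char_poly_zero_columns: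
  fixes M :: "complex mat"
  assumes M: "M \<in> carrier_mat N N" and S: "S0 \<subseteq> {..<N}" "S1 \<subseteq> {..<N}" "S0 \<inter> S1 = {}"
    and z: "\<And>p q. p < N \<Longrightarrow> q \<in> S0 \<union> S1 \<Longrightarrow> p \<notin> S0 \<Longrightarrow> M $$ (p,q) = 0"
  shows "[:0, 1:] ^ card S1 dvd char_poly M"
proof -
  let ?C = "char_poly_matrix M"
  have C: "?C \<in> carrier_mat N N" using M by simp
  have Cij: "?C $$ (i,j) = (if i = j then [:- M $$ (i,j), 1:] else [:- M $$ (i,j):])" if "i < N" "j < N" for i j
    using M that by (simp add: char_poly_matrix_def)
  have "[:0, 1:] ^ card S1 dvd signof \<pi> * (\<Prod>i = 0..<N. ?C $$ (i, \<pi> i))" if \<pi>: "\<pi> permutes {0..<N}" for \<pi>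
  proof (cases "\<exists>i<N. ?C $$ (i, \<pi> i) = 0")
    case True
    then have "(\<Prod>i = 0..<N. ?C $$ (i, \<pi> i)) = 0" by auto
    then show ?thesis by (metis dvd_0_right mult_zero_right)
  next
    case False
    then have nz: "?C $$ (i, \<pi> i) \<noteq> 0" if "i < N" for i using that by auto
    have lt: "\<pi> i < N" if "i < N" for i using permutes_in_image[OF \<pi>, of i] that by simp
    have inj: "inj \<pi>" by (rule permutes_inj[OF \<pi>])
    have pre: "i \<in> S0" if "i < N" "\<pi> i \<in> S0" for i
    proof (rule ccontr)
      assume "i \<notin> S0"
      then have "\<pi> i \<noteq> i" "M $$ (i, \<pi> i) = 0" using that z[of i "\<pi> i"] by auto
      then show False using nz[OF that(1)] Cij[OF that(1) lt[OF that(1)]] by simp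
    qed
    \<comment> \<open>\<open>T\<close> is the preimage of \<open>S0\<close>. It lies inside
      \<open>S0\<close> and has as many elements, so it is all of \<open>S0\<close>, and no index
      outside \<open>S0\<close> is sent into it.\<close>
    define T where "T = {i. i < N \<and> \<pi> i \<in> S0}"
    have fS0: "finite S0" using S(1) finite_subset by blast
    have "\<pi> ` T = S0"
    proof
      show "S0 \<subseteq> \<pi> ` T"
      proof
        fix q assume q: "q \<in> S0"
        then have "q \<in> \<pi> ` {0..<N}" using permutes_image[OF \<pi>] S(1) by auto
        then show "q \<in> \<pi> ` T" using q by (auto simp: T_def)
      qed
    qed (auto simp: T_def)
    then have "card T = card S0" using inj by (metis card_image inj_on_subset subset_UNIV)
    moreover have "T \<subseteq> S0" using pre by (auto simp: T_def)
    ultimately have T: "T = S0" using fS0 card_subset_eq by blast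
    have fixed: "?C $$ (q, \<pi> q) = [:0, 1:]" if q: "q \<in> S1" for q
    proof -
      have "q \<in> \<pi> ` {0..<N}" using permutes_image[OF \<pi>] S(2) q by auto
      then obtain i where i: "i < N" "q = \<pi> i" by auto
      have "i \<notin> S0" using T i q S(3) by (auto simp: T_def)
      then have m: "M $$ (i, q) = 0" using z[OF i(1), of q] q by auto
      then have "i = q" using nz[OF i(1)] Cij[OF i(1) lt[OF i(1)]] i(2) by (auto split: if_splits)
      then have "\<pi> q = q" "q < N" "M $$ (q, q) = 0" using i m by auto
      then show ?thesis using Cij[of q q] by simp
    qed
    have "[:0, 1:] ^ card S1 = (\<Prod>q\<in>S1. ?C $$ (q, \<pi> q))" using fixed by simp
    also have "\<dots> dvd (\<Prod>i = 0..<N. ?C $$ (i, \<pi> i))"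
      using S(2) by (intro prod_dvd_prod_subset) auto
    finally show ?thesis by (rule dvd_mult)
  qed
  then show ?thesis unfolding char_poly_def det_def'[OF C] by (intro dvd_sum) auto
qed

text \<open>A unitary change of basis of the underlying space is a similarity of
  \<open>rep_mat\<close>, so the multiplicity of zero can be computed in an eigenbasis of the fixed
  point.\<close>

lemma rep_mat_sandwich_conj:
  assumes \<psi>: "linear_map_mat d \<psi>" and U: "unitary_mat d U"
  shows "char_poly (rep_mat d (sandwich (mat_adjoint U) \<circ> (\<psi> \<circ> sandwich U))) = char_poly (rep_mat d \<psi>)"
proof -
  note u = unitary_matD[OF U]
  let ?P = "rep_mat d (sandwich (mat_adjoint U))" and ?Q = "rep_mat d (sandwich U)"
  note l = linear_sandwich[OF u(1)] linear_sandwich[OF u(2)]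
  have 1: "rep_mat d (sandwich (mat_adjoint U) \<circ> (\<psi> \<circ> sandwich U)) = ?P * (rep_mat d \<psi> * ?Q)"
    using rep_mat_comp[OF l(2) linear_map_comp[OF \<psi> l(1)]] rep_mat_comp[OF \<psi> l(1)] by simp
  have id: "rep_mat d \<chi> = 1\<^sub>m (d*d)" if "\<And>a b. \<chi> (mat_unit d a b) = mat_unit d a b" for \<chi>
    using that rep_mat_id[of d] by (simp add: rep_mat_def)
  have 2: "?P * ?Q = 1\<^sub>m (d*d)" "?Q * ?P = 1\<^sub>m (d*d)"
    unfolding rep_mat_comp[OF l(2,1), symmetric] rep_mat_comp[OF l, symmetric]
    by (auto intro!: id sandwich_unitary[OF U])
  have "similar_mat (rep_mat d (sandwich (mat_adjoint U) \<circ> (\<psi> \<circ> sandwich U))) (rep_mat d \<psi>)"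
    unfolding similar_mat_def similar_mat_wit_def Let_def 1
    by (rule exI[of _ ?P], rule exI[of _ ?Q])
      (use 2 assoc_mult_mat[OF rep_mat_carrier rep_mat_carrier rep_mat_carrier, of d]
        mult_carrier_mat[OF rep_mat_carrier mult_carrier_mat[OF rep_mat_carrier rep_mat_carrier], of d]
        in \<open>simp add: carrier_matD[OF rep_mat_carrier]\<close>)
  then show ?thesis by (rule char_poly_similar)
qed

text \<open>A term \<open>tr (E\<^sub>l X) R\<^sub>l\<close> with \<open>tr (E\<^sub>l D) \<noteq> 0\<close> has \<open>R\<^sub>l\<close> supported where \<open>D\<close> is, since \<open>D\<close> is fixed; all other
  terms do not see the rows and columns in which \<open>D\<close> is nonzero.\<close>
lemma holevo_fixed_diag_support:
  assumes hol: "holevo d \<psi>" and f: "\<And>i. i < d \<Longrightarrow> 0 \<le> f i" and fixd: "\<psi> (real_diag d f) = real_diag d f"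
    and ab: "a < d" "b < d" "0 < f a \<or> 0 < f b" and ij: "i < d" "j < d" "f i = 0 \<or> f j = 0"
  shows "\<psi> (mat_unit d a b) $$ (i,j) = 0"
proof -
  obtain N :: nat and E R where ER: "\<And>l. l < N \<Longrightarrow> psd d (E l)" "\<And>l. l < N \<Longrightarrow> psd d (R l)"
    and eq: "\<And>X. X \<in> carrier_mat d d \<Longrightarrow> \<psi> X = mat d d (\<lambda>(i,j). \<Sum>l<N. mtrace (E l * X) * R l $$ (i,j))"
    using hol unfolding holevo_def by blast
  have trD: "mtrace (E l * real_diag d f) = of_real (\<Sum>c<d. f c * Re (E l $$ (c,c)))" if l: "l < N" for l
  proof -
    have "mtrace (E l * real_diag d f) = (\<Sum>c<d. \<Sum>k<d. if k = c then E l $$ (c,c) * of_real (f c) else 0)"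
      unfolding mtrace_mult[OF psdD(1)[OF ER(1)[OF l]] real_diag_carrier] by (intro sum.cong) auto
    also have "\<dots> = (\<Sum>c<d. of_real (f c * Re (E l $$ (c,c))))"
    proof (intro sum.cong refl)
      fix c assume c: "c \<in> {..<d}"
      then have "E l $$ (c,c) * of_real (f c) = of_real (Re (E l $$ (c,c))) * of_real (f c)"
        using psd_diag_entry(3)[OF ER(1)[OF l], of c] by (metis lessThan_iff)
      then show "(\<Sum>k<d. if k = c then E l $$ (c,c) * of_real (f c) else 0) = of_real (f c * Re (E l $$ (c,c)))"
        using c by (simp add: mult.commute)
    qed
    finally show ?thesis by simp
  qed
  \<comment> \<open>A nonzero off-diagonal entry of a positive \<open>E l\<close> forces both
    diagonal entries in its row and column to be positive. One of them meets a positive entry of the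
    fixed diagonal matrix, so this term has positive weight.\<close>
  have Rzero: "R l $$ (i,j) = 0" if l: "l < N" and nz: "E l $$ (b,a) \<noteq> 0" for l
  proof -
    note e = psd_diag_entry[OF ER(1)[OF l]]
    have "E l $$ (a,a) \<noteq> 0" "E l $$ (b,b) \<noteq> 0"
      using psd_zero_diag_row[OF ER(1)[OF l] ab(1,2)] psd_zero_diag_row[OF ER(1)[OF l] ab(2,1)] nz by auto
    then have "0 < Re (E l $$ (a,a))" "0 < Re (E l $$ (b,b))"
      using e[OF ab(1)] e[OF ab(2)] by (metis less_eq_real_def of_real_0)+
    then obtain c where c: "c < d" "0 < f c" "0 < Re (E l $$ (c,c))" using ab by auto
    have t: "0 < (\<Sum>c<d. f c * Re (E l $$ (c,c)))"
      using c f e(1) by (intro sum_pos2[of _ c]) auto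
    \<comment> \<open>A zero diagonal entry of the fixed matrix is a sum of nonnegative
      contributions, all of which must vanish; the \<open>l\<close>-th has positive weight
      \<open>t\<close>.\<close>
    have diag: "R l $$ (k,k) = 0" if k: "k < d" "f k = 0" for k
    proof -
      have "0 = Re (\<psi> (real_diag d f) $$ (k,k))" unfolding fixd using k by simp
      also have "\<dots> = (\<Sum>m<N. (\<Sum>c<d. f c * Re (E m $$ (c,c))) * Re (R m $$ (k,k)))"
        unfolding eq[OF real_diag_carrier] using k trD by simp
      finally have s: "(\<Sum>m<N. (\<Sum>c<d. f c * Re (E m $$ (c,c))) * Re (R m $$ (k,k))) = 0" by simp
      have "0 \<le> (\<Sum>c<d. f c * Re (E m $$ (c,c))) * Re (R m $$ (k,k))" if "m \<in> {..<N}" for m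
        using that f psd_diag_entry(1)[OF ER(1)] psd_diag_entry(1)[OF ER(2) k(1)]
        by (intro mult_nonneg_nonneg sum_nonneg) auto
      then have "(\<Sum>c<d. f c * Re (E l $$ (c,c))) * Re (R l $$ (k,k)) = 0"
        using s l sum_nonneg_eq_0_iff[of "{..<N}" "\<lambda>m. (\<Sum>c<d. f c * Re (E m $$ (c,c))) * Re (R m $$ (k,k))"] by auto
      then have "Re (R l $$ (k,k)) = 0" using t by simp
      then show ?thesis using psd_diag_entry(3)[OF ER(2)[OF l] k(1)] by simp
    qed
    show ?thesis
      using ij psd_zero_diag_row[OF ER(2)[OF l] ij(1,2) diag[OF ij(1)]] psd_zero_diag_row[OF ER(2)[OF l] ij(2,1) diag[OF ij(2)]] by auto
  qed
  have "\<psi> (mat_unit d a b) $$ (i,j) = (\<Sum>l<N. E l $$ (b,a) * R l $$ (i,j))"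
    unfolding eq[OF mat_unit_carrier] using ij mtrace_mat_unit(2)[OF psdD(1)[OF ER(1)] ab(1,2)] by simp
  also have "\<dots> = 0" using Rzero by (intro sum.neutral) auto
  finally show ?thesis .
qed

lemma holevo_semipositive_imp_zero_mult:
  assumes l: "linear_map_mat d \<psi>" and hol: "holevo d \<psi>" and sp: "has_semipositive_fixed_point d \<psi>"
  shows "2 * (d - 1) \<le> alg_mult d \<psi> 0"
proof -
  obtain A where A: "psd d A" "A \<noteq> 0\<^sub>m d d" "det A = 0" "\<psi> A = A"
    using sp unfolding has_semipositive_fixed_point_def semipositive_fixed_point_def by blast
  obtain U f where U: "unitary_mat d U" and AU: "A = sandwich U (real_diag d f)" and f: "\<And>i. i < d \<Longrightarrow> 0 \<le> f i"
    using psd_spectral[OF A(1)] unfolding sandwich_def by blast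
  note u = unitary_matD[OF U]
  define \<chi> where "\<chi> = sandwich (mat_adjoint U) \<circ> (\<psi> \<circ> sandwich U)"
  have hol\<chi>: "holevo d \<chi>" unfolding \<chi>_def
    by (intro holevo_comp holevo_precomp_sandwich hol u(1) linear_sandwich u(2))
      (unfold sandwich_def, rule psd_conj[OF _ u(2)])
  have fix\<chi>: "\<chi> (real_diag d f) = real_diag d f"
    unfolding \<chi>_def using A(4) sandwich_unitary(1)[OF U, of "real_diag d f"] by (simp add: AU)
  define I where "I = {i. i < d \<and> 0 < f i}"
  define J where "J = {i. i < d \<and> f i = 0}"
  have IJ: "I \<union> J = {..<d}" "I \<inter> J = {}" using f by (auto simp: I_def J_def less_le)
  have fin: "finite I" "finite J" by (auto simp: I_def J_def)
  have "J \<noteq> {}"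
  proof
    assume "J = {}"
    then have "0 < f i" if "i < d" for i using f[OF that] that by (auto simp: J_def less_le)
    then have "0 < (\<Prod>i<d. f i)" by (intro prod_pos) auto
    then show False using A(3) unfolding AU sandwich_def det_spectral[OF U] of_real_eq_0_iff by simp
  qed
  moreover have "I \<noteq> {}"
  proof
    assume "I = {}"
    then have "real_diag d f = 0\<^sub>m d d" using f by (intro eq_matI) (auto simp: I_def less_le)
    then show False using A(2) linear_map_zero[OF linear_sandwich[OF u(1)]] unfolding AU by simp
  qed
  ultimately have c1: "1 \<le> card I" "1 \<le> card J" using fin by (simp_all add: Suc_le_eq card_gt_0_iff)
  have cd: "card I + card J = d" using card_Un_disjoint[OF fin IJ(2)] IJ(1) by simp
  \<comment> \<open>With \<open>I\<close> the support of the fixed point, \<open>S0\<close> codes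
    the corner I x I and \<open>S1\<close> the two off-diagonal blocks.\<close>
  define S0 where "S0 = {p. p < d*d \<and> p div d \<in> I \<and> p mod d \<in> I}"
  define S1 where "S1 = {p. p < d*d \<and> (p div d \<in> I) \<noteq> (p mod d \<in> I)}"
  have M0: "rep_mat d \<chi> $$ (p,q) = 0" if p: "p < d*d" "p \<notin> S0" and q: "q \<in> S0 \<union> S1" for p q
  proof -
    have qd: "q < d*d" using q by (auto simp: S0_def S1_def)
    note lt = div_mod_lt[OF p(1)] div_mod_lt[OF qd]
    have "f (p div d) = 0 \<or> f (p mod d) = 0" using p lt f[of "p div d"] f[of "p mod d"] by (auto simp: S0_def I_def less_le)
    moreover have "0 < f (q div d) \<or> 0 < f (q mod d)" using q by (auto simp: S0_def S1_def I_def)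
    ultimately have "\<chi> (mat_unit d (q div d) (q mod d)) $$ (p div d, p mod d) = 0"
      using holevo_fixed_diag_support[OF hol\<chi> f fix\<chi>] lt by blast
    then show ?thesis using p qd by (simp add: rep_mat_def)
  qed
  have "[:0, 1:] ^ card S1 dvd char_poly (rep_mat d \<chi>)"
    by (rule char_poly_zero_columns[OF rep_mat_carrier, of S0]) (use M0 in \<open>auto simp: S0_def S1_def\<close>)
  then have "[:- 0, 1:] ^ card S1 dvd char_poly (rep_mat d \<psi>)"
    unfolding \<chi>_def rep_mat_sandwich_conj[OF l U] by simp
  then have le: "card S1 \<le> alg_mult d \<psi> 0"
    unfolding order_divides alg_mult_def using char_poly_rep_mat_nonzero by blast
  have inj: "inj_on (\<lambda>(i,j). i * d + j) ({..<d} \<times> {..<d})"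
  proof (rule inj_onI, clarsimp)
    fix i j i' j' assume h: "i < d" "j < d" "i' < d" "j' < d" and e: "i * d + j = i' * d + j'"
    have "i = i'" using arg_cong[OF e, of "\<lambda>p. p div d"] h by simp
    then show "i = i' \<and> j = j'" using e by simp
  qed
  have sub: "(\<lambda>(i,j). i * d + j) ` (I \<times> J \<union> J \<times> I) \<subseteq> S1"
  proof
    fix p assume "p \<in> (\<lambda>(i,j). i * d + j) ` (I \<times> J \<union> J \<times> I)"
    then obtain i j where p: "p = i * d + j" and ij: "(i \<in> I \<and> j \<in> J) \<or> (i \<in> J \<and> j \<in> I)" by auto
    have lt: "i < d" "j < d" using ij by (auto simp: I_def J_def)
    have "p div d = i" "p mod d = j" unfolding p using lt by auto
    moreover have "(i \<in> I) \<noteq> (j \<in> I)" using ij IJ(2) by blast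
    ultimately show "p \<in> S1" unfolding S1_def using index_lt[OF lt] p by simp
  qed
  have "card (I \<times> J \<union> J \<times> I) = 2 * (card I * card J)"
    using IJ(2) fin by (subst card_Un_disjoint) (auto simp: card_cartesian_product)
  moreover have "card ((\<lambda>(i,j). i * d + j) ` (I \<times> J \<union> J \<times> I)) = card (I \<times> J \<union> J \<times> I)"
    by (rule card_image, rule inj_on_subset[OF inj]) (auto simp: I_def J_def)
  moreover have "card ((\<lambda>(i,j). i * d + j) ` (I \<times> J \<union> J \<times> I)) \<le> card S1"
    by (rule card_mono[OF _ sub]) (auto simp: S1_def)
  moreover have "d - 1 \<le> card I * card J"
  proof -
    \<comment> \<open>Here d - 1 = x + y + 1, while the product is x y + x + y + 1.\<close>
    obtain x y where xy: "card I = Suc x" "card J = Suc y" using c1 by (metis Suc_le_D One_nat_def)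
    show ?thesis using cd unfolding xy by (auto simp flip: cd)
  qed
  ultimately show ?thesis using le by linarith
qed

section \<open>The eigenvalue zero of a power\<close>

lemma upper_triangular_pow:
  fixes B :: "complex mat"
  assumes B: "B \<in> carrier_mat n n" "upper_triangular B"
  shows "upper_triangular (B ^\<^sub>m k) \<and> (\<forall>i<n. (B ^\<^sub>m k) $$ (i,i) = (B $$ (i,i)) ^ k)"
proof (induction k)
  case 0
  then show ?case using B by auto
next
  case (Suc k)
  let ?P = "B ^\<^sub>m k"
  have P: "?P \<in> carrier_mat n n" using B by simp
  have ut: "?P $$ (i,j) = 0" "B $$ (i,j) = 0" if "j < i" "i < n" for i j
    using Suc B that P unfolding upper_triangular_def by (auto simp: carrier_matD(1)[OF P] simp del: pow_mat_dim)
  have e: "(B ^\<^sub>m Suc k) $$ (i,j) = (\<Sum>l<n. ?P $$ (i,l) * B $$ (l,j))" if "i < n" "j < n" for i j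
    using mult_mat_index[OF P B(1) that] by simp
  have "(B ^\<^sub>m Suc k) $$ (i,j) = 0" if "i < n" "j < i" for i j
  proof -
    have "?P $$ (i,l) * B $$ (l,j) = 0" if "l < n" for l
      using ut[of l i] ut[of j l] \<open>i < n\<close> \<open>j < i\<close> that by (cases "l < i") auto
    then have "(\<Sum>l<n. ?P $$ (i,l) * B $$ (l,j)) = 0" by (intro sum.neutral) auto
    then show ?thesis using e[of i j] that by simp
  qed
  moreover have "(B ^\<^sub>m Suc k) $$ (i,i) = (B $$ (i,i)) ^ Suc k" if "i < n" for i
  proof -
    have "(B ^\<^sub>m Suc k) $$ (i,i) = (\<Sum>l<n. if l = i then ?P $$ (i,i) * B $$ (i,i) else 0)"
      unfolding e[OF that that]
    proof (intro sum.cong refl)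
      fix l assume "l \<in> {..<n}"
      then show "?P $$ (i,l) * B $$ (l,i) = (if l = i then ?P $$ (i,i) * B $$ (i,i) else 0)"
        using ut[of l i] ut[of i l] that by (cases l i rule: linorder_cases) auto
    qed
    then show ?thesis using Suc that by simp
  qed
  moreover have "dim_row (B ^\<^sub>m Suc k) = n" using B by simp
  ultimately show ?case unfolding upper_triangular_def by (auto simp del: pow_mat.simps)
qed

lemma order_zero_linear_factors:
  "Polynomial.order (0 :: complex) (\<Prod>a\<leftarrow>as. [:- a, 1:]) = length (filter (\<lambda>a. a = 0) as)"
proof (induction as)
  case (Cons a as)
  have nz: "(\<Prod>a\<leftarrow>as. [:- a, 1:]) \<noteq> (0 :: complex poly)" unfolding prod_list_zero_iff by auto
  have "Polynomial.order 0 [:- a, 1:] = (if a = 0 then 1 else 0)"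
    using order_power_n_n[of "0 :: complex" 1] by (auto simp: order_0I)
  moreover have "Polynomial.order 0 ([:- a, 1:] * (\<Prod>a\<leftarrow>as. [:- a, 1:]))
      = Polynomial.order 0 [:- a, 1:] + Polynomial.order 0 (\<Prod>a\<leftarrow>as. [:- a, 1:])"
    using nz by (intro order_mult) (simp only: mult_eq_0_iff, simp)
  ultimately show ?case using Cons by (simp del: mult_pCons_left)
qed (simp add: order_0I)

text \<open>In a triangular form the diagonal of the power consists of the \<open>k\<close>-th
  powers of the diagonal entries, which for \<open>k\<close> at least 1 vanish exactly where the
  entries do.\<close>

lemma order_zero_char_poly_pow:
  fixes A :: "complex mat"
  assumes A: "A \<in> carrier_mat n n" and k: "1 \<le> k"
  shows "Polynomial.order 0 (char_poly (A ^\<^sub>m k)) = Polynomial.order 0 (char_poly A)"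
proof -
  obtain es where "char_poly A = (\<Prod>a\<leftarrow>es. [:- a, 1:])" using char_poly_factorized[OF A] by blast
  from schur_decomposition_exists[OF A this] obtain B where
    B: "B \<in> carrier_mat n n" "upper_triangular B" and sim: "similar_mat A B" by blast
  obtain P Q where wit: "similar_mat_wit A B P Q" using sim unfolding similar_mat_def by blast
  have simk: "similar_mat (A ^\<^sub>m k) (B ^\<^sub>m k)"
    using similar_mat_wit_pow[OF wit, of k] unfolding similar_mat_def by blast
  have Bk: "B ^\<^sub>m k \<in> carrier_mat n n" using B by simp
  note ut = upper_triangular_pow[OF B, of k]
  have d: "diag_mat (B ^\<^sub>m k) = map (\<lambda>a. a ^ k) (diag_mat B)"
    unfolding diag_mat_def carrier_matD(1)[OF Bk] carrier_matD(1)[OF B(1)] using ut by simp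
  have "(\<lambda>a. a ^ k = 0) = (\<lambda>a :: complex. a = 0)" using k by auto
  then have "length (filter (\<lambda>a. a = 0) (diag_mat (B ^\<^sub>m k))) = length (filter (\<lambda>a. a = 0) (diag_mat B))"
    unfolding d filter_map length_map comp_def by simp
  then show ?thesis
    unfolding char_poly_similar[OF simk] char_poly_similar[OF sim]
      char_poly_upper_triangular[OF Bk conjunct1[OF ut]] char_poly_upper_triangular[OF B] order_zero_linear_factors .
qed

lemma alg_mult_zero_funpow:
  assumes "linear_map_mat d \<phi>" "1 \<le> k"
  shows "alg_mult d (\<phi> ^^ k) 0 = alg_mult d \<phi> 0"
  unfolding alg_mult_def rep_mat_funpow[OF assms(1)] by (rule order_zero_char_poly_pow[OF rep_mat_carrier assms(2)])

subsection \<open>Entanglement-saving channels\<close>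

lemma aperiodic_faithful_imp_eventually_entanglement_breaking:
  assumes ch: "quantum_channel d \<phi>" and d: "0 < d"
    and no: "\<not> has_semipositive_fixed_point d \<phi>"
    and aper: "\<And>z. poly (char_poly (rep_mat d \<phi>)) z = 0 \<Longrightarrow> cmod z = 1 \<Longrightarrow> z = 1"
  obtains n where "1 \<le> n" "entanglement_breaking d (\<phi> ^^ n)"
proof -
  have \<phi>: "ptp d \<phi>" by (rule channel_ptp[OF ch d])
  note l = ptpD(1)[OF \<phi>]
  obtain \<rho> where \<rho>: "psd d \<rho>" "det \<rho> \<noteq> 0" "\<phi> \<rho> = \<rho>" "mtrace \<rho> = 1"
    using semipositive_or_faithful_fixed_state[OF \<phi> d no] by blast
  obtain K where KF: "kraus_family d \<phi> (d*d) K" using channel_kraus[OF ch d] by blast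
  \<comment> \<open>A left eigenmatrix for z bounds its modulus by one. On the unit circle only z =
    1 is left, and a traceless fixed point would yield a semipositive one.\<close>
  have gap: "cmod z < 1" if X: "X \<in> carrier_mat d d" "X \<noteq> 0\<^sub>m d d" "\<phi> X = z \<cdot>\<^sub>m X" "mtrace X = 0" for X z
  proof -
    have root: "poly (char_poly (rep_mat d \<phi>)) z = 0" by (rule eigenmatrix_root[OF l X(1-3)])
    obtain u where u: "u \<in> carrier_mat d d" "u \<noteq> 0\<^sub>m d d"
      and eig: "\<And>X. X \<in> carrier_mat d d \<Longrightarrow> mtrace (u * \<phi> X) = z * mtrace (u * X)"
      using rep_mat_left_eigenmatrix[OF l root] by blast
    have "cmod z \<le> 1" using left_eigenmatrix_intertwines(1)[OF \<phi> KF \<rho>(1-3) u eig] .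
    moreover have "cmod z \<noteq> 1"
    proof
      assume "cmod z = 1"
      then have "z = 1" using aper root by blast
      moreover have "1 \<cdot>\<^sub>m X = X" by (rule eq_matI) auto
      ultimately have "\<phi> X = X" using X(3) by simp
      then show False using fixed_trace_zero_imp_semipositive[OF \<phi> X(1,2) _ X(4)] no by blast
    qed
    ultimately show ?thesis by simp
  qed
  obtain \<epsilon> where \<epsilon>: "0 < \<epsilon>" "\<And>\<chi>. ptp d \<chi> \<Longrightarrow>
    (\<And>a b i j. a < d \<Longrightarrow> b < d \<Longrightarrow> i < d \<Longrightarrow> j < d \<Longrightarrow>
      cmod (\<chi> (mat_unit d a b) $$ (i,j) - (if a = b then \<rho> $$ (i,j) else 0)) < \<epsilon>) \<Longrightarrow> holevo d \<chi>"
    using near_depolarizing_holevo[OF \<rho>(1,2) d] by blast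
  show ?thesis
  proof (rule funpow_tendsto_depolarizing[OF \<phi> d psdD(1)[OF \<rho>(1)] \<rho>(3,4) _ \<epsilon>(1)])
    fix n assume n: "1 \<le> n" "\<And>a b i j. a < d \<Longrightarrow> b < d \<Longrightarrow> i < d \<Longrightarrow> j < d \<Longrightarrow>
      cmod ((\<phi> ^^ n) (mat_unit d a b) $$ (i,j) - (if a = b then \<rho> $$ (i,j) else 0)) < \<epsilon>"
    have "holevo d (\<phi> ^^ n)" by (rule \<epsilon>(2)[OF ptp_funpow[OF \<phi>] n(2)])
    then show thesis using that n(1) holevo_imp_entanglement_breaking by blast
  qed (rule gap)
qed

lemma semipositive_or_peripheral_imp_semipositive_power:
  assumes ch: "quantum_channel d \<phi>" and d: "0 < d"
    and "has_semipositive_fixed_point d \<phi> \<or> 2 \<le> peripheral_count d \<phi>"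
  shows "\<exists>n. 1 \<le> n \<and> n \<le> d \<and> has_semipositive_fixed_point d (\<phi> ^^ n)"
proof -
  have \<phi>: "ptp d \<phi>" by (rule channel_ptp[OF ch d])
  have tp: "trace_preserving d \<phi>" using \<phi> unfolding ptp_def by blast
  have one: ?thesis if "has_semipositive_fixed_point d \<phi>"
    using that d by (intro exI[of _ 1]) auto
  consider "has_semipositive_fixed_point d \<phi>" | "2 \<le> alg_mult d \<phi> 1"
    | z where "poly (char_poly (rep_mat d \<phi>)) z = 0" "cmod z = 1" "z \<noteq> 1"
    using assms(3) peripheral_count_ge_2_cases by blast
  then show ?thesis
  proof cases
    case 2
    obtain Y where "Y \<in> carrier_mat d d" "Y \<noteq> 0\<^sub>m d d" "\<phi> Y = Y" "mtrace Y = 0"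
      using double_one_imp_traceless_fixed[OF ptpD(1)[OF \<phi>] tp d 2] by blast
    then show ?thesis using one fixed_trace_zero_imp_semipositive[OF \<phi>] by blast
  qed (use one peripheral_imp_semipositive_power[OF ch d] in blast)+
qed

lemma semipositive_power_imp_entanglement_saving:
  assumes ch: "quantum_channel d \<phi>" and mult: "alg_mult d \<phi> 0 < 2 * (d - 1)"
    and n: "1 \<le> n" "has_semipositive_fixed_point d (\<phi> ^^ n)"
  shows "entanglement_saving d \<phi>"
  unfolding entanglement_saving_def
proof (intro allI impI notI)
  fix m :: nat assume m: "1 \<le> m" and eb: "entanglement_breaking d (\<phi> ^^ m)"
  have d: "0 < d" using mult by simp
  have \<phi>: "ptp d \<phi>" by (rule channel_ptp[OF ch d])
  note l = ptpD(1)[OF \<phi>]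
  have hm: "holevo d (\<phi> ^^ m)" by (rule entanglement_breaking_imp_holevo[OF linear_map_funpow[OF l] d eb])
  \<comment> \<open>Splitting off one factor exhibits the power as a positive map applied after the
    measure-and-prepare map \<open>\<phi> ^^ m\<close>.\<close>
  have "n * m = (n - 1) * m + m" using n(1) by (cases n) auto
  then have "\<phi> ^^ (n * m) = \<phi> ^^ ((n - 1) * m) \<circ> \<phi> ^^ m" by (metis funpow_add)
  then have h: "holevo d (\<phi> ^^ (n * m))"
    using holevo_comp[OF hm ptpD(1,3)[OF ptp_funpow[OF \<phi>]]] by metis
  obtain A where A: "psd d A" "A \<noteq> 0\<^sub>m d d" "det A = 0" "(\<phi> ^^ n) A = A"
    using n(2) unfolding has_semipositive_fixed_point_def semipositive_fixed_point_def by blast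
  have "((\<phi> ^^ n) ^^ m) A = A" using A(4) by (induction m) auto
  then have "(\<phi> ^^ (n * m)) A = A" by (simp add: funpow_mult mult.commute)
  then have "has_semipositive_fixed_point d (\<phi> ^^ (n * m))"
    unfolding has_semipositive_fixed_point_def semipositive_fixed_point_def using A by blast
  from holevo_semipositive_imp_zero_mult[OF linear_map_funpow[OF l] h this]
  have "2 * (d - 1) \<le> alg_mult d (\<phi> ^^ (n * m)) 0" .
  also have "\<dots> = alg_mult d \<phi> 0" using alg_mult_zero_funpow[OF l] n(1) m by simp
  finally show False using mult by simp
qed

theorem mainTheorem8:
  fixes d :: nat and \<phi> :: "complex mat \<Rightarrow> complex mat"
  assumes "quantum_channel d \<phi>"
    and "alg_mult d \<phi> 0 < 2 * (d - 1)"
  shows "(entanglement_saving d \<phi> \<longleftrightarrow>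
            (has_semipositive_fixed_point d \<phi> \<or> peripheral_count d \<phi> \<ge> 2))
       \<and> (entanglement_saving d \<phi> \<longleftrightarrow>
            (\<exists>n. 1 \<le> n \<and> n \<le> d \<and> has_semipositive_fixed_point d (\<phi> ^^ n)))"
proof -
  \<comment> \<open>For \<open>d\<close> equal to 0 or 1 the truncated bound is 0, which no
    multiplicity undercuts.\<close>
  have d: "0 < d" using assms(2) by simp
  have \<phi>: "ptp d \<phi>" by (rule channel_ptp[OF assms(1) d])
  then have l: "linear_map_mat d \<phi>" "trace_preserving d \<phi>" unfolding ptp_def by auto
  \<comment> \<open>The cycle is (1) to (2) here, then (2) to (3) and (3) to (1) by the two
    preceding lemmas.\<close>
  have "has_semipositive_fixed_point d \<phi> \<or> peripheral_count d \<phi> \<ge> 2" if es: "entanglement_saving d \<phi>"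
  proof (rule ccontr)
    assume "\<not> ?thesis"
    then have no: "\<not> has_semipositive_fixed_point d \<phi>" "\<not> 2 \<le> peripheral_count d \<phi>" by auto
    obtain n where "1 \<le> n" "entanglement_breaking d (\<phi> ^^ n)"
      using aperiodic_faithful_imp_eventually_entanglement_breaking[OF assms(1) d no(1)
          peripheral_count_less_2[OF no(2) one_root_char_poly[OF l d]]] by blast
    then show False using es unfolding entanglement_saving_def by blast
  qed
  then show ?thesis
    using semipositive_or_peripheral_imp_semipositive_power[OF assms(1) d]
      semipositive_power_imp_entanglement_saving[OF assms] by blast
qed

end
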